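(* Let $\phi,\overline\phi$, $v_n$, $\mathcal{F}$, $\mathcal{F}_0$ and $\mathcal{M}(\mathcal{F})$ be as described in the context. There exist constants $k_0$ and $k_1$ (depending only on $\phi$ and $\overline\phi$), with \[ k_1=\frac{\lvert\mathcal{F}_0\rvert-13}{2}+\frac{\log(\phi-\overline\phi)}{2\log\phi}, \] such that, as $x\to\infty$, \[ \lvert\mathcal{M}(\mathcal{F})\cap[1,x]\rvert=k_0(\log x)^{k_1}\exp\Bigl(\pi\sqrt{\frac{2\log x}{3\log\phi}}\Bigr)\Bigl(1+O\Bigl(\frac{1}{(\log x)^{1/10}}\Bigr)\Bigr). \]
   Context: Let $\phi$ and $\overline\phi$ be real algebraic integers such that $\phi+\overline\phi$ and $\phi\overline\phi$ are non-zero coprime rational integers and $\phi>\lvert\overline\phi\rvert$. For $n\ge 1$ put $v_n=v_n(\phi,\overline\phi)=(\phi^n-\overline\phi^n)/(\phi-\overline\phi)$; these are positive integers, strictly increasing for $n\ge 2$. A prime $p$ is a primitive divisor of $v_n$ if $p\mid v_n$ but $p\nmid v_1v_2\cdots v_{n-1}$. Let $\mathcal{F}=\{v_n: v_n \text{ has a primitive divisor}\}$ and $\mathcal{F}_0=\{v_n: n\le 12,\ v_n\text{ has a primitive divisor}\}$. (By Carmichael's theorem every $v_n$ with $n\ge 13$ has a primitive divisor, so $\mathcal{F}=\mathcal{F}_0\cup\{v_n:n\ge 13\}$.) Let $\mathcal{M}(\mathcal{F})=\{m_1\cdots m_k: k\ge 0,\ m_j\in\mathcal{F}\}$ be the multiplicative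 monoid generated by $\mathcal{F}$ (the empty product is $1$). Implied constants in $O$-terms may depend on $\phi,\overline\phi$. *)

theory Defs
  imports
    Complex_Main
    "HOL-Computational_Algebra.Computational_Algebra"
    "HOL-Library.Landau_Symbols"
begin

definition lucas_v :: "real \<Rightarrow> real \<Rightarrow> nat \<Rightarrow> real" where
  "lucas_v \<phi> \<psi> n = (\<phi> ^ n - \<psi> ^ n) / (\<phi> - \<psi>)"

text \<open>
  Divisibility in the rational integers for a number given as a real; \<open>dvd\<close> on type
  \<^typ>\<open>real\<close> is trivial, so it cannot be used.
\<close>

definition int_divides :: "nat \<Rightarrow> real \<Rightarrow> bool" where
  "int_divides p x \<longleftrightarrow> (\<exists>k::int. x = of_int k \<and> int p dvd k)"

definition primitive_divisor :: "real \<Rightarrow> real \<Rightarrow> nat \<Rightarrow> nat \<Rightarrow> bool" where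
  "primitive_divisor \<phi> \<psi> p n \<longleftrightarrow>
     prime p \<and> int_divides p (lucas_v \<phi> \<psi> n) \<and> \<not> int_divides p (\<Prod>i=1..<n. lucas_v \<phi> \<psi> i)"

definition lucas_F :: "real \<Rightarrow> real \<Rightarrow> real set" where
  "lucas_F \<phi> \<psi> = {lucas_v \<phi> \<psi> n | n. 1 \<le> n \<and> (\<exists>p. primitive_divisor \<phi> \<psi> p n)}"

definition lucas_F0 :: "real \<Rightarrow> real \<Rightarrow> real set" where
  "lucas_F0 \<phi> \<psi> = {lucas_v \<phi> \<psi> n | n. 1 \<le> n \<and> n \<le> 12 \<and> (\<exists>p. primitive_divisor \<phi> \<psi> p n)}"

definition mult_monoid :: "real set \<Rightarrow> real set" where
  "mult_monoid S = {prod_list ms | ms. set ms \<subseteq> S}"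

end

theory Submission
  imports
    Defs
    "HOL-Probability.Probability"
    "HOL-Number_Theory.Number_Theory"
    "HOL-Real_Asymp.Real_Asymp"
begin

text \<open>
  By Carmichael's theorem all \<open>v\<^sub>n\<close> with \<open>n \<ge> 13\<close> have a primitive divisor, and primitive divisors
  make the monoid free on its generators. Carmichael's theorem follows by comparing two evaluations
  of the homogeneous cyclotomic value \<open>\<Prod> (\<phi> - \<zeta> \<psi>)\<close> over the primitive \<open>n\<close>-th roots of unity \<open>\<zeta>\<close>: factor by
  factor it is at least the value for the pair of the Fibonacci numbers or for the pair \<open>(2, 1)\<close>, hence it
  grows like a power \<open>a ^ totient n\<close>; but without a primitive divisor it is at most \<open>6\<close> or the
  largest prime factor of \<open>n\<close>.

  Up to an exponentially small error the numbers \<open>ln v\<^sub>n / ln \<phi>\<close> are an arithmetic progression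
  \<open>j + b\<close>, so one has to count the partitions of numbers up to \<open>y = ln x / ln \<phi>\<close> into such parts. Give the
  multiplicities \<open>a\<^sub>j\<close> independent geometric distributions with ratios \<open>exp (- s \<lambda>\<^sub>j)\<close>, where
  \<open>s = \<pi> / sqrt (6 y)\<close>. The count is then the generating function at \<open>s\<close> times an expectation that
  only depends on the law of the sum \<open>\<Sum> a\<^sub>j \<lambda>\<^sub>j\<close> near \<open>y\<close>. Convolving with a Gaussian of width
  \<open>s powr (-3/4)\<close>, which is much smaller than the scale \<open>1 / s\<close> on which the count varies, makes the
  characteristic function relevant only for \<open>\<bar>t\<bar> \<le> s powr (7/10)\<close>. There it is either close to that of a
  normal distribution or very small. The generating function itself is obtained from its
  logarithmic derivative, a Riemann sum of \<open>u / (exp u - 1)\<close>.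
\<close>

section \<open>Homogeneous cyclotomic values\<close>

text \<open>The parameter \<open>s\<close> is not the exact saddle point. The mean of the total
  misses \<open>y\<close> by O(1/s), while its standard deviation is of order
  \<open>s powr (-3/2)\<close>; near \<open>y\<close> the normal density is flat to leading order,
  and the explicit value suffices. The power of the logarithm can be read off: the generating
  function contributes \<open>s powr (b - 1/2)\<close>, division by \<open>s\<close> and by the
  standard deviation contributes \<open>s powr (1/2)\<close>, and \<open>s\<close> is proportional
  to \<open>ln x powr (-1/2)\<close>, so the exponent is \<open>- b / 2\<close>. The parts are real
  numbers, and decay of the characteristic function is proved only for frequencies below a constant.
  Hence the count is smoothed instead of being recovered by a direct Fourier inversion. Smoothing
  has a price: the Gaussian of width \<open>h = s powr (-3/4)\<close> has to be cut off at distance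
  \<open>K * h\<close> with \<open>K = s powr (-1/20)\<close>, and moving \<open>y\<close> by that
  much changes the count by a factor 1 + O(\<open>s * K * h\<close>), where
  \<open>s * K * h = s powr (1/5)\<close>. This is the largest error and accounts for the exponent
  1/10 of the theorem.\<close>

lemma divisors_prime_power_mult:
  fixes p a d :: nat
  assumes p: "prime p" and d: "\<not> p dvd d" and d0: "d > 0"
  shows "{e. e dvd p ^ Suc a * d} = {e. e dvd p ^ a * d} \<union> (\<lambda>e. p ^ Suc a * e) ` {e. e dvd d}"
    and "{e. e dvd p ^ a * d} \<inter> (\<lambda>e. p ^ Suc a * e) ` {e. e dvd d} = {}"
proof -
  have p0: "p > 0" using p by (simp add: prime_gt_0_nat)
  have "e \<in> {e. e dvd p ^ a * d} \<union> (\<lambda>e. p ^ Suc a * e) ` {e. e dvd d}" if e: "e dvd p ^ Suc a * d" for e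
  proof -
    have "e \<noteq> 0" using e p0 d0 by (auto intro: ccontr)
    moreover have "\<not> is_unit p" using p by auto
    ultimately obtain f where f: "e = p ^ multiplicity p e * f" "\<not> p dvd f"
      using multiplicity_decompose'[of e p] by metis
    let ?i = "multiplicity p e"
    have "f dvd p ^ Suc a * d" using e f(1) dvd_mult_right[of "p ^ ?i" f] by simp
    moreover have "coprime f (p ^ Suc a)" using f(2) p by (metis coprime_commute coprime_power_right_iff prime_imp_coprime)
    ultimately have fd: "f dvd d" by (simp add: coprime_dvd_mult_right_iff)
    have "p ^ ?i dvd p ^ Suc a * d" using e multiplicity_dvd dvd_trans by blast
    moreover have "coprime (p ^ ?i) d" using d p by (meson coprime_power_left_iff prime_imp_coprime)
    ultimately have "p ^ ?i dvd p ^ Suc a" by (simp add: coprime_dvd_mult_left_iff)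
    then have i: "?i \<le> Suc a" using power_dvd_imp_le[OF _ prime_gt_1_nat[OF p]] by blast
    show ?thesis
    proof (cases "?i = Suc a")
      case True
      then have "e = p ^ Suc a * f" using f(1) by simp
      then show ?thesis using fd by blast
    next
      case False
      then have "p ^ ?i dvd p ^ a" using i by (intro le_imp_power_dvd) simp
      then have "e dvd p ^ a * d" using f(1) fd mult_dvd_mono[of "p ^ ?i" "p ^ a" f d] by simp
      then show ?thesis by blast
    qed
  qed
  note sub = this
  show "{e. e dvd p ^ Suc a * d} = {e. e dvd p ^ a * d} \<union> (\<lambda>e. p ^ Suc a * e) ` {e. e dvd d}"
  proof -
    have "e dvd p ^ Suc a * d" if "e dvd p ^ a * d" for e
      using that by (rule dvd_trans) (intro mult_dvd_mono le_imp_power_dvd, auto)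
    then show "{e. e dvd p ^ Suc a * d} = {e. e dvd p ^ a * d} \<union> (\<lambda>e. p ^ Suc a * e) ` {e. e dvd d}"
      using sub mult_dvd_mono[OF dvd_refl[of "p ^ Suc a"]] by blast
  qed
  have "False" if "p ^ Suc a * e dvd p ^ a * d" "e dvd d" for e
  proof -
    have "p ^ a * (p * e) dvd p ^ a * d" using that(1) by (simp add: mult_ac)
    then have "p * e dvd d" using p0 by (simp add: nat_mult_dvd_cancel_disj)
    then show False using d dvd_mult_left by blast
  qed
  then show "{e. e dvd p ^ a * d} \<inter> (\<lambda>e. p ^ Suc a * e) ` {e. e dvd d} = {}" by blast
qed

text \<open>Moebius inversion, in the form of a bound; applied to a difference it also gives uniqueness.\<close>
lemma moebius_inversion_bound:
  fixes L :: "nat \<Rightarrow> real"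
  assumes "n > 0"
  shows "\<bar>L n\<bar> \<le> (\<Sum>d | d dvd n. \<bar>\<Sum>e | e dvd d. L e\<bar>)"
  using assms
proof (induction n arbitrary: L rule: less_induct)
  case (less n)
  show ?case
  proof (cases "n = 1")
    case False
    then obtain p where p: "prime p" "p dvd n" using prime_factor_nat by blast
    have "n \<noteq> 0" "\<not> is_unit p" using less.prems p(1) by auto
    then obtain m where m: "n = p ^ multiplicity p n * m" "\<not> p dvd m"
      using multiplicity_decompose'[of n p] by metis
    have "multiplicity p n > 0" using p less.prems by (simp add: prime_multiplicity_gt_zero_iff)
    then obtain a where a: "multiplicity p n = Suc a" by (cases "multiplicity p n") auto
    have p1: "p > 1" using p(1) by (rule prime_gt_1_nat)
    have nm: "n = p ^ Suc a * m" using m(1) a by simp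
    have m0: "m > 0" using nm less.prems by (auto intro: ccontr)
    have "m < n" using n_less_m_mult_n[OF m0, of "p ^ Suc a"] one_less_power[OF p1, of "Suc a"] nm by simp
    define l where "l = (\<lambda>d. \<Sum>e | e dvd d. L e)"
    let ?f = "\<lambda>e. p ^ Suc a * e" and ?g = "\<lambda>e. p ^ a * e"
    have inj: "inj_on ?f X" "inj_on ?g X" for X using p1 by (auto intro!: inj_onI simp del: power_Suc)
    \<comment> \<open>The divisors of \<open>?f d\<close> beyond those of \<open>?g d\<close> are
      the \<open>?f e\<close> with \<open>e\<close> dividing \<open>d\<close>. So
      \<open>\<lambda>e. L (?f e)\<close>, considered on the smaller number \<open>m\<close>, has
      divisor sums that are differences of divisor sums of \<open>L\<close>, and the induction
      removes one prime at a time.\<close>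
    have diff: "(\<Sum>e | e dvd d. L (?f e)) = l (?f d) - l (?g d)" if "d dvd m" for d
    proof -
      have nd: "\<not> p dvd d" "d > 0" using that m(2) m0 dvd_trans by (auto intro: Nat.gr0I)
      have "l (?f d) = l (?g d) + (\<Sum>e\<in>?f ` {e. e dvd d}. L e)"
        unfolding l_def divisors_prime_power_mult(1)[OF p(1) nd]
        by (rule sum.union_disjoint) (use divisors_prime_power_mult(2)[OF p(1) nd] nd p1 in auto)
      also have "(\<Sum>e\<in>?f ` {e. e dvd d}. L e) = (\<Sum>e | e dvd d. L (?f e))"
        using inj by (simp add: sum.reindex o_def)
      finally show ?thesis by simp
    qed
    have "\<bar>L n\<bar> = \<bar>L (?f m)\<bar>" using nm by simp
    also have "\<dots> \<le> (\<Sum>d | d dvd m. \<bar>\<Sum>e | e dvd d. L (?f e)\<bar>)"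
      by (rule less.IH[OF \<open>m < n\<close> m0, of "\<lambda>e. L (?f e)"])
    also have "\<dots> = (\<Sum>d | d dvd m. \<bar>l (?f d) - l (?g d)\<bar>)" by (intro sum.cong refl) (simp add: diff del: power_Suc)
    also have "\<dots> \<le> (\<Sum>d | d dvd m. \<bar>l (?f d)\<bar> + \<bar>l (?g d)\<bar>)" by (intro sum_mono abs_triangle_ineq4)
    also have "\<dots> = (\<Sum>d\<in>?f ` {d. d dvd m}. \<bar>l d\<bar>) + (\<Sum>d\<in>?g ` {d. d dvd m}. \<bar>l d\<bar>)"
      using inj by (simp add: sum.distrib sum.reindex o_def)
    also have "\<dots> = (\<Sum>d\<in>?f ` {d. d dvd m} \<union> ?g ` {d. d dvd m}. \<bar>l d\<bar>)"
    \<comment> \<open>Each divisor of \<open>n\<close> is charged at most once, so no factor 2 per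
      prime accumulates.\<close>
    proof (rule sum.union_disjoint[symmetric])
      have "False" if "?f d = ?g e" "e dvd m" for d e
      proof -
        have "e = p * d" using that(1) p1 by simp
        then show False using that(2) m(2) dvd_mult_left by blast
      qed
      then show "?f ` {d. d dvd m} \<inter> ?g ` {d. d dvd m} = {}" by blast
    qed (use m0 in auto)
    also have "\<dots> \<le> (\<Sum>d | d dvd n. \<bar>l d\<bar>)"
    proof (rule sum_mono2)
      show "?f ` {d. d dvd m} \<union> ?g ` {d. d dvd m} \<subseteq> {d. d dvd n}"
        unfolding nm by (auto intro!: mult_dvd_mono le_imp_power_dvd)
    qed (use less.prems in auto)
    finally show ?thesis by (simp add: l_def)
  qed auto
qed

text \<open>The absolute value of the homogenized \<open>n\<close>-th cyclotomic polynomial at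
  \<open>(x, y)\<close>. Taking the norm of every single factor allows two pairs to be compared
  factor by factor.\<close>

definition cyc_prod :: "real \<Rightarrow> real \<Rightarrow> nat \<Rightarrow> real" where
  "cyc_prod x y n = (\<Prod>k\<in>totatives n. cmod (of_real x - cis (2 * pi * real k / real n) * of_real y))"

text \<open>In the variable \<open>x\<close> both sides are monic of degree \<open>n\<close> and
  vanish at the \<open>n\<close> distinct points \<open>\<zeta> * y\<close>. For
  \<open>y = 0\<close> these points coincide, hence the separate case.\<close>

lemma power_diff_factorization:
  fixes x y :: complex
  assumes n: "n > 0"
  shows "x ^ n - y ^ n = (\<Prod>k\<in>{0<..n}. x - cis (2 * pi * real k / real n) * y)"
proof (cases "y = 0")
  case True
  then show ?thesis using n by simp
next
  case False
  let ?r = "\<lambda>k. cis (2 * pi * real k / real n) * y"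
  let ?p = "Polynomial.monom 1 n - [:y ^ n:]"
  let ?q = "\<Prod>k\<in>{0<..n}. [:- ?r k, 1:]"
  have dq: "degree ?q = n" by (subst degree_prod_eq_sum_degree) auto
  have lq: "lead_coeff ?q = 1" by (simp add: lead_coeff_prod)
  have inj: "inj_on ?r {0<..n}"
  proof (rule inj_onI)
    fix j k assume jk: "j \<in> {0<..n}" "k \<in> {0<..n}" "?r j = ?r k"
    have "bij_betw (\<lambda>k. cis (2 * pi * real k / real n)) {..<n} {z. z ^ n = 1}"
      by (rule Complex.bij_betw_roots_unity[OF n])
    then have inj: "inj_on (\<lambda>k. cis (2 * pi * real k / real n)) {..<n}" by (rule bij_betw_imp_inj_on)
    \<comment> \<open>The indices \<open>1..n\<close> match those of \<open>totatives\<close>;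
      reduction modulo \<open>n\<close> carries them to the enumeration of the roots of unity by
      \<open>{..<n}\<close>.\<close>
    have eq: "cis (2 * pi * real k / real n) = cis (2 * pi * real (k mod n) / real n)" if "k \<in> {0<..n}" for k
    proof (cases "k = n")
      case True then show ?thesis using n by simp
    next
      case False then show ?thesis using that by simp
    qed
    have "cis (2 * pi * real (j mod n) / real n) = cis (2 * pi * real (k mod n) / real n)"
      using jk(3) False eq[OF jk(1)] eq[OF jk(2)] by simp
    then have "j mod n = k mod n" using inj n by (auto dest!: inj_onD)
    then show "j = k" using jk(1,2) by (cases "j = n"; cases "k = n") auto
  qed
  have "?p = ?q"
  proof (rule poly_eqI_degree_lead_coeff[where A = "?r ` {0<..n}" and n = n])
    show "degree ?p \<le> n" by (rule degree_diff_le) (auto simp: degree_monom_le)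
    show "Polynomial.coeff ?p n = Polynomial.coeff ?q n" using lq dq n by (simp add: coeff_pCons split: nat.splits)
    show "n \<le> card (?r ` {0<..n})" using inj by (simp add: card_image)
    fix z assume "z \<in> ?r ` {0<..n}"
    then obtain k where k: "k \<in> {0<..n}" "z = ?r k" by blast
    have "cis (2 * pi * real k / real n) ^ n = 1"
    proof -
      have "real n * (2 * pi * real k / real n) = 2 * pi * real k" using n by simp
      then show ?thesis by (simp only: Complex.DeMoivre) (rule cis_multiple_2pi, simp)
    qed
    then have "poly ?p z = 0" using k by (simp add: poly_monom power_mult_distrib)
    moreover have "poly ?q z = 0" using k by (auto simp: poly_prod)
    ultimately show "poly ?p z = poly ?q z" by simp
  qed (use dq in auto)
  then have "poly ?p x = poly ?q x" by simp
  then show ?thesis by (simp add: poly_monom poly_prod)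
qed

text \<open>Sort the factors of \<open>x ^ n - y ^ n\<close> by \<open>gcd k n = d\<close>: dividing
  such \<open>k\<close> by \<open>d\<close> yields the totatives of \<open>n div d\<close>.\<close>

lemma cyc_prod_divisors:
  assumes n: "n > 0"
  shows "(\<Prod>d | d dvd n. cyc_prod x y d) = \<bar>x ^ n - y ^ n\<bar>"
proof -
  let ?c = "\<lambda>k. cmod (of_real x - cis (2 * pi * real k / real n) * of_real y)"
  let ?A = "\<lambda>d. {k\<in>{0<..n}. gcd k n = d}"
  have "\<bar>x ^ n - y ^ n\<bar> = cmod (of_real x ^ n - of_real y ^ n)"
    by (simp flip: of_real_power of_real_diff)
  also have "\<dots> = (\<Prod>k\<in>{0<..n}. ?c k)" unfolding power_diff_factorization[OF n] by (simp add: prod_norm)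
  also have "{0<..n} = (\<Union>d\<in>{d. d dvd n}. ?A d)" by auto
  also have "(\<Prod>k\<in>\<dots>. ?c k) = (\<Prod>d | d dvd n. \<Prod>k\<in>?A d. ?c k)"
    using n by (intro prod.UNION_disjoint) auto
  also have "\<dots> = (\<Prod>d | d dvd n. cyc_prod x y (n div d))"
  proof (rule prod.cong[OF refl])
    fix d assume "d \<in> {d. d dvd n}"
    then have d: "d dvd n" "d > 0" using n by (auto intro: Nat.gr0I)
    have "(\<Prod>k\<in>?A d. ?c k) = (\<Prod>k\<in>totatives (n div d). ?c (k * d))"
      using bij_betw_totatives_gcd_eq[OF d(1) n] by (intro prod.reindex_bij_betw[symmetric])
    also have "\<dots> = cyc_prod x y (n div d)" unfolding cyc_prod_def
    proof (intro prod.cong refl)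
      fix k
      have "real (k * d) / real n = real k / real (n div d)"
        using d n by (auto simp: real_of_nat_div field_simps)
      then have "2 * pi * real (k * d) / real n = 2 * pi * real k / real (n div d)"
        by (metis times_divide_eq_right)
      then show "?c (k * d) = cmod (of_real x - cis (2 * pi * real k / real (n div d)) * of_real y)" by simp
    qed
    finally show "(\<Prod>k\<in>?A d. ?c k) = cyc_prod x y (n div d)" .
  qed
  also have "\<dots> = (\<Prod>d | d dvd n. cyc_prod x y d)"
    using n by (intro prod.reindex_bij_witness[of _ "(div) n" "(div) n"]) (auto elim: dvdE)
  finally show ?thesis by simp
qed

text \<open>The squared factor depends on the pair only through \<open>x\<^sup>2 + y\<^sup>2\<close>
  and \<open>x * y\<close>. For a Lucas pair both are integers, which makes a uniform comparison
  with two fixed pairs possible.\<close>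

lemma cyc_factor_norm2:
  "(cmod (of_real x - cis \<theta> * of_real y))\<^sup>2 = x\<^sup>2 + y\<^sup>2 - 2 * (x * y) * cos \<theta>"
proof -
  have "(cmod (of_real x - cis \<theta> * of_real y))\<^sup>2 = (x - cos \<theta> * y)\<^sup>2 + (sin \<theta> * y)\<^sup>2"
    by (simp add: cmod_power2)
  also have "\<dots> = x\<^sup>2 + y\<^sup>2 - 2 * (x * y) * cos \<theta>"
    unfolding power_mult_distrib sin_squared_eq by (simp add: power2_eq_square algebra_simps)
  finally show ?thesis .
qed

lemma cyc_prod_mono:
  assumes "\<And>c. -1 \<le> c \<Longrightarrow> c \<le> 1 \<Longrightarrow> x'\<^sup>2 + y'\<^sup>2 - 2 * (x' * y') * c \<le> x\<^sup>2 + y\<^sup>2 - 2 * (x * y) * c"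
  shows "cyc_prod x' y' n \<le> cyc_prod x y n"
  unfolding cyc_prod_def
proof (rule prod_mono, rule conjI)
  fix k
  show "cmod (of_real x' - cis (2 * pi * real k / real n) * of_real y') \<le> cmod (of_real x - cis (2 * pi * real k / real n) * of_real y)"
    by (rule power2_le_imp_le) (auto simp: cyc_factor_norm2 intro!: assms)
qed auto

lemma cyc_prod_pos: "cyc_prod x y n > 0" if "\<bar>y\<bar> < x" "n > 0"
proof -
  have "cmod (of_real x - cis t * of_real y) > 0" for t
  proof -
    have "cmod (of_real x) - cmod (cis t * of_real y) \<le> cmod (of_real x - cis t * of_real y)"
      by (rule norm_triangle_ineq2)
    then show ?thesis using that(1) unfolding norm_mult norm_cis norm_of_real by linarith
  qed
  then show ?thesis unfolding cyc_prod_def by (intro prod_pos) blast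
qed

lemma abs_ln_one_minus: "\<bar>ln (1 - t)\<bar> \<le> \<bar>t\<bar> / (1 - \<bar>t\<bar>)" if "\<bar>t\<bar> < 1" for t :: real
proof -
  have 1: "ln (1 - t) \<le> \<bar>t\<bar>" using ln_le_minus_one[of "1 - t"] that by linarith
  have "- ln (1 - t) = ln (1 / (1 - t))" using that by (simp add: ln_div)
  also have "\<dots> \<le> 1 / (1 - t) - 1" using that by (intro ln_le_minus_one) simp
  also have "\<dots> = t / (1 - t)" using that by (simp add: field_simps)
  also have "\<dots> \<le> \<bar>t\<bar> / (1 - \<bar>t\<bar>)" using that by (intro frac_le) auto
  finally have 2: "- ln (1 - t) \<le> \<bar>t\<bar> / (1 - \<bar>t\<bar>)" .
  have "\<bar>t\<bar> * (1 - \<bar>t\<bar>) \<le> \<bar>t\<bar>" by (simp add: mult_left_le)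
  then have "\<bar>t\<bar> \<le> \<bar>t\<bar> / (1 - \<bar>t\<bar>)" using that by (simp add: pos_le_divide_eq)
  then show ?thesis using 1 2 by linarith
qed

text \<open>After subtracting \<open>totient d * ln x\<close>, the logarithms of the cyclotomic
  values have divisor sums \<open>ln (1 - (y / x) ^ d)\<close>. Moebius inversion then bounds the
  deviation at \<open>n\<close> by the absolute values of these, summed over all \<open>d\<close> up
  to \<open>n\<close>. The term \<open>d = 1\<close> is kept as it is, the others are dominated by a
  geometric series.\<close>

lemma cyc_prod_lower:
  assumes y: "y \<noteq> 0" "\<bar>y\<bar> < x" and n: "n > 0"
  defines "r \<equiv> \<bar>y / x\<bar>"
  shows "x ^ totient n * exp (- (\<bar>ln (1 - y / x)\<bar> + r\<^sup>2 / ((1 - r) * (1 - r\<^sup>2)))) \<le> cyc_prod x y n"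
proof -
  have x: "x > 0" using y by linarith
  have r: "0 < r" "r < 1" using y x by (auto simp: r_def)
  define t where "t = y / x"
  have tr: "\<bar>t\<bar> = r" by (simp add: t_def r_def)
  have td: "\<bar>t ^ d\<bar> < 1" if "d > 0" for d using r that by (simp add: power_abs tr power_Suc_less_one power_less_one_iff)
  define L where "L = (\<lambda>d. ln (cyc_prod x y d) - real (totient d) * ln x)"
  have Ld: "(\<Sum>e | e dvd d. L e) = ln (1 - t ^ d)" if d: "d > 0" for d
  proof -
    have fin: "finite {e. e dvd d}" using d by simp
    have "(\<Sum>e | e dvd d. ln (cyc_prod x y e)) = ln (\<Prod>e | e dvd d. cyc_prod x y e)"
    proof (rule ln_prod[symmetric, OF fin])
      fix e assume "e \<in> {e. e dvd d}"
      then have "cyc_prod x y e > 0" using d y by (intro cyc_prod_pos) (auto intro: Nat.gr0I)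
      then show "cyc_prod x y e \<noteq> 0" by simp
    qed
    also have "\<dots> = ln \<bar>x ^ d - y ^ d\<bar>" using cyc_prod_divisors[OF d] by simp
    also have "x ^ d - y ^ d = x ^ d * (1 - t ^ d)" using x by (simp add: t_def power_divide right_diff_distrib)
    also have "\<bar>\<dots>\<bar> = x ^ d * (1 - t ^ d)" using x td[OF d] by (simp add: abs_mult)
    also have "ln \<dots> = real d * ln x + ln (1 - t ^ d)"
      using x td[OF d] by (simp add: ln_mult ln_realpow)
    finally have 1: "(\<Sum>e | e dvd d. ln (cyc_prod x y e)) = real d * ln x + ln (1 - t ^ d)" .
    have "(\<Sum>e | e dvd d. real (totient e) * ln x) = real (\<Sum>e | e dvd d. totient e) * ln x"
      by (simp add: sum_distrib_right)
    also have "\<dots> = real d * ln x" by (simp add: totient_divisor_sum)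
    finally show ?thesis using 1 by (simp add: L_def sum_subtractf)
  qed
  have "\<bar>L n\<bar> \<le> (\<Sum>d | d dvd n. \<bar>\<Sum>e | e dvd d. L e\<bar>)" by (rule moebius_inversion_bound[OF n])
  also have "\<dots> = (\<Sum>d | d dvd n. \<bar>ln (1 - t ^ d)\<bar>)"
    using n by (intro sum.cong refl) (auto simp: Ld Nat.gr0I)
  also have "\<dots> \<le> (\<Sum>d\<in>{1..n}. \<bar>ln (1 - t ^ d)\<bar>)"
    using n by (intro sum_mono2) (auto dest: dvd_imp_le simp: Suc_le_eq intro!: Nat.gr0I)
  also have "\<dots> = \<bar>ln (1 - t)\<bar> + (\<Sum>d\<in>{2..n}. \<bar>ln (1 - t ^ d)\<bar>)"
    using n by (simp add: sum.atLeast_Suc_atMost numeral_2_eq_2)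
  also have "(\<Sum>d\<in>{2..n}. \<bar>ln (1 - t ^ d)\<bar>) \<le> (\<Sum>d\<in>{2..n}. r ^ d / (1 - r\<^sup>2))"
  proof (rule sum_mono)
    fix d assume d: "d \<in> {2..n}"
    have "\<bar>ln (1 - t ^ d)\<bar> \<le> \<bar>t ^ d\<bar> / (1 - \<bar>t ^ d\<bar>)" using td[of d] d by (intro abs_ln_one_minus) auto
    also have "\<dots> = r ^ d / (1 - r ^ d)" by (simp add: power_abs tr)
    also have "\<dots> \<le> r ^ d / (1 - r\<^sup>2)"
    proof (rule divide_left_mono)
      have "r ^ d \<le> r\<^sup>2" using r d by (intro power_decreasing) auto
      then show "1 - r\<^sup>2 \<le> 1 - r ^ d" by simp
      have "r\<^sup>2 < 1" "r ^ d < 1" using r d by (auto simp: power_less_one_iff)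
      then show "0 < (1 - r ^ d) * (1 - r\<^sup>2)" by simp
    qed (use r in auto)
    finally show "\<bar>ln (1 - t ^ d)\<bar> \<le> r ^ d / (1 - r\<^sup>2)" .
  qed
  also have "\<dots> = (\<Sum>d\<in>{2..n}. r ^ d) / (1 - r\<^sup>2)" by (simp add: sum_divide_distrib)
  also have "\<dots> \<le> (r\<^sup>2 / (1 - r)) / (1 - r\<^sup>2)"
  proof (rule divide_right_mono)
    have "(\<Sum>d\<in>{2..n}. r ^ d) \<le> (\<Sum>d. r ^ (d + 2))"
    proof -
      have "(\<Sum>d\<in>{2..n}. r ^ d) = (\<Sum>d\<in>{..<n - 1}. r ^ (d + 2))"
        by (rule sum.reindex_bij_witness[of _ "\<lambda>d. d + 2" "\<lambda>d. d - 2"]) (auto simp del: add_2_eq_Suc' power_Suc)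
      also have "\<dots> \<le> (\<Sum>d. r ^ (d + 2))"
        using r by (intro sum_le_suminf) (auto simp: power_add intro!: summable_mult2 summable_geometric)
      finally show ?thesis .
    qed
    also have "\<dots> = r\<^sup>2 / (1 - r)"
    proof -
      have "(\<Sum>d. r ^ (d + 2)) = (\<Sum>d. r\<^sup>2 * r ^ d)" by (simp only: power_add mult.commute)
      also have "\<dots> = r\<^sup>2 * (1 / (1 - r))"
        using r by (subst suminf_mult) (auto intro!: summable_geometric simp: suminf_geometric)
      finally show ?thesis by simp
    qed
    finally show "(\<Sum>d\<in>{2..n}. r ^ d) \<le> r\<^sup>2 / (1 - r)" .
    show "0 \<le> 1 - r\<^sup>2" using r by (simp add: power_le_one)
  qed
  finally have "\<bar>L n\<bar> \<le> \<bar>ln (1 - t)\<bar> + r\<^sup>2 / ((1 - r) * (1 - r\<^sup>2))" by simp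
  then have "real (totient n) * ln x - (\<bar>ln (1 - t)\<bar> + r\<^sup>2 / ((1 - r) * (1 - r\<^sup>2))) \<le> ln (cyc_prod x y n)"
    unfolding L_def by linarith
  then have "exp (real (totient n) * ln x - (\<bar>ln (1 - t)\<bar> + r\<^sup>2 / ((1 - r) * (1 - r\<^sup>2)))) \<le> exp (ln (cyc_prod x y n))"
    by (simp only: exp_le_cancel_iff)
  also have "exp (ln (cyc_prod x y n)) = cyc_prod x y n" using cyc_prod_pos[of y x n] y n by simp
  also have "exp (real (totient n) * ln x - (\<bar>ln (1 - t)\<bar> + r\<^sup>2 / ((1 - r) * (1 - r\<^sup>2)))) = x ^ totient n * exp (- (\<bar>ln (1 - t)\<bar> + r\<^sup>2 / ((1 - r) * (1 - r\<^sup>2))))"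
  proof -
    have "exp (real (totient n) * ln x) = x ^ totient n" using x by (simp add: exp_of_nat_mult)
    moreover have "exp (z - w) = exp z * exp (- w)" for z w :: real by (simp add: exp_diff exp_minus divide_inverse)
    ultimately show ?thesis by (simp only:)
  qed
  finally show ?thesis by (simp add: t_def)
qed

text \<open>The golden ratio exceeds 8/5. Its conjugate is smaller by the factor
  \<open>r \<le> 0.382\<close>, so the loss in \<open>cyc_prod_lower\<close> is at least
  \<open>exp (- 2/3) \<ge> 9/20\<close>. This is the pair with sum 1 and product -1, the extreme
  case for negative \<open>Q\<close>.\<close>

lemma cyc_prod_fib_lower:
  assumes n: "n > 0"
  defines "g \<equiv> (1 + sqrt 5) / 2" and "g' \<equiv> (1 - sqrt 5) / 2"
  shows "9/20 * (8/5) ^ totient n \<le> cyc_prod g g' n"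
proof -
  have s5: "2.236 \<le> sqrt 5" "sqrt 5 \<le> 2.237" 
    by (rule real_le_rsqrt, simp add: power2_eq_square) (rule real_le_lsqrt, simp_all add: power2_eq_square)
  have ss: "sqrt 5 * sqrt 5 = 5" by simp
  have g: "8/5 \<le> g" "g > 0" using s5 by (auto simp: g_def)
  have gg: "g' / g = - ((3 - sqrt 5) / 2)"
  proof -
    have "g' = - ((3 - sqrt 5) / 2) * g" unfolding g_def g'_def using ss by (simp add: field_simps)
    then show ?thesis using g by simp
  qed
  define r where "r = \<bar>g' / g\<bar>"
  have r: "r = (3 - sqrt 5) / 2" "0 < r" "r \<le> 0.382" unfolding r_def gg using s5 by auto
  have "ln (1 - g' / g) \<le> 0.382" "0 \<le> ln (1 - g' / g)"
  proof -
    have "1 - g' / g = 1 + r" using gg r by simp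
    then show "ln (1 - g' / g) \<le> 0.382" "0 \<le> ln (1 - g' / g)" unfolding \<open>1 - g' / g = 1 + r\<close> using r ln_add_one_self_le_self[of r] by auto
  qed
  then have l: "\<bar>ln (1 - g' / g)\<bar> \<le> 0.382" by simp
  have "r\<^sup>2 / ((1 - r) * (1 - r\<^sup>2)) \<le> 0.146 / (0.618 * 0.854)"
  proof (rule frac_le)
    have "r * r \<le> 0.382 * 0.382" using r by (intro mult_mono) auto
    then show r2: "r\<^sup>2 \<le> 0.146" by (simp add: power2_eq_square)
    show "0.618 * 0.854 \<le> (1 - r) * (1 - r\<^sup>2)" using r r2 by (intro mult_mono) auto
  qed auto
  then have S: "\<bar>ln (1 - g' / g)\<bar> + r\<^sup>2 / ((1 - r) * (1 - r\<^sup>2)) \<le> 2/3" using l by simp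
  have "exp (2/3 :: real) \<le> 1 + 2/3 + (2/3)\<^sup>2" by (rule exp_bound) auto
  then have "exp (2/3 :: real) \<le> 20/9" by (simp add: power2_eq_square)
  then have "9/20 \<le> exp (- (2/3 :: real))" by (simp add: exp_minus field_simps)
  also have "\<dots> \<le> exp (- (\<bar>ln (1 - g' / g)\<bar> + r\<^sup>2 / ((1 - r) * (1 - r\<^sup>2))))" using S by simp
  finally have e: "9/20 \<le> exp (- (\<bar>ln (1 - g' / g)\<bar> + r\<^sup>2 / ((1 - r) * (1 - r\<^sup>2))))" .
  have "9/20 * (8/5) ^ totient n \<le> exp (- (\<bar>ln (1 - g' / g)\<bar> + r\<^sup>2 / ((1 - r) * (1 - r\<^sup>2)))) * g ^ totient n"
    using e g by (intro mult_mono power_mono) auto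
  also have "\<dots> \<le> cyc_prod g g' n"
  proof -
    have "g' < 0" using s5 unfolding g'_def by simp
    moreover have "g' = 1 - g" by (simp add: g_def g'_def field_simps)
    then have "- g' < g" by linarith
    ultimately have "g' \<noteq> 0" "\<bar>g'\<bar> < g" by auto
    from cyc_prod_lower[OF this n] show ?thesis unfolding r_def by (simp only: mult.commute)
  qed
  finally show ?thesis .
qed

text \<open>Here the loss factor is only 4/27, but base 2 gains 5/4 over 8/5 in each of at least 6
  factors. This yields the same lower bound as for the golden ratio, so that one estimate serves all
  Lucas pairs.\<close>

lemma cyc_prod_mersenne_lower:
  assumes n: "n > 0" "totient n \<ge> 6"
  shows "9/20 * (8/5) ^ totient n \<le> cyc_prod 2 1 n"
proof -
  have l: "\<bar>ln (1 - 1/2 :: real)\<bar> \<le> 1" using abs_ln_one_minus[of "1/2"] by simp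
  have "exp (1 + 2/3 :: real) \<le> 27/4"
  proof -
    have "exp (2/3 :: real) \<le> 1 + 2/3 + (2/3)\<^sup>2" by (rule exp_bound) auto
    then have "exp (2/3 :: real) \<le> 9/4" by (simp add: power2_eq_square)
    then have "exp (1 :: real) * exp (2/3) \<le> 3 * (9/4)" using exp_le by (intro mult_mono) auto
    moreover have "exp (1 + 2/3 :: real) = exp 1 * exp (2/3)" by (rule exp_add)
    ultimately show ?thesis by linarith
  qed
  then have "4/27 \<le> exp (- (1 + 2/3 :: real))" by (simp add: exp_minus field_simps)
  also have "\<dots> \<le> exp (- (\<bar>ln (1 - 1/2 :: real)\<bar> + (1/2)\<^sup>2 / ((1 - 1/2) * (1 - (1/2)\<^sup>2))))"
    using l by (simp add: power2_eq_square)
  finally have e: "4/27 \<le> exp (- (\<bar>ln (1 - 1/2 :: real)\<bar> + (1/2)\<^sup>2 / ((1 - 1/2) * (1 - (1/2)\<^sup>2))))" .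
  \<comment> \<open>What is needed is the ratio of 9/20 to 4/27, which is a little above 3;
    \<open>(5/4) ^ 6\<close> exceeds 3.8.\<close>
  have "(8/5 :: real) ^ totient n * 3.8 \<le> 2 ^ totient n"
  proof -
    have "(3.8 :: real) \<le> (5/4) ^ 6" by (simp add: eval_nat_numeral)
    also have "\<dots> \<le> (5/4) ^ totient n" using n by (intro power_increasing) auto
    finally have "(8/5 :: real) ^ totient n * 3.8 \<le> (8/5) ^ totient n * (5/4) ^ totient n" by (intro mult_left_mono) auto
    also have "\<dots> = 2 ^ totient n" by (simp flip: power_mult_distrib)
    finally show ?thesis .
  qed
  moreover have "0 \<le> (2 :: real) ^ totient n" by simp
  ultimately have "9/20 * (8/5 :: real) ^ totient n \<le> 2 ^ totient n * (4/27)" by linarith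
  also have "\<dots> \<le> 2 ^ totient n * exp (- (\<bar>ln (1 - 1/2 :: real)\<bar> + (1/2)\<^sup>2 / ((1 - 1/2) * (1 - (1/2)\<^sup>2))))"
    using e by (intro mult_left_mono) auto
  also have "\<dots> \<le> cyc_prod 2 1 n" using cyc_prod_lower[of 1 2 n] n by simp
  finally show ?thesis .
qed

section \<open>Divisibility in Lucas sequences\<close>

text \<open>The parameters are arbitrary integers because \<open>lucas_int_mult\<close> passes to
  the pair \<open>\<phi> ^ k\<close>, \<open>\<psi> ^ k\<close>, whose sum and product are again
  integers. All divisibility arguments take place here, where \<open>dvd\<close> is
  meaningful.\<close>

fun lucas_int :: "int \<Rightarrow> int \<Rightarrow> nat \<Rightarrow> int" where
  "lucas_int P Q 0 = 0"
| "lucas_int P Q (Suc 0) = 1"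
| "lucas_int P Q (Suc (Suc n)) = P * lucas_int P Q (Suc n) - Q * lucas_int P Q n"

lemma lucas_int_add:
  "lucas_int P Q (m + Suc n) = lucas_int P Q (Suc m) * lucas_int P Q (Suc n) - Q * lucas_int P Q m * lucas_int P Q n"
proof (induction P Q n rule: lucas_int.induct)
  case (3 P Q n)
  have "lucas_int P Q (m + Suc (Suc (Suc n))) = P * lucas_int P Q (m + Suc (Suc n)) - Q * lucas_int P Q (m + Suc n)"
    by simp
  also have "\<dots> = P * (lucas_int P Q (Suc m) * lucas_int P Q (Suc (Suc n)) - Q * lucas_int P Q m * lucas_int P Q (Suc n))
     - Q * (lucas_int P Q (Suc m) * lucas_int P Q (Suc n) - Q * lucas_int P Q m * lucas_int P Q n)"
    by (simp only: 3)
  also have "\<dots> = lucas_int P Q (Suc m) * lucas_int P Q (Suc (Suc (Suc n))) - Q * lucas_int P Q m * lucas_int P Q (Suc (Suc n))"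
    by (simp add: algebra_simps)
  finally show ?case .
qed (auto simp: algebra_simps)

text \<open>The left side is a determinant of two solutions of the recurrence, and each step of the
  recurrence multiplies it by \<open>Q\<close>.\<close>

lemma lucas_int_docagne:
  "lucas_int P Q (Suc i) * lucas_int P Q (i + k) - lucas_int P Q i * lucas_int P Q (Suc (i + k)) = Q ^ i * lucas_int P Q k"
proof (induction i)
  case (Suc i)
  have "lucas_int P Q (Suc (Suc i)) * lucas_int P Q (Suc i + k) - lucas_int P Q (Suc i) * lucas_int P Q (Suc (Suc i + k))
    = Q * (lucas_int P Q (Suc i) * lucas_int P Q (i + k) - lucas_int P Q i * lucas_int P Q (Suc (i + k)))"
    by (simp add: algebra_simps)
  then show ?case using Suc by simp
qed simp

text \<open>The left side factors over the roots as
  \<open>(l (k+1) - \<phi> * l k) * (l (k+1) - \<psi> * l k)\<close>, with \<open>l\<close> the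
  sequence; the two factors are \<open>\<psi> ^ k\<close> and \<open>\<phi> ^ k\<close>.\<close>

lemma lucas_int_norm:
  "(lucas_int P Q (Suc k))\<^sup>2 - P * lucas_int P Q k * lucas_int P Q (Suc k) + Q * (lucas_int P Q k)\<^sup>2 = Q ^ k"
  using lucas_int_docagne[of P Q k 1] by (simp add: power2_eq_square algebra_simps)

text \<open>The companion sequence \<open>\<phi> ^ k + \<psi> ^ k\<close>, written in terms of
  \<open>lucas_int\<close>.\<close>

definition lucas_comp :: "int \<Rightarrow> int \<Rightarrow> nat \<Rightarrow> int" where
  "lucas_comp P Q k = 2 * lucas_int P Q (Suc k) - P * lucas_int P Q k"

lemma lucas_comp_disc: "(lucas_comp P Q k)\<^sup>2 - 4 * Q ^ k = (P\<^sup>2 - 4 * Q) * (lucas_int P Q k)\<^sup>2"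
  unfolding lucas_int_norm[of P Q k, symmetric] lucas_comp_def by (simp add: power2_eq_square algebra_simps)

text \<open>Both \<open>\<phi> ^ k\<close> and \<open>\<psi> ^ k\<close> are roots of the quadratic
  with trace \<open>lucas_comp P Q k\<close> and norm \<open>Q ^ k\<close>, so every
  \<open>k\<close>-th term obeys the corresponding recurrence.\<close>

lemma lucas_int_double_step:
  "lucas_int P Q (n + 2 * k) = lucas_comp P Q k * lucas_int P Q (n + k) - Q ^ k * lucas_int P Q n"
proof (induction P Q n rule: lucas_int.induct)
  case (1 P Q)
  show ?case
  proof (cases k)
    case (Suc k')
    have "lucas_int P Q (2 * k) = lucas_int P Q (Suc k) * lucas_int P Q k - Q * lucas_int P Q k * lucas_int P Q k'"
      using lucas_int_add[of P Q k k'] unfolding mult_2 Suc .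
    also have "\<dots> = lucas_int P Q k * (lucas_int P Q (Suc k) - Q * lucas_int P Q k')" by (simp add: algebra_simps)
    also have "Q * lucas_int P Q k' = P * lucas_int P Q k - lucas_int P Q (Suc k)" using Suc by simp
    finally show ?thesis by (simp add: lucas_comp_def algebra_simps)
  qed simp
next
  case (2 P Q)
  have "lucas_int P Q (Suc 0 + 2 * k) = lucas_int P Q (k + Suc k)" by (simp add: mult_2)
  also have "\<dots> = lucas_int P Q (Suc k) * lucas_int P Q (Suc k) - Q * lucas_int P Q k * lucas_int P Q k"
    by (rule lucas_int_add)
  also have "\<dots> = lucas_comp P Q k * lucas_int P Q (Suc 0 + k) - Q ^ k * lucas_int P Q (Suc 0)"
    unfolding lucas_int_norm[of P Q k, symmetric] lucas_comp_def by (simp add: power2_eq_square algebra_simps)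
  finally show ?case .
next
  case (3 P Q n)
  have "lucas_int P Q (Suc (Suc n) + 2 * k) = P * lucas_int P Q (Suc n + 2 * k) - Q * lucas_int P Q (n + 2 * k)" by simp
  also have "\<dots> = P * (lucas_comp P Q k * lucas_int P Q (Suc n + k) - Q ^ k * lucas_int P Q (Suc n))
     - Q * (lucas_comp P Q k * lucas_int P Q (n + k) - Q ^ k * lucas_int P Q n)" by (simp only: 3)
  also have "\<dots> = lucas_comp P Q k * lucas_int P Q (Suc (Suc n) + k) - Q ^ k * lucas_int P Q (Suc (Suc n))"
    by (simp add: algebra_simps)
  finally show ?case .
qed

lemma lucas_int_mult:
  "lucas_int P Q (k * m) = lucas_int P Q k * lucas_int (lucas_comp P Q k) (Q ^ k) m"
proof (induction m rule: induct_nat_012)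
  case (ge2 m)
  have "k * Suc (Suc m) = k * m + 2 * k" by simp
  then have "lucas_int P Q (k * Suc (Suc m)) = lucas_int P Q (k * m + 2 * k)" by (simp only:)
  also have "\<dots> = lucas_comp P Q k * lucas_int P Q (k * Suc m) - Q ^ k * lucas_int P Q (k * m)"
    using lucas_int_double_step[of P Q "k * m" k] by (simp add: add.commute)
  finally show ?case using ge2 by (simp add: algebra_simps)
qed auto

text \<open>Modulo the discriminant the two roots coincide and equal \<open>P / 2\<close>, so that
  the term of index \<open>m + 1\<close> becomes \<open>(m + 1) * (P / 2) ^ m\<close>. The power of
  2 clears the denominator.\<close>

lemma lucas_int_mod_disc: "P\<^sup>2 - 4 * Q dvd 2 ^ m * lucas_int P Q (Suc m) - (int m + 1) * P ^ m"
proof (induction m rule: induct_nat_012)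
  case (ge2 m)
  let ?X = "\<lambda>m. 2 ^ m * lucas_int P Q (Suc m) - (int m + 1) * P ^ m"
  have "?X (Suc (Suc m)) = 2 * P * ?X (Suc m) - 4 * Q * ?X m + (P\<^sup>2 - 4 * Q) * ((int m + 1) * P ^ m)"
    by (simp add: algebra_simps power2_eq_square)
  moreover have "P\<^sup>2 - 4 * Q dvd 2 * P * ?X (Suc m) - 4 * Q * ?X m + (P\<^sup>2 - 4 * Q) * ((int m + 1) * P ^ m)"
    by (rule dvd_add[OF dvd_diff[OF dvd_mult[OF ge2(2)] dvd_mult[OF ge2(1)]] dvd_triv_left])
  ultimately show ?case by (simp only:)
qed auto

text \<open>Modulo a prime divisor of \<open>Q\<close> the recurrence is multiplication by
  \<open>P\<close>, which is a unit by coprimality; starting from 1 it never reaches 0.\<close>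

lemma prime_lucas_not_dvd_Q:
  fixes p :: int
  assumes "prime p" "coprime P Q" "p dvd lucas_int P Q (Suc n)"
  shows "\<not> p dvd Q"
proof
  assume Q: "p dvd Q"
  have "\<not> p dvd lucas_int P Q (Suc n)"
  proof (induction n)
    case 0
    then show ?case using assms(1) by (simp add: prime_int_iff) 
  next
    case (Suc n)
    have "\<not> p dvd P" using Q assms(1,2) by (meson coprime_common_divisor not_prime_unit)
    then have "\<not> p dvd P * lucas_int P Q (Suc n)" using Suc assms(1) by (simp add: prime_dvd_mult_iff)
    moreover have "p dvd P * lucas_int P Q (Suc n)" if "p dvd lucas_int P Q (Suc (Suc n))"
    proof -
      have "p dvd lucas_int P Q (Suc (Suc n)) + Q * lucas_int P Q n" using that Q by (intro dvd_add) auto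
      then show ?thesis by simp
    qed
    ultimately show ?case by blast
  qed
  then show False using assms(3) by simp
qed

text \<open>If two neighbours were divisible, the recurrence run backwards would make all earlier
  terms divisible, since \<open>p\<close> does not divide \<open>Q\<close>; but the term of index 1
  is 1.\<close>

lemma prime_lucas_consecutive:
  fixes p :: int
  assumes "prime p" "coprime P Q" "p dvd lucas_int P Q n"
  shows "\<not> p dvd lucas_int P Q (Suc n)"
  using assms(3)
proof (induction n)
  case 0
  then show ?case using assms(1) by (simp add: prime_int_iff)
next
  case (Suc n)
  have nQ: "\<not> p dvd Q" using prime_lucas_not_dvd_Q[OF assms(1,2) Suc.prems] .
  show ?case
  proof
    assume "p dvd lucas_int P Q (Suc (Suc n))"
    then have "p dvd P * lucas_int P Q (Suc n) - lucas_int P Q (Suc (Suc n))" using Suc.prems by (intro dvd_diff dvd_mult)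
    then have "p dvd Q * lucas_int P Q n" by simp
    then have "p dvd lucas_int P Q n" using nQ assms(1) by (simp add: prime_dvd_mult_iff)
    then show False using Suc by blast
  qed
qed

text \<open>Known as the rank of apparition. The \<open>LEAST\<close> is meaningful only if
  \<open>p\<close> divides some term, hence the hypotheses on \<open>n\<close> or \<open>n0\<close>
  in the lemmas about it.\<close>

definition lucas_rank :: "int \<Rightarrow> int \<Rightarrow> int \<Rightarrow> nat" where
  "lucas_rank P Q p = (LEAST n. 0 < n \<and> p dvd lucas_int P Q n)"

lemma lucas_rankI:
  assumes "0 < n" "p dvd lucas_int P Q n"
  shows "0 < lucas_rank P Q p" "p dvd lucas_int P Q (lucas_rank P Q p)" "lucas_rank P Q p \<le> n"
  unfolding lucas_rank_def
  using LeastI[of "\<lambda>n. 0 < n \<and> p dvd lucas_int P Q n" n] Least_le[of "\<lambda>n. 0 < n \<and> p dvd lucas_int P Q n" n] assms by auto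

text \<open>Modulo \<open>p\<close> the addition formula reduces the term of index
  \<open>m + z\<close> (\<open>z\<close> the rank) to \<open>- Q\<close> times the terms of index
  \<open>m\<close> and \<open>z - 1\<close>. Neither \<open>Q\<close> nor the term of index
  \<open>z - 1\<close> is divisible by \<open>p\<close>, so the index may be lowered by
  \<open>z\<close>.\<close>

lemma lucas_rank_dvd_iff:
  fixes p :: int
  assumes p: "prime p" and co: "coprime P Q" and n0: "0 < n0" "p dvd lucas_int P Q n0"
  shows "p dvd lucas_int P Q n \<longleftrightarrow> lucas_rank P Q p dvd n"
proof (induction n rule: less_induct)
  case (less n)
  define z where "z = lucas_rank P Q p"
  have z: "0 < z" "p dvd lucas_int P Q z" using lucas_rankI[OF n0] by (auto simp: z_def)
  obtain z' where z': "z = Suc z'" using z(1) by (cases z) auto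
  have nQ: "\<not> p dvd Q" using prime_lucas_not_dvd_Q[OF p co] z(2) z' by simp
  show ?case
  proof (cases "n < z")
    case True
    then have "p dvd lucas_int P Q n \<longleftrightarrow> n = 0"
      using not_less_Least[of n "\<lambda>n. 0 < n \<and> p dvd lucas_int P Q n"] by (auto simp: z_def lucas_rank_def)
    moreover have "z dvd n \<longleftrightarrow> n = 0" using True by (auto dest: dvd_imp_le)
    ultimately show ?thesis by (simp add: z_def)
  next
    case False
    define m where "m = n - z"
    have n: "n = m + Suc z'" "m < n" using False z' by (auto simp: m_def)
    have "lucas_int P Q n = lucas_int P Q (Suc m) * lucas_int P Q z - Q * lucas_int P Q m * lucas_int P Q z'"
      unfolding n(1) z' by (rule lucas_int_add)
    then have "p dvd lucas_int P Q n \<longleftrightarrow> p dvd Q * lucas_int P Q m * lucas_int P Q z'"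
      using z(2) by (simp add: dvd_diff_right_iff)
    also have "\<dots> \<longleftrightarrow> p dvd lucas_int P Q m"
      using nQ prime_lucas_consecutive[OF p co, of z'] z(2) z' p by (auto simp: prime_dvd_mult_iff)
    also have "\<dots> \<longleftrightarrow> z dvd m" using less[OF n(2)] by (simp add: z_def)
    also have "n = m + z" using n(1) z' by simp
    then have "z dvd m \<longleftrightarrow> z dvd n" by (simp add: dvd_add_left_iff)
    finally show ?thesis by (simp add: z_def)
  qed
qed

text \<open>Pigeonhole on the ratios of consecutive terms modulo \<open>p\<close>.\<close>
lemma lucas_rank_exists:
  fixes p :: int
  assumes p: "prime p" and nQ: "\<not> p dvd Q"
  shows "\<exists>n>0. int n \<le> p + 1 \<and> p dvd lucas_int P Q n"
proof (rule ccontr)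
  assume "\<not> ?thesis"
  then have nd: "\<not> p dvd lucas_int P Q n" if "0 < n" "int n \<le> p + 1" for n using that by blast
  have p2: "p \<ge> 2" using p by (simp add: prime_ge_2_int)
  have "\<exists>x. [lucas_int P Q n * x = 1] (mod p)" if "0 < n" "int n \<le> p + 1" for n
  proof (rule cong_solve_coprime_int)
    show "coprime (lucas_int P Q n) p" using nd[OF that] p by (metis coprime_commute prime_imp_coprime)
  qed
  then obtain g where g: "\<And>n. 0 < n \<Longrightarrow> int n \<le> p + 1 \<Longrightarrow> [lucas_int P Q n * g n = 1] (mod p)" by metis
  define f where "f = (\<lambda>n. (lucas_int P Q (Suc n) * g n) mod p)"
  let ?A = "{1..nat p}"
  \<comment> \<open>There are \<open>p\<close> indices but only \<open>p - 1\<close> nonzero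
    residues for the ratios.\<close>
  have "f ` ?A \<subseteq> {1..p - 1}"
  proof
    fix y assume "y \<in> f ` ?A"
    then obtain n where n: "n \<in> ?A" "y = f n" by blast
    have n': "0 < n" "int n \<le> p" using n(1) p2 by auto
    have "\<not> p dvd g n"
    proof
      assume "p dvd g n"
      then have "p dvd lucas_int P Q n * g n" by simp
      then have "p dvd 1" using g[of n] n' by (meson cong_dvd_iff order_trans zle_add1_eq_le less_imp_le zless_add1_eq)
      then show False using p2 by (simp add: zdvd_imp_le)
    qed
    then have "\<not> p dvd lucas_int P Q (Suc n) * g n" using nd[of "Suc n"] n' p by (simp add: prime_dvd_mult_iff)
    then have "y \<noteq> 0" unfolding n(2) f_def by (simp add: dvd_eq_mod_eq_0)
    moreover have "0 \<le> y" "y < p" unfolding n(2) f_def using p2 by auto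
    ultimately show "y \<in> {1..p - 1}" by auto
  qed
  then have "card (f ` ?A) \<le> card {1..p - 1}" by (rule card_mono[rotated]) simp
  also have "\<dots> < card ?A" using p2 by simp
  finally have "\<not> inj_on f ?A" using card_image by fastforce
  then obtain i j where ij: "i \<in> ?A" "j \<in> ?A" "f i = f j" "i < j"
    unfolding inj_on_def by (metis linorder_neqE_nat)
  define k where "k = j - i"
  have j: "j = i + k" "k > 0" using ij(4) by (auto simp: k_def)
  have b: "0 < i" "int i \<le> p + 1" "0 < j" "int j \<le> p + 1" "int k \<le> p + 1" using ij(1,2) j by auto
  let ?l = "lucas_int P Q"
  have c: "[?l (Suc i) * g i = ?l (Suc j) * g j] (mod p)" using ij(3) by (simp add: f_def cong_def)
  have "[?l (Suc i) * ?l j * (?l i * g i) = ?l (Suc i) * ?l j * 1] (mod p)" by (intro cong_mult cong_refl g b)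
  moreover have "[?l (Suc j) * ?l i * (?l j * g j) = ?l (Suc j) * ?l i * 1] (mod p)" by (intro cong_mult cong_refl g b)
  moreover have "[(?l (Suc i) * g i) * (?l i * ?l j) = (?l (Suc j) * g j) * (?l i * ?l j)] (mod p)" by (intro cong_mult cong_refl c)
  ultimately have "[?l (Suc i) * ?l j = ?l (Suc j) * ?l i] (mod p)"
    by (simp add: mult_ac) (metis cong_sym cong_trans)
  \<comment> \<open>Equal ratios at \<open>i\<close> and \<open>j\<close> make the determinant of
    \<open>lucas_int_docagne\<close> vanish modulo \<open>p\<close>, which forces \<open>p\<close>
    to divide the term of the smaller index \<open>j - i\<close>.\<close>
  then have "p dvd ?l (Suc i) * ?l j - ?l (Suc j) * ?l i" by (simp add: cong_iff_dvd_diff)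
  also have "?l (Suc i) * ?l j - ?l (Suc j) * ?l i = Q ^ i * ?l k"
    using lucas_int_docagne[of P Q i k] j by (simp add: mult.commute)
  finally have "p dvd ?l k" using nQ p by (auto simp: prime_dvd_mult_iff dest: prime_dvd_power)
  then show False using nd[of k] j b by simp
qed

section \<open>Powers of a prime in the quotients of the terms of index \<open>k * m\<close> and
  \<open>k\<close>\<close>

lemma prime_not_dvd_lucas_comp:
  fixes p :: int
  assumes p: "prime p" "p \<noteq> 2" and nQ: "\<not> p dvd Q" and pk: "p dvd lucas_int P Q k"
  shows "\<not> p dvd lucas_comp P Q k"
proof
  assume "p dvd lucas_comp P Q k"
  then have "p dvd (lucas_comp P Q k)\<^sup>2 - (P\<^sup>2 - 4 * Q) * (lucas_int P Q k)\<^sup>2"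
    using pk by (intro dvd_diff dvd_mult) (auto simp: power2_eq_square)
  then have "p dvd 4 * Q ^ k" using lucas_comp_disc[of P Q k] by (simp add: algebra_simps)
  moreover have "\<not> p dvd 4"
  proof
    assume "p dvd 4"
    then have "p dvd 2 ^ 2" by simp
    then have "p dvd 2" using p(1) prime_dvd_power by blast
    then show False using p by (simp add: primes_dvd_imp_eq)
  qed
  ultimately show False using nQ p(1) by (auto simp: prime_dvd_mult_iff dest: prime_dvd_power)
qed

text \<open>If \<open>p\<close> divides the term of index \<open>k\<close>, it divides the
  discriminant of the pair of \<open>k\<close>-th powers. For odd \<open>p\<close>,
  \<open>lucas_int_mod_disc\<close> then shows the cofactor to be \<open>m\<close> times a unit
  modulo \<open>p\<close>. For \<open>p = 2\<close> the factor \<open>2 ^ m\<close> spoils this, and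
  the parity of the recurrence is followed directly.\<close>

lemma lucas_cofactor_not_dvd:
  fixes p :: int
  assumes p: "prime p" and nQ: "\<not> p dvd Q" and pk: "p dvd lucas_int P Q k" and m: "\<not> p dvd int m" 
  shows "\<not> p dvd lucas_int (lucas_comp P Q k) (Q ^ k) m"
proof (cases "p = 2")
  case False
  have nC: "\<not> p dvd lucas_comp P Q k" using p False nQ pk by (rule prime_not_dvd_lucas_comp)
  obtain m' where m': "m = Suc m'" using m by (cases m) auto
  show ?thesis
  proof
    assume d: "p dvd lucas_int (lucas_comp P Q k) (Q ^ k) m"
    have "p dvd (lucas_comp P Q k)\<^sup>2 - 4 * Q ^ k" unfolding lucas_comp_disc using pk by (simp add: power2_eq_square)
    also have "\<dots> dvd 2 ^ m' * lucas_int (lucas_comp P Q k) (Q ^ k) (Suc m') - (int m' + 1) * lucas_comp P Q k ^ m'"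
      by (rule lucas_int_mod_disc)
    finally have "p dvd (int m' + 1) * lucas_comp P Q k ^ m'"
      using d m' by (metis dvd_diff_right_iff dvd_mult)
    then have "p dvd int m' + 1" using nC p by (auto simp: prime_dvd_mult_iff dest: prime_dvd_power)
    then show False using m m' by (simp add: add.commute)
  qed
next
  case True
  have eC: "even (lucas_comp P Q k)" using pk True by (simp add: lucas_comp_def)
  have oQ: "odd (Q ^ k)" using nQ True by simp
  have "odd (lucas_int (lucas_comp P Q k) (Q ^ k) (Suc (2 * i)))" for i
    using eC oQ by (induction i) auto
  moreover have "odd m" using m True by presburger
  then obtain i where "m = Suc (2 * i)" by (metis oddE Suc_eq_plus1)
  ultimately show ?thesis using True by simp
qed

text \<open>For odd \<open>p\<close> the same congruence holds modulo \<open>p\<^sup>2\<close>,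
  since the discriminant contains the square of the term of index \<open>k\<close>; it shows the
  cofactor to be \<open>p\<close> times a unit. The condition for \<open>p = 2\<close> excludes
  genuine exceptions: the Fibonacci numbers of index 3 and 6 are 2 and 8, with quotient 4.\<close>

lemma lucas_cofactor_prime:
  fixes p :: int
  assumes p: "prime p" and nQ: "\<not> p dvd Q" and pk: "p dvd lucas_int P Q k"
    and two: "p = 2 \<Longrightarrow> even P \<or> 4 dvd lucas_int P Q k" and k: "k > 0"
  shows "\<not> p\<^sup>2 dvd lucas_int (lucas_comp P Q k) (Q ^ k) (nat p)"
proof (cases "p = 2")
  case False
  have nC: "\<not> p dvd lucas_comp P Q k" using p False nQ pk by (rule prime_not_dvd_lucas_comp)
  have p0: "p > 0" using p by (simp add: prime_gt_0_int)
  obtain m' where m': "nat p = Suc m'" using p0 by (cases "nat p") auto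
  show ?thesis
  proof
    assume d: "p\<^sup>2 dvd lucas_int (lucas_comp P Q k) (Q ^ k) (nat p)"
    have "p\<^sup>2 dvd (lucas_comp P Q k)\<^sup>2 - 4 * Q ^ k" unfolding lucas_comp_disc using pk by (intro dvd_mult) (simp add: dvd_power_same)
    also have "\<dots> dvd 2 ^ m' * lucas_int (lucas_comp P Q k) (Q ^ k) (Suc m') - (int m' + 1) * lucas_comp P Q k ^ m'"
      by (rule lucas_int_mod_disc)
    finally have "p\<^sup>2 dvd (int m' + 1) * lucas_comp P Q k ^ m'"
      using d m' by (metis dvd_diff_right_iff dvd_mult)
    moreover have "int m' + 1 = p" using m' p0 by linarith
    ultimately have "p dvd lucas_comp P Q k ^ m'" using p0 by (simp add: power2_eq_square)
    then show False using nC p by (auto dest: prime_dvd_power)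
  qed
next
  case True
  have oQ: "odd (Q ^ k)" using nQ True by simp
  have eq: "lucas_int (lucas_comp P Q k) (Q ^ k) (nat p) = lucas_comp P Q k" using True by (simp add: numeral_2_eq_2)
  obtain c where c: "lucas_int P Q k = 2 * c" using pk True by (auto elim: dvdE)
  show ?thesis
  proof
    assume "p\<^sup>2 dvd lucas_int (lucas_comp P Q k) (Q ^ k) (nat p)"
    then have "p\<^sup>2 dvd lucas_comp P Q k" unfolding eq .
    moreover have "p\<^sup>2 = 4" using True by simp
    ultimately have "4 dvd lucas_comp P Q k" by metis
    then have "4 * 4 dvd (lucas_comp P Q k)\<^sup>2" unfolding power2_eq_square using mult_dvd_mono by blast
    moreover have "(lucas_comp P Q k)\<^sup>2 = 4 * (Q ^ k + (P\<^sup>2 - 4 * Q) * c\<^sup>2)"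
      using lucas_comp_disc[of P Q k] unfolding c by (simp add: power2_eq_square algebra_simps)
    ultimately have "4 * 4 dvd 4 * (Q ^ k + (P\<^sup>2 - 4 * Q) * c\<^sup>2)" by (simp only:)
    then have "4 dvd Q ^ k + (P\<^sup>2 - 4 * Q) * c\<^sup>2" by (simp only: dvd_mult_cancel_left) simp
    moreover have "even ((P\<^sup>2 - 4 * Q) * c\<^sup>2)"
    proof -
      have "even P \<or> even c" using two[OF True] c by auto
      then show ?thesis by auto
    qed
    ultimately have "even (Q ^ k)"
      by (metis dvd_add_left_iff dvd_trans even_numeral)
    then show False using oQ by simp
  qed
qed

section \<open>Carmichael's theorem\<close>

text \<open>By monotonicity along divisibility one divisor of totient at least 6 is enough: a prime
  from 7 on, or one of 16, 9, 25, 24, 20, 15. The bound fails for 12.\<close>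

lemma totient_ge_6:
  assumes n: "n \<ge> 13"
  shows "totient n \<ge> 6"
proof -
  have le: "totient d \<le> totient n" if "d dvd n" for d
    using totient_dvd_mono[OF that] n by simp
  show ?thesis
  proof (cases "\<exists>q. prime q \<and> q dvd n \<and> q \<ge> 7")
    case True
    then obtain q where q: "prime q" "q dvd n" "q \<ge> 7" by blast
    then show ?thesis using le[OF q(2)] totient_prime[OF q(1)] by simp
  next
    case False
    define a where "a = multiplicity 2 n"
    define b where "b = multiplicity 3 n"
    define c where "c = multiplicity 5 n"
    have sub: "prime_factors n \<subseteq> {2, 3, 5}"
    proof
      fix q assume q: "q \<in> prime_factors n"
      then have q': "prime q" "q < 7" using False by (auto simp: in_prime_factors_iff not_le)
      moreover have "q \<ge> 2" using q'(1) by (rule prime_ge_2_nat)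
      ultimately have "q = 2 \<or> q = 3 \<or> q = 4 \<or> q = 5 \<or> q = 6" by linarith
      moreover have "\<not> prime (4::nat)" "\<not> prime (6::nat)" by simp_all
      ultimately have "q = 2 \<or> q = 3 \<or> q = 5" using q'(1) by metis
      then show "q \<in> {2, 3, 5}" by auto
    qed
    have "n = (\<Prod>p\<in>prime_factors n. p ^ multiplicity p n)" using n by (intro prime_factorization_nat) auto
    also have "\<dots> = (\<Prod>p\<in>{2, 3, 5}. p ^ multiplicity p n)"
      using sub n by (intro prod.mono_neutral_left) (auto simp: in_prime_factors_iff not_dvd_imp_multiplicity_0 prime_multiplicity_other)
    finally have nf: "n = 2 ^ a * (3 ^ b * 5 ^ c)" by (simp add: a_def b_def c_def)
    have t: "totient 16 = 8" "totient 9 = 6" "totient 25 = 20" "totient 24 = 8" "totient 15 = 8" "totient 20 = 8"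
    proof -
      have p: "prime (2::nat)" "prime (3::nat)" "prime (5::nat)" by simp_all
      show "totient 16 = 8" using totient_prime_power[OF p(1), of 4] by simp
      show "totient 9 = 6" using totient_prime_power[OF p(2), of 2] by simp
      show "totient 25 = 20" using totient_prime_power[OF p(3), of 2] by simp
      have t8: "totient 8 = 4" using totient_prime_power[OF p(1), of 3] by simp
      have c: "coprime (3::nat) 8" "coprime (3::nat) 5" "coprime (4::nat) 5" by (simp_all add: coprime_iff_gcd_eq_1 gcd_non_0_nat)
      show "totient 24 = 8" using totient_mult_coprime[OF c(1)] t8 totient_prime[OF p(2)] by simp
      show "totient 15 = 8" using totient_mult_coprime[OF c(2)] totient_prime[OF p(2)] totient_prime[OF p(3)] by simp
      show "totient 20 = 8" using totient_mult_coprime[OF c(3)] totient_prime[OF p(3)] by simp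
    qed
    show ?thesis
    proof (cases "a \<ge> 4 \<or> b \<ge> 2 \<or> c \<ge> 2")
      case True
      have "16 dvd n" if "a \<ge> 4"
        using le_imp_power_dvd[OF that, of "2::nat"] unfolding nf by (intro dvd_mult2) simp
      moreover have "9 dvd n" if "b \<ge> 2"
        using le_imp_power_dvd[OF that, of "3::nat"] unfolding nf by (intro dvd_mult[OF dvd_mult2]) simp
      moreover have "25 dvd n" if "c \<ge> 2"
        using le_imp_power_dvd[OF that, of "5::nat"] unfolding nf by (intro dvd_mult[OF dvd_mult]) simp
      ultimately show ?thesis using True le[of 16] le[of 9] le[of 25] t by auto
    next
      case False
      then have "a \<in> {0,1,2,3}" "b \<in> {0,1}" "c \<in> {0,1}" by auto
      \<comment> \<open>These are the divisors of 120 that are at least 13.\<close>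
      then have "n = 24 \<or> n = 40 \<or> n = 15 \<or> n = 30 \<or> n = 60 \<or> n = 120 \<or> n = 20" using nf n by auto
      then have "24 dvd n \<or> 20 dvd n \<or> 15 dvd n" by auto
      then show ?thesis using le[of 24] le[of 20] le[of 15] t by auto
    qed
  qed
qed

text \<open>For the largest prime factor \<open>q\<close> of \<open>n\<close>: as
  \<open>totient n \<ge> q - 1\<close>, the lower bound of the cyclotomic value beats
  \<open>q\<close>.\<close>

lemma exp_growth_bound: "real q < 9/20 * (8/5) ^ (q - 1)" if "q \<ge> 8"
  using that
proof (induction q rule: nat_induct_at_least)
  case (Suc q)
  have "real (Suc q) \<le> 8/5 * real q" using Suc by simp
  also have "\<dots> < 8/5 * (9/20 * (8/5) ^ (q - 1))" using Suc by simp
  also have "\<dots> = 9/20 * (8/5) ^ (Suc q - 1)" using Suc by (cases q) auto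
  finally show ?case .
qed (simp add: eval_nat_numeral)

section \<open>Lucas pairs over the reals and their integer values\<close>

locale lucas_pair =
  fixes \<phi> \<psi> :: real and P Q :: int
  assumes sum_eq: "\<phi> + \<psi> = of_int P" and prod_eq: "\<phi> * \<psi> = of_int Q"
    and P0: "P \<noteq> 0" and Q0: "Q \<noteq> 0" and coprime_PQ: "coprime P Q"
    and dominant: "\<phi> > \<bar>\<psi>\<bar>"
begin

abbreviation l :: "nat \<Rightarrow> int" where "l \<equiv> lucas_int P Q"

lemma lucas_v_eq: "lucas_v \<phi> \<psi> n = of_int (l n)"
proof -
  have d: "\<phi> - \<psi> \<noteq> 0" using dominant by linarith
  have "\<phi> ^ n - \<psi> ^ n = (\<phi> - \<psi>) * of_int (l n)"
  proof (induction n rule: induct_nat_012)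
    case (ge2 n)
    have "(\<phi> - \<psi>) * of_int (l (Suc (Suc n))) = (\<phi> + \<psi>) * ((\<phi> - \<psi>) * of_int (l (Suc n))) - (\<phi> * \<psi>) * ((\<phi> - \<psi>) * of_int (l n))"
      unfolding sum_eq prod_eq by (simp add: algebra_simps)
    also have "\<dots> = (\<phi> + \<psi>) * (\<phi> ^ Suc n - \<psi> ^ Suc n) - (\<phi> * \<psi>) * (\<phi> ^ n - \<psi> ^ n)" by (simp only: ge2)
    also have "\<dots> = \<phi> ^ Suc (Suc n) - \<psi> ^ Suc (Suc n)" by (simp add: algebra_simps)
    finally show ?case ..
  qed auto
  then show ?thesis using d by (simp add: lucas_v_def)
qed

lemma phi_gt_1: "\<phi> > 1"
proof -
  have "\<bar>\<phi> * \<psi>\<bar> \<ge> 1" unfolding prod_eq using Q0 by linarith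
  then have 1: "1 \<le> \<phi> * \<bar>\<psi>\<bar>" using dominant by (simp add: abs_mult)
  have p0: "\<phi> > 0" using dominant by linarith
  have "\<phi> * \<bar>\<psi>\<bar> < \<phi> * \<phi>" using dominant p0 by (intro mult_strict_left_mono)
  then have "1 < \<phi> * \<phi>" using 1 by linarith
  show ?thesis
  proof (rule ccontr)
    assume "\<not> \<phi> > 1"
    then have "\<phi> * \<phi> \<le> 1 * 1" using p0 by (intro mult_mono) auto
    then show False using \<open>1 < \<phi> * \<phi>\<close> by simp
  qed
qed

lemma pow_less: "n > 0 \<Longrightarrow> \<psi> ^ n < \<phi> ^ n"
proof -
  assume n: "n > 0"
  have "\<psi> ^ n \<le> \<bar>\<psi>\<bar> ^ n" by (metis abs_ge_self power_abs)
  also have "\<dots> < \<phi> ^ n" using dominant n by (intro power_strict_mono) auto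
  finally show ?thesis .
qed

lemma l_pos: "n > 0 \<Longrightarrow> l n > 0"
proof -
  assume n: "n > 0"
  have "lucas_v \<phi> \<psi> n > 0" unfolding lucas_v_def using pow_less[OF n] dominant by (intro divide_pos_pos) auto
  then show "l n > 0" unfolding lucas_v_eq by simp
qed

lemma l_dvd: "m dvd n \<Longrightarrow> l m dvd l n"
  by (auto elim!: dvdE simp: lucas_int_mult)

lemma disc_ge_1: "P\<^sup>2 - 4 * Q \<ge> 1"
proof -
  have "of_int (P\<^sup>2 - 4 * Q) = (\<phi> + \<psi>)\<^sup>2 - 4 * (\<phi> * \<psi>)" unfolding sum_eq prod_eq by simp
  also have "\<dots> = (\<phi> - \<psi>)\<^sup>2" by (simp add: power2_eq_square algebra_simps)
  also have "\<dots> > 0" using dominant by auto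
  finally show ?thesis by linarith
qed

text \<open>With \<open>c\<close> the cosine, the squared factor is
  \<open>P\<^sup>2 - Q * (2 + 2 * c)\<close>. For negative \<open>Q\<close> it is at least
  \<open>3 + 2 * c\<close>, the value for the golden ratio. It also equals the discriminant plus
  \<open>Q * (2 - 2 * c)\<close>, which for \<open>Q \<ge> 2\<close> is at least
  \<open>5 - 4 * c\<close>, the value for the pair \<open>(2, 1)\<close>.\<close>

lemma cyc_prod_bound:
  assumes n: "n \<ge> 13"
  shows "9/20 * (8/5) ^ totient n \<le> cyc_prod \<phi> \<psi> n"
proof -
  have sq: "\<phi>\<^sup>2 + \<psi>\<^sup>2 = of_int (P\<^sup>2 - 2 * Q)"
    using arg_cong[OF sum_eq, of "\<lambda>x. x\<^sup>2"] prod_eq by (simp add: power2_eq_square algebra_simps)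
  consider "Q \<le> -1" | "Q = 1" | "Q \<ge> 2" using Q0 by linarith
  then show ?thesis
  proof cases
    case 1
    have "9/20 * (8/5) ^ totient n \<le> cyc_prod ((1 + sqrt 5) / 2) ((1 - sqrt 5) / 2) n"
      using n by (intro cyc_prod_fib_lower) auto
    also have "\<dots> \<le> cyc_prod \<phi> \<psi> n"
    proof (rule cyc_prod_mono)
      fix c :: real assume c: "-1 \<le> c" "c \<le> 1"
      have p2: "1 \<le> P\<^sup>2" using P0 by (simp add: int_one_le_iff_zero_less)
      have e1: "((1 + sqrt 5) / 2)\<^sup>2 + ((1 - sqrt 5) / 2)\<^sup>2 = 3" "(1 + sqrt 5) / 2 * ((1 - sqrt 5) / 2) = -1"
        by (simp_all add: power2_eq_square field_simps)
      have "1 * (2 + 2 * c) \<le> of_int (- Q) * (2 + 2 * c)" using 1 c by (intro mult_right_mono) auto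
      then have "3 + 2 * c \<le> of_int (P\<^sup>2) + of_int (- Q) * (2 + 2 * c)" using p2 of_int_le_iff[of 1 "P\<^sup>2", where 'a = real] by simp
      then show "((1 + sqrt 5) / 2)\<^sup>2 + ((1 - sqrt 5) / 2)\<^sup>2 - 2 * ((1 + sqrt 5) / 2 * ((1 - sqrt 5) / 2)) * c \<le> \<phi>\<^sup>2 + \<psi>\<^sup>2 - 2 * (\<phi> * \<psi>) * c"
        unfolding e1 sq prod_eq by (simp add: algebra_simps)
    qed
    finally show ?thesis .
  next
    case 2
    have "9/20 * (8/5) ^ totient n \<le> cyc_prod 2 1 n"
      using n totient_ge_6[OF n] by (intro cyc_prod_mersenne_lower) auto
    also have "\<dots> \<le> cyc_prod \<phi> \<psi> n"
    proof (rule cyc_prod_mono)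
      fix c :: real assume c: "-1 \<le> c" "c \<le> 1"
      \<comment> \<open>For \<open>Q = 1\<close> the second term is too small, but a positive
        discriminant forces \<open>\<bar>P\<bar> \<ge> 3\<close>.\<close>
      have "9 \<le> P\<^sup>2"
      proof (rule ccontr)
        assume "\<not> 9 \<le> P\<^sup>2"
        moreover have "9 \<le> P\<^sup>2" if "3 \<le> \<bar>P\<bar>" using power_mono[OF that, of 2] by simp
        ultimately have "\<bar>P\<bar> < 3" by linarith
        then have "P \<in> {-2, -1, 0, 1, 2}" by auto
        then show False using disc_ge_1 2 by auto
      qed
      then have "9 \<le> (of_int (P\<^sup>2) :: real)" using of_int_le_iff[of 9 "P\<^sup>2", where 'a = real] by simp
      then show "2\<^sup>2 + 1\<^sup>2 - 2 * (2 * 1) * c \<le> \<phi>\<^sup>2 + \<psi>\<^sup>2 - 2 * (\<phi> * \<psi>) * c"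
        unfolding sq prod_eq using c 2 by simp
    qed
    finally show ?thesis .
  next
    case 3
    have "9/20 * (8/5) ^ totient n \<le> cyc_prod 2 1 n"
      using n totient_ge_6[OF n] by (intro cyc_prod_mersenne_lower) auto
    also have "\<dots> \<le> cyc_prod \<phi> \<psi> n"
    proof (rule cyc_prod_mono)
      fix c :: real assume c: "-1 \<le> c" "c \<le> 1"
      have "1 \<le> (of_int (P\<^sup>2 - 4 * Q) :: real)" using disc_ge_1 of_int_le_iff[of 1 "P\<^sup>2 - 4 * Q", where 'a = real] by simp
      moreover have "2 * (2 - 2 * c) \<le> of_int Q * (2 - 2 * c)" using 3 c by (intro mult_right_mono) auto
      ultimately show "2\<^sup>2 + 1\<^sup>2 - 2 * (2 * 1) * c \<le> \<phi>\<^sup>2 + \<psi>\<^sup>2 - 2 * (\<phi> * \<psi>) * c"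
        unfolding sq prod_eq by (simp add: algebra_simps)
    qed
    finally show ?thesis .
  qed
qed

abbreviation v :: "int \<Rightarrow> nat \<Rightarrow> nat" where "v p n \<equiv> multiplicity p (l n)"
abbreviation rk :: "int \<Rightarrow> nat" where "rk p \<equiv> lucas_rank P Q p"

lemma val_mult_coprime:
  assumes p: "prime p" and k: "k > 0" "p dvd l k" and m: "\<not> p dvd int m"
  shows "v p (k * m) = v p k"
proof -
  obtain k' where k': "k = Suc k'" using k by (cases k) auto
  have nQ: "\<not> p dvd Q" using prime_lucas_not_dvd_Q[OF p coprime_PQ, of k'] k k' by simp
  let ?U = "lucas_int (lucas_comp P Q k) (Q ^ k) m"
  have nU: "\<not> p dvd ?U" by (rule lucas_cofactor_not_dvd[OF p nQ k(2) m])
  have "v p (k * m) = multiplicity p (l k * ?U)" by (simp add: lucas_int_mult)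
  also have "\<dots> = v p k + multiplicity p ?U"
    using nU l_pos[OF k(1)] p by (intro prime_elem_multiplicity_mult_distrib) auto
  finally show ?thesis using nU by (simp add: not_dvd_imp_multiplicity_0)
qed

lemma val_step:
  assumes p: "prime p" and k: "k > 0" "p dvd l k" and two: "p = 2 \<Longrightarrow> even P \<or> 4 dvd l k"
  shows "v p (k * nat p) \<le> v p k + 1"
proof -
  obtain k' where k': "k = Suc k'" using k by (cases k) auto
  have nQ: "\<not> p dvd Q" using prime_lucas_not_dvd_Q[OF p coprime_PQ, of k'] k k' by simp
  let ?U = "lucas_int (lucas_comp P Q k) (Q ^ k) (nat p)"
  have nU: "\<not> p\<^sup>2 dvd ?U" by (rule lucas_cofactor_prime[OF p nQ k(2) two k(1)])
  then have U0: "?U \<noteq> 0" by auto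
  have "v p (k * nat p) = multiplicity p (l k * ?U)" by (simp add: lucas_int_mult)
  also have "\<dots> = v p k + multiplicity p ?U"
    using U0 l_pos[OF k(1)] p by (intro prime_elem_multiplicity_mult_distrib) auto
  also have "multiplicity p ?U < 2"
    using nU U0 p by (subst (asm) power_dvd_iff_le_multiplicity) (auto simp: not_le)
  finally show ?thesis by simp
qed

text \<open>The exponent of \<open>p\<close> in the \<open>d\<close>-th homogeneous cyclotomic value.\<close>
definition prim_exp :: "int \<Rightarrow> nat \<Rightarrow> real" where
  "prim_exp p d = (if \<exists>j. d = rk p * nat p ^ j then real (v p d) - (if d = rk p then 0 else real (v p (d div nat p))) else 0)"

text \<open>Only the divisors \<open>rk p * p ^ j\<close> carry an exponent, and along them the
  differences telescope to the valuation at the largest one that divides \<open>d\<close>. The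
  remaining cofactor of \<open>d\<close> is prime to \<open>p\<close> and leaves the valuation
  unchanged by \<open>val_mult_coprime\<close>.\<close>

lemma prim_exp_sum:
  assumes p: "prime p" and n0: "n0 > 0" "p dvd l n0" and d: "d > 0"
  shows "(\<Sum>e | e dvd d. prim_exp p e) = real (v p d)"
proof -
  define q where "q = nat p"
  have q: "q > 1" "int q = p" using prime_gt_1_int[OF p] by (auto simp: q_def)
  define z where "z = rk p"
  have z: "z > 0" "\<And>n. p dvd l n \<longleftrightarrow> z dvd n"
    using lucas_rankI[OF n0] lucas_rank_dvd_iff[OF p coprime_PQ n0] by (auto simp: z_def)
  have inj: "z * q ^ i = z * q ^ j \<longleftrightarrow> i = j" for i j using z q by simp
  have step: "(\<Sum>j\<le>i. prim_exp p (z * q ^ j)) = real (v p (z * q ^ i))" for i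
  proof (induction i)
    case 0
    have "\<exists>j. z = z * q ^ j" by (rule exI[of _ 0]) simp
    then have "prim_exp p z = real (v p z)" unfolding prim_exp_def z_def[symmetric] q_def[symmetric] by simp
    then show ?case by simp
  next
    case (Suc i)
    have "z * q ^ Suc i \<noteq> z" using inj[of "Suc i" 0] by simp
    moreover have "z * q ^ Suc i div q = z * q ^ i" using q by (simp add: mult.left_commute)
    ultimately have "prim_exp p (z * q ^ Suc i) = real (v p (z * q ^ Suc i)) - real (v p (z * q ^ i))"
      unfolding prim_exp_def z_def[symmetric] q_def[symmetric] by (simp only: if_False) (auto simp del: power_Suc)
    then show ?case using Suc by simp
  qed
  show ?thesis
  proof (cases "z dvd d")
    case True
    then obtain k where k: "d = z * k" by blast
    have k0: "k \<noteq> 0" using k d by auto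
    have "\<not> is_unit q" using q by auto
    with k0 obtain m where m: "k = q ^ multiplicity q k * m" "\<not> q dvd m" using multiplicity_decompose'[of k q] by metis
    define i where "i = multiplicity q k"
    have dz: "d = z * q ^ i * m" using k m(1) by (simp add: i_def mult.assoc)
    have pq: "prime q" using p q by (metis prime_int_nat_transfer prime_nat_int_transfer)
    have sub: "(\<lambda>j. z * q ^ j) ` {..i} \<subseteq> {e. e dvd d}"
      unfolding dz by (auto intro!: dvd_mult2[OF mult_dvd_mono[OF dvd_refl le_imp_power_dvd]])
    have other: "prim_exp p e = 0" if "e dvd d" "e \<notin> (\<lambda>j. z * q ^ j) ` {..i}" for e
    proof -
      have "e \<noteq> z * q ^ j" for j
      proof
        assume e: "e = z * q ^ j"
        then have "z * q ^ j dvd z * (q ^ i * m)" using that(1) dz by (simp add: mult.assoc)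
        then have "q ^ j dvd q ^ i * m" using z(1) by (simp add: nat_mult_dvd_cancel_disj)
        moreover have "coprime (q ^ j) m" using m(2) pq by (meson coprime_power_left_iff prime_imp_coprime)
        ultimately have "q ^ j dvd q ^ i" by (simp add: coprime_dvd_mult_left_iff)
        then have "j \<le> i" using q(1) power_dvd_imp_le by blast
        then show False using that(2) e by blast
      qed
      then show ?thesis unfolding prim_exp_def z_def[symmetric] q_def[symmetric] by simp
    qed
    have "(\<Sum>e | e dvd d. prim_exp p e) = (\<Sum>e\<in>(\<lambda>j. z * q ^ j) ` {..i}. prim_exp p e)"
      using sub other d by (intro sum.mono_neutral_right) auto
    also have "\<dots> = (\<Sum>j\<le>i. prim_exp p (z * q ^ j))"
      by (subst sum.reindex) (simp_all only: inj_on_def inj o_def, blast)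
    also have "\<dots> = real (v p (z * q ^ i))" by (rule step)
    also have "v p (z * q ^ i) = v p d" unfolding dz
    proof (rule val_mult_coprime[OF p, symmetric])
      show "p dvd l (z * q ^ i)" using z by simp
      show "\<not> p dvd int m" using m(2) q(2) by (metis int_dvd_int_iff)
    qed (use z q in auto)
    finally show ?thesis .
  next
    case False
    have "prim_exp p e = 0" if "e dvd d" for e
    proof -
      have "e \<noteq> z * q ^ j" for j using that False dvd_trans[of z e d] by auto
      then show ?thesis unfolding prim_exp_def z_def[symmetric] q_def[symmetric] by simp
    qed
    moreover have "v p d = 0" using False z(2) by (simp add: not_dvd_imp_multiplicity_0)
    ultimately show ?thesis by simp
  qed
qed

lemma ln_l: 
  assumes n: "n > 0" "d dvd n"
  shows "ln (of_int (l d)) = (\<Sum>p\<in>prime_factors (l n). real (v p d) * ln (of_int p))"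
proof -
  have d: "d > 0" using n by (auto intro: Nat.gr0I)
  have l0: "l d > 0" "l n > 0" using l_pos d n by auto
  have sub: "prime_factors (l d) \<subseteq> prime_factors (l n)"
    using l_dvd[OF n(2)] l0 by (intro dvd_prime_factors) auto
  have "l d = (\<Prod>p\<in>prime_factors (l d). p ^ v p d)" using l0 by (simp add: prod_prime_factors)
  also have "\<dots> = (\<Prod>p\<in>prime_factors (l n). p ^ v p d)"
    using sub l0 by (intro prod.mono_neutral_left) (auto simp: in_prime_factors_iff not_dvd_imp_multiplicity_0)
  finally have "ln (of_int (l d)) = ln (\<Prod>p\<in>prime_factors (l n). (of_int p :: real) ^ v p d)"
    by (metis (no_types, lifting) of_int_power of_int_prod prod.cong)
  also have "\<dots> = (\<Sum>p\<in>prime_factors (l n). ln ((of_int p :: real) ^ v p d))"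
    by (intro ln_prod) auto
  also have "\<dots> = (\<Sum>p\<in>prime_factors (l n). real (v p d) * ln (of_int p))"
    by (intro sum.cong refl ln_realpow)
  finally show ?thesis .
qed

text \<open>Once \<open>ln (\<phi> - \<psi>)\<close> is removed at index 1, both sides have the
  divisor sums \<open>ln (of_int (l d))\<close>. Their difference has vanishing divisor sums at
  every divisor of \<open>n\<close> and is 0 by \<open>moebius_inversion_bound\<close>. The primes
  of \<open>l n\<close> suffice because \<open>l d\<close> divides \<open>l n\<close>.\<close>

lemma ln_cyc_prod:
  assumes n: "n > 1"
  shows "ln (cyc_prod \<phi> \<psi> n) = (\<Sum>p\<in>prime_factors (l n). prim_exp p n * ln (of_int p))"
proof -
  let ?S = "prime_factors (l n)"
  define L where "L = (\<lambda>d. ln (cyc_prod \<phi> \<psi> d) - (if d = 1 then ln (\<phi> - \<psi>) else 0) - (\<Sum>p\<in>?S. prim_exp p d * ln (of_int p)))"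
  have "(\<Sum>e | e dvd d. L e) = 0" if dn: "d dvd n" for d
  proof -
    have d: "d > 0" using n dn by (auto intro: Nat.gr0I)
    have fin: "finite {e. e dvd d}" using d by simp
    have "(\<Sum>e | e dvd d. ln (cyc_prod \<phi> \<psi> e)) = ln (\<Prod>e | e dvd d. cyc_prod \<phi> \<psi> e)"
    proof (rule ln_prod[symmetric, OF fin])
      fix e assume "e \<in> {e. e dvd d}"
      then have "cyc_prod \<phi> \<psi> e > 0" using d dominant by (intro cyc_prod_pos) (auto intro: Nat.gr0I)
      then show "cyc_prod \<phi> \<psi> e \<noteq> 0" by simp
    qed
    also have "\<dots> = ln ((\<phi> - \<psi>) * of_int (l d))"
    proof -
      have "\<phi> ^ d - \<psi> ^ d = (\<phi> - \<psi>) * of_int (l d)"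
        using lucas_v_eq[of d] dominant by (simp add: lucas_v_def field_simps)
      then show ?thesis using cyc_prod_divisors[OF d, of \<phi> \<psi>] pow_less[OF d] by simp
    qed
    also have "\<dots> = ln (\<phi> - \<psi>) + ln (of_int (l d))"
      using dominant l_pos[OF d] by (intro ln_mult_pos) auto
    finally have 1: "(\<Sum>e | e dvd d. ln (cyc_prod \<phi> \<psi> e)) = ln (\<phi> - \<psi>) + ln (of_int (l d))" .
    have 2: "(\<Sum>e | e dvd d. if e = 1 then ln (\<phi> - \<psi>) else 0) = ln (\<phi> - \<psi>)"
      using fin by (simp add: sum.delta)
    have "(\<Sum>e | e dvd d. \<Sum>p\<in>?S. prim_exp p e * ln (of_int p)) = (\<Sum>p\<in>?S. (\<Sum>e | e dvd d. prim_exp p e) * ln (of_int p))"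
      by (subst sum.swap) (simp add: sum_distrib_right)
    also have "\<dots> = (\<Sum>p\<in>?S. real (v p d) * ln (of_int p))"
      by (intro sum.cong refl, subst prim_exp_sum[of _ n]) (use n d in \<open>auto simp: in_prime_factors_iff\<close>)
    also have "\<dots> = ln (of_int (l d))" using ln_l[OF _ dn] n by simp
    finally have 3: "(\<Sum>e | e dvd d. \<Sum>p\<in>?S. prim_exp p e * ln (of_int p)) = ln (of_int (l d))" .
    show ?thesis unfolding L_def sum_subtractf 1 2 3 by simp
  qed
  then have "(\<Sum>d | d dvd n. \<bar>\<Sum>e | e dvd d. L e\<bar>) = 0" by simp
  then have "L n = 0" using moebius_inversion_bound[of n L] n by simp
  then show ?thesis using n by (simp add: L_def)
qed

lemma rank_2_odd:
  assumes "odd P" "n0 > 0" "2 dvd l n0"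
  shows "rk 2 = 3"
proof -
  have p2: "prime (2::int)" by simp
  obtain n' where n': "n0 = Suc n'" using assms(2) by (cases n0) auto
  have oQ: "odd Q" using prime_lucas_not_dvd_Q[OF p2 coprime_PQ, of n'] assms n' by simp
  have "l 3 = P * P - Q" by (simp add: numeral_3_eq_3)
  then have "2 dvd l 3" using assms(1) oQ by simp
  then have "rk 2 dvd 3" using lucas_rank_dvd_iff[OF p2 coprime_PQ assms(2,3)] by simp
  moreover have "\<not> rk 2 dvd 1" using lucas_rank_dvd_iff[OF p2 coprime_PQ assms(2,3), of 1] by simp
  moreover have "rk 2 \<le> 3" using \<open>rk 2 dvd 3\<close> by (rule dvd_imp_le) simp
  moreover have "prime (3::nat)" by simp
  ultimately have "rk 2 = 1 \<or> rk 2 = 3" "rk 2 \<noteq> 1" unfolding prime_nat_iff by auto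
  then show ?thesis by blast
qed

text \<open>Suppose that every prime \<open>p\<close> of \<open>l n\<close> has rank below
  \<open>n\<close>. Then its exponent in the cyclotomic value is at most 1, and positive only if
  \<open>n = rk p * p ^ (j + 1)\<close>. Since \<open>rk p \<le> p + 1\<close>, such a
  \<open>p\<close> is the largest prime factor \<open>q\<close> of \<open>n\<close>, apart from 2
  when \<open>q = 3\<close>. So the value is at most \<open>max q 6\<close>, against a lower bound
  exponential in \<open>totient n\<close>.\<close>

theorem carmichael:
  assumes n: "n \<ge> 13"
  shows "\<exists>p. prime p \<and> p dvd l n \<and> (\<forall>m. 0 < m \<and> m < n \<longrightarrow> \<not> p dvd l m)"
proof (rule ccontr)
  assume "\<not> ?thesis"
  then have noprim: "\<exists>m. 0 < m \<and> m < n \<and> p dvd l m" if "prime p" "p dvd l n" for p using that by blast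
  let ?S = "prime_factors (l n)"
  define T where "T = {p\<in>?S. \<exists>j. n = rk p * nat p ^ Suc j}"
  have Sp: "prime p" "p dvd l n" "p > 1" if "p \<in> ?S" for p using that by (auto simp: in_prime_factors_iff prime_gt_1_int)
  have rk: "0 < rk p" "p dvd l (rk p)" "rk p < n" "\<And>m. p dvd l m \<longleftrightarrow> rk p dvd m" "int (rk p) \<le> p + 1" if p: "p \<in> ?S" for p
  proof -
    obtain m where m: "0 < m" "m < n" "p dvd l m" using noprim Sp[OF p] by blast
    show "0 < rk p" "p dvd l (rk p)" "rk p < n" using lucas_rankI[OF m(1,3)] m(2) by auto
    show "p dvd l m' \<longleftrightarrow> rk p dvd m'" for m' by (rule lucas_rank_dvd_iff[OF Sp(1)[OF p] coprime_PQ m(1,3)])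
    obtain m' where m': "m = Suc m'" using m(1) by (cases m) auto
    have "\<not> p dvd Q" using prime_lucas_not_dvd_Q[OF Sp(1)[OF p] coprime_PQ, of m'] m m' by simp
    then obtain r where "0 < r" "int r \<le> p + 1" "p dvd l r" using lucas_rank_exists[OF Sp(1)[OF p]] by blast
    then show "int (rk p) \<le> p + 1" using lucas_rankI(3)[of r p P Q] by simp
  qed
  have w_le: "prim_exp p n \<le> (if p \<in> T then 1 else 0)" if p: "p \<in> ?S" for p
  proof (cases "\<exists>j. n = rk p * nat p ^ j")
    case True
    then obtain j where j: "n = rk p * nat p ^ j" by blast
    have "j \<noteq> 0" using j rk(3)[OF p] by (intro notI) simp
    then obtain i where i: "j = Suc i" by (cases j) auto
    define k where "k = rk p * nat p ^ i"
    have nk: "n = k * nat p" using j i by (simp add: k_def)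
    have np: "nat p > 1" using Sp(3)[OF p] by simp
    have k: "k > 0" "p dvd l k" using rk[OF p] np by (auto simp: k_def)
    have T: "p \<in> T" using p j i by (auto simp: T_def)
    \<comment> \<open>This excludes the exception of \<open>lucas_cofactor_prime\<close>. For odd
      \<open>P\<close> the rank of 2 is 3 and \<open>n = 3 * 2 ^ (i + 1)\<close>; the bad cases
      \<open>i = 0, 1\<close> are \<open>n = 6\<close> and \<open>n = 12\<close>. Otherwise 6
      divides \<open>k\<close>, and 4 divides \<open>l 6\<close>.\<close>
    have two: "even P \<or> 4 dvd l k" if "p = 2"
    proof (cases "even P")
      case False
      have r3: "rk 2 = 3" using rank_2_odd[OF False k(1)] k(2) that by simp
      have "i \<ge> 2"
      proof (rule ccontr)
        assume "\<not> i \<ge> 2"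
        then have "i = 0 \<or> i = 1" by auto
        then show False using n nk that r3 by (auto simp: k_def)
      qed
      then have "6 dvd k" using r3 that le_imp_power_dvd[of 1 i "2::nat"] mult_dvd_mono[of 3 3 2 "2 ^ i :: nat"] by (simp add: k_def)
      have e3: "even (l 3)" using rk(2)[OF p] r3 that by simp
      have "l 6 = l 3 * lucas_comp P Q 3" using lucas_int_mult[of P Q 3 2] by (simp add: numeral_2_eq_2)
      moreover have "even (lucas_comp P Q 3)" using e3 by (simp add: lucas_comp_def)
      ultimately have "2 * 2 dvd l 6" using e3 by (simp only:) (intro mult_dvd_mono)
      then show ?thesis using l_dvd[OF \<open>6 dvd k\<close>] dvd_trans by auto
    qed simp
    have "v p n \<le> v p k + 1" unfolding nk by (rule val_step[OF Sp(1)[OF p] k two])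
    moreover have "n div nat p = k" using nk np by simp
    moreover have "n \<noteq> rk p" using rk(3)[OF p] by simp
    ultimately show ?thesis using T True by (simp add: prim_exp_def)
  next
    case False
    then show ?thesis by (simp add: prim_exp_def)
  qed
  have cp: "cyc_prod \<phi> \<psi> n > 0" using dominant n by (intro cyc_prod_pos) auto
  have lnp: "ln (of_int p :: real) \<ge> 0" if "p \<in> ?S" for p using Sp(3)[OF that] by simp
  have finS: "finite ?S" by simp
  have "ln (cyc_prod \<phi> \<psi> n) = (\<Sum>p\<in>?S. prim_exp p n * ln (of_int p))" using n by (intro ln_cyc_prod) simp
  also have "\<dots> \<le> (\<Sum>p\<in>?S. (if p \<in> T then 1 else 0) * ln (of_int p))"
    by (intro sum_mono mult_right_mono w_le lnp)
  also have "\<dots> = (\<Sum>p\<in>T. ln (of_int p))"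
    using finS by (intro sum.mono_neutral_cong_right) (auto simp: T_def)
  finally have up: "ln (cyc_prod \<phi> \<psi> n) \<le> (\<Sum>p\<in>T. ln (of_int p))" .
  define q where "q = Max (prime_factors n)"
  have pfn: "prime_factors n \<noteq> {}" "finite (prime_factors n)"
  proof -
    obtain r where "prime r" "r dvd n" using prime_factor_nat[of n] n by auto
    then have "r \<in> prime_factors n" using n by (simp add: in_prime_factors_iff)
    then show "prime_factors n \<noteq> {}" by blast
  qed simp
  have q: "prime q" "q dvd n" using Max_in[OF pfn(2,1)] by (auto simp: q_def in_prime_factors_iff)
  have qmax: "r \<le> q" if "prime r" "r dvd n" for r
    unfolding q_def using that n pfn(2) by (intro Max_ge) (auto simp: in_prime_factors_iff)
  have Tp: "nat p \<le> q" "int q = p \<or> (p = 2 \<and> q = 3)" if p: "p \<in> T" for p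
  proof -
    have pS: "p \<in> ?S" using p by (simp add: T_def)
    obtain j where j: "n = rk p * nat p ^ Suc j" using p by (auto simp: T_def)
    have pn: "prime (nat p)" using Sp(1)[OF pS] prime_gt_0_int[of p] by (metis prime_int_nat_transfer)
    have "nat p dvd n" unfolding j by simp
    then show le: "nat p \<le> q" using qmax pn by blast
    have p1: "p > 1" using Sp(3)[OF pS] .
    \<comment> \<open>If \<open>q\<close> differs from \<open>p\<close>, it must divide
      \<open>rk p\<close>, which is at most \<open>p + 1\<close>. With \<open>p < q\<close> this
      leaves \<open>q = p + 1\<close>, and 2 and 3 are the only consecutive primes.\<close>
    show "int q = p \<or> (p = 2 \<and> q = 3)"
    proof (cases "q = nat p")
      case False
      have "q dvd rk p * nat p ^ Suc j" using q(2) j by simp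
      then have "q dvd rk p \<or> q dvd nat p ^ Suc j" using q(1) by (simp only: prime_dvd_mult_iff)
      moreover have "\<not> q dvd nat p ^ Suc j"
      proof
        assume "q dvd nat p ^ Suc j"
        then have "q dvd nat p" using q(1) prime_dvd_power by blast
        then show False using q(1) pn False by (simp add: primes_dvd_imp_eq)
      qed
      ultimately have "q \<le> rk p" using rk(1)[OF pS] dvd_imp_le by blast
      then have q1: "q = nat p + 1" using rk(5)[OF pS] le False p1 by linarith
      have "nat p = 2"
      proof (rule ccontr)
        assume "nat p \<noteq> 2"
        then have "odd (nat p)" using pn by (metis prime_odd_nat prime_ge_2_nat le_neq_implies_less)
        then have "even q" using q1 by simp
        then have "q = 2" using q(1) by (metis prime_odd_nat prime_ge_2_nat le_neq_implies_less)
        then show False using q1 p1 by simp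
      qed
      then show ?thesis using q1 p1 by auto
    qed (use p1 in simp)
  qed
  have q2: "q \<ge> 2" using q(1) by (rule prime_ge_2_nat)
  have "(\<Sum>p\<in>T. ln (of_int p)) \<le> ln (real (max q 6))"
  proof (cases "T \<subseteq> {int q}")
    case True
    then have "(\<Sum>p\<in>T. ln (of_int p)) \<le> (\<Sum>p\<in>{int q}. ln (of_int p :: real))"
      using q2 by (intro sum_mono2) auto
    also have "\<dots> \<le> ln (real (max q 6))" using q2 by simp
    finally show ?thesis .
  next
    case False
    then have q3: "q = 3" using Tp by blast
    have "T \<subseteq> {2, 3}" using Tp(2) q3 by force
    then have "(\<Sum>p\<in>T. ln (of_int p)) \<le> (\<Sum>p\<in>{2, 3}. ln (of_int p :: real))"
      by (intro sum_mono2) auto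
    also have "\<dots> = ln 2 + ln 3" by simp
    also have "\<dots> = ln 6" using ln_mult_pos[of 2 "3::real"] by simp
    finally show ?thesis using q3 by simp
  qed
  then have "ln (cyc_prod \<phi> \<psi> n) \<le> ln (real (max q 6))" using up by linarith
  then have ub: "cyc_prod \<phi> \<psi> n \<le> real (max q 6)" using cp q2 by simp
  have lb: "9/20 * (8/5) ^ totient n \<le> cyc_prod \<phi> \<psi> n" by (rule cyc_prod_bound[OF n])
  show False
  \<comment> \<open>For small \<open>q\<close> the bound \<open>totient n \<ge> 6\<close> suffices;
    for larger \<open>q\<close> it is replaced by \<open>totient n \<ge> q - 1\<close>.\<close>
  proof (cases "q \<le> 7")
    case True
    have "(7::real) < 9/20 * (8/5) ^ 6" by (simp add: eval_nat_numeral)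
    also have "\<dots> \<le> 9/20 * (8/5) ^ totient n" using totient_ge_6[OF n] by (intro mult_left_mono power_increasing) auto
    finally show False using lb ub True by simp
  next
    case False
    have "totient q \<le> totient n" using totient_dvd_mono[OF q(2)] n by simp
    then have t: "q - 1 \<le> totient n" using totient_prime[OF q(1)] by simp
    have "real q < 9/20 * (8/5) ^ (q - 1)" using False by (intro exp_growth_bound) simp
    also have "\<dots> \<le> 9/20 * (8/5) ^ totient n" using t by (intro mult_left_mono power_increasing) auto
    finally show False using lb ub False by simp
  qed
qed

end

section \<open>Riemann sums of the Bose function\<close>

text \<open>The function whose values at the points \<open>s * lam j\<close> add up to
  \<open>s * mean_sum s\<close> below.\<close>

definition bose :: "real \<Rightarrow> real" where "bose u = u / (exp u - 1)"
definition bose' :: "real \<Rightarrow> real" where "bose' u = (exp u - 1 - u * exp u) / (exp u - 1)\<^sup>2"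

text \<open>Divided by \<open>exp (u / 2)\<close> this is \<open>u \<le> 2 * sinh (u / 2)\<close>;
  the derivative of the difference is a square.\<close>

lemma expm1_ge: "u * exp (u / 2) \<le> exp u - 1" if "u \<ge> 0" for u :: real
proof -
  have "exp 0 - exp (-0) - 2 * 0 \<le> exp (u/2) - exp (-(u/2)) - 2 * (u/2)"
  proof (rule DERIV_nonneg_imp_nondecreasing[of 0 "u/2" "\<lambda>x. exp x - exp (-x) - 2 * x"])
    fix x :: real assume "0 \<le> x"
    have "exp x + exp (-x) - 2 = (exp (x/2) - exp (-(x/2)))\<^sup>2"
      by (simp add: power2_eq_square algebra_simps flip: exp_add)
    then have "0 \<le> exp x + exp (-x) - 2" by simp
    moreover have "((\<lambda>x. exp x - exp (-x) - 2 * x) has_real_derivative (exp x + exp (-x) - 2)) (at x)"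
      by (auto intro!: derivative_eq_intros)
    ultimately show "\<exists>y. ((\<lambda>x. exp x - exp (-x) - 2 * x) has_real_derivative y) (at x) \<and> 0 \<le> y" by blast
  qed (use that in auto)
  then have "u \<le> exp (u/2) - exp (-(u/2))" by simp
  then have "u * exp (u/2) \<le> (exp (u/2) - exp (-(u/2))) * exp (u/2)" by (intro mult_right_mono) auto
  then show ?thesis by (simp add: algebra_simps flip: exp_add)
qed

lemma expm1_pos [simp]: "u > 0 \<Longrightarrow> exp u - 1 > (0::real)"
  by simp

lemma bose_le_exp: "bose u \<le> exp (- (u / 2))" if "u > 0"
  using expm1_ge[of u] that unfolding bose_def
  by (simp add: exp_minus divide_simps mult.commute)

lemma bose_pos: "u > 0 \<Longrightarrow> bose u > 0"
  by (simp add: bose_def)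

lemma bose_le_1: "u > 0 \<Longrightarrow> bose u \<le> 1"
  unfolding bose_def using exp_ge_add_one_self[of u] expm1_pos[of u] by (metis add.commute diff_add_cancel diff_ge_0_iff_ge divide_le_eq_1_pos le_diff_eq)

lemma bose_ge: "1 - u / 2 \<le> bose u" if "u > 0"
proof -
  have "0 - (1 - 0 / 2) * (exp 0 - 1) \<le> u - (1 - u / 2) * (exp u - 1)"
  proof (rule DERIV_nonneg_imp_nondecreasing[of 0 u "\<lambda>u. u - (1 - u / 2) * (exp u - 1)"])
    fix x :: real assume "0 \<le> x"
    have "1 - x \<le> exp (-x)" using exp_ge_add_one_self[of "-x"] by simp
    then have "(1 - x) * exp x \<le> exp (-x) * exp x" by (intro mult_right_mono) auto
    then have "0 \<le> (1 - (1 - x) * exp x) / 2" by (simp flip: exp_add)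
    moreover have "((\<lambda>u. u - (1 - u / 2) * (exp u - 1)) has_real_derivative (1 - (1 - x) * exp x) / 2) (at x)"
      by (auto intro!: derivative_eq_intros simp: field_simps)
    ultimately show "\<exists>y. ((\<lambda>u. u - (1 - u / 2) * (exp u - 1)) has_real_derivative y) (at x) \<and> 0 \<le> y" by blast
  qed (use that in auto)
  then show ?thesis using that by (simp add: bose_def field_simps)
qed

lemma DERIV_bose: "(bose has_real_derivative bose' u) (at u)" if "u > 0"
proof -
  have "exp u - 1 \<noteq> 0" using that by simp
  then show ?thesis unfolding bose_def [abs_def] bose'_def
    by (auto intro!: derivative_eq_intros simp: power2_eq_square)
qed

lemma bose'_le_0: "bose' u \<le> 0" if "u > 0"
proof -
  have "1 - u \<le> exp (-u)" using exp_ge_add_one_self[of "-u"] by simp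
  then have "(1 - u) * exp u \<le> exp (-u) * exp u" by (intro mult_right_mono) auto
  then have "exp u - 1 - u * exp u \<le> 0" by (simp add: algebra_simps flip: exp_add)
  then show ?thesis unfolding bose'_def by (intro divide_nonpos_nonneg) auto
qed

lemma bose'_ge: "-1 \<le> bose' u" if "u > 0"
proof -
  have "u * exp u \<le> (exp u - 1) * exp u" using exp_ge_add_one_self[of u] by (intro mult_right_mono) (linarith | simp)+
  then have "- ((exp u - 1)\<^sup>2) \<le> exp u - 1 - u * exp u"
    by (simp add: power2_eq_square algebra_simps)
  then show ?thesis unfolding bose'_def using that by (simp add: field_simps)
qed

text \<open>Convexity of \<open>bose\<close>: up to a positive factor the second derivative is
  \<open>u * (exp u + 1) - 2 * (exp u - 1)\<close>, which vanishes at 0 and has the derivative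
  \<open>(u - 1) * exp u + 1 \<ge> 0\<close>.\<close>

lemma bose'_mono: "bose' x \<le> bose' y" if "0 < x" "x \<le> y"
proof (rule DERIV_nonneg_imp_nondecreasing[OF that(2)])
  fix u assume "x \<le> u"
  then have u: "u > 0" using that by simp
  have n2: "0 \<le> (v - 1) * exp v + 1" if "v \<ge> 0" for v :: real
  proof -
    have "1 - v \<le> exp (-v)" using exp_ge_add_one_self[of "-v"] by simp
    then have "(1 - v) * exp v \<le> exp (-v) * exp v" by (intro mult_right_mono) auto
    then show ?thesis by (simp add: algebra_simps flip: exp_add)
  qed
  have "0 * (exp 0 + 1) - 2 * (exp 0 - 1) \<le> u * (exp u + 1) - 2 * (exp u - 1)"
  proof (rule DERIV_nonneg_imp_nondecreasing[of 0 u "\<lambda>u. u * (exp u + 1) - 2 * (exp u - 1)"])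
    fix v :: real assume v: "0 \<le> v"
    have "((\<lambda>u. u * (exp u + 1) - 2 * (exp u - 1)) has_real_derivative ((v - 1) * exp v + 1)) (at v)"
      by (auto intro!: derivative_eq_intros simp: algebra_simps)
    with n2[OF v] show "\<exists>y. ((\<lambda>u. u * (exp u + 1) - 2 * (exp u - 1)) has_real_derivative y) (at v) \<and> 0 \<le> y"
      by blast
  qed (use u in auto)
  then have nn: "0 \<le> exp u * (u * (exp u + 1) - 2 * (exp u - 1)) / (exp u - 1) ^ 3" using u by simp
  define e where "e = exp u"
  have e: "e > 1" using u by (simp add: e_def)
  have "((\<lambda>u. (exp u - 1 - u * exp u) / (exp u - 1)\<^sup>2) has_real_derivative
     ((e - (e + u * e)) * (e - 1)\<^sup>2 - (e - 1 - u * e) * (2 * (e - 1) * e)) / ((e - 1)\<^sup>2 * (e - 1)\<^sup>2)) (at u)"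
    using e by (auto intro!: derivative_eq_intros simp: e_def algebra_simps)
  also have "((e - (e + u * e)) * (e - 1)\<^sup>2 - (e - 1 - u * e) * (2 * (e - 1) * e)) / ((e - 1)\<^sup>2 * (e - 1)\<^sup>2)
     = e * (u * (e + 1) - 2 * (e - 1)) / (e - 1) ^ 3"
  proof -
    have *: "((e - 1) * X) / ((e - 1) * Y) = X / Y" for X Y using e by simp
    have "((e - (e + u * e)) * (e - 1)\<^sup>2 - (e - 1 - u * e) * (2 * (e - 1) * e)) = (e - 1) * (e * (u * (e + 1) - 2 * (e - 1)))"
      by (simp add: power2_eq_square algebra_simps)
    moreover have "(e - 1)\<^sup>2 * (e - 1)\<^sup>2 = (e - 1) * (e - 1) ^ 3" by (simp add: power2_eq_square power3_eq_cube)
    ultimately show ?thesis using * by metis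
  qed
  finally show "\<exists>y. (bose' has_real_derivative y) (at u) \<and> 0 \<le> y"
    using nn unfolding bose'_def [abs_def] e_def by blast
qed

lemma bose'_lim: "(bose' \<longlongrightarrow> 0) at_top"
  unfolding bose'_def by real_asymp

section \<open>An antiderivative of the Bose function through the dilogarithm\<close>

definition dilog :: "real \<Rightarrow> real" where "dilog x = (\<Sum>k. 1 / (real k + 1)\<^sup>2 * x ^ Suc k)"

lemma dilog_1: "dilog 1 = pi\<^sup>2 / 6"
  using inverse_squares_sums by (simp add: dilog_def sums_iff add.commute)

lemma DERIV_dilog: "(dilog has_real_derivative - ln (1 - x) / x) (at x)" if "0 < x" "x < 1"
proof -
  have "((\<lambda>x. \<Sum>n. 1 / (real n + 1)\<^sup>2 * x ^ Suc n) has_real_derivative (\<Sum>n. 1 / (real n + 1)\<^sup>2 * real (Suc n) * x ^ n)) (at x)"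
  proof (rule DERIV_power_series'[of 1])
    fix y :: real assume y: "y \<in> {-1<..<1}"
    show "summable (\<lambda>n. 1 / (real n + 1)\<^sup>2 * real (Suc n) * y ^ n)"
    proof (rule summable_comparison_test'[where N = 0])
      show "summable (\<lambda>n. \<bar>y\<bar> ^ n)" using y by (intro summable_geometric) auto
      fix n :: nat
      have "1 / (real n + 1)\<^sup>2 * real (Suc n) \<le> 1" by (simp add: power2_eq_square divide_simps) (simp add: algebra_simps)
      then have "1 / (real n + 1)\<^sup>2 * real (Suc n) * \<bar>y\<bar> ^ n \<le> 1 * \<bar>y\<bar> ^ n" by (intro mult_right_mono) auto
      then show "norm (1 / (real n + 1)\<^sup>2 * real (Suc n) * y ^ n) \<le> \<bar>y\<bar> ^ n"
        by (simp add: abs_mult power_abs)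
    qed
  qed (use that in auto)
  also have "(\<Sum>n. 1 / (real n + 1)\<^sup>2 * real (Suc n) * x ^ n) = - ln (1 - x) / x"
  proof -
    have "ln (1 - x) = (\<Sum>n. (- 1) ^ n * (1 / real (n + 1)) * (1 - x - 1) ^ Suc n)"
      using that by (intro ln_series) auto
    also have "(\<lambda>n. (- 1) ^ n * (1 / real (n + 1)) * (1 - x - 1) ^ Suc n) = (\<lambda>n. - x * (1 / (real n + 1)\<^sup>2 * real (Suc n) * x ^ n))"
    proof
      fix n
      have "(- 1) ^ n * (1 / real (n + 1)) * (1 - x - 1) ^ Suc n = ((-1)^n * (- x) ^ n) * (- x) / real (n+1)" by simp
      also have "((-1)^n * (- x) ^ n) = x ^ n" by (simp flip: power_mult_distrib)
      also have "x ^ n * (- x) / real (n + 1) = - x * (1 / (real n + 1)\<^sup>2 * real (Suc n) * x ^ n)"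
        by (simp add: power2_eq_square divide_simps add.commute)
      finally show "(- 1) ^ n * (1 / real (n + 1)) * (1 - x - 1) ^ Suc n = - x * (1 / (real n + 1)\<^sup>2 * real (Suc n) * x ^ n)" .
    qed
    also have "(\<Sum>n. - x * (1 / (real n + 1)\<^sup>2 * real (Suc n) * x ^ n)) = - x * (\<Sum>n. 1 / (real n + 1)\<^sup>2 * real (Suc n) * x ^ n)"
    proof (rule suminf_mult)
      show "summable (\<lambda>n. 1 / (real n + 1)\<^sup>2 * real (Suc n) * x ^ n)"
      proof (rule summable_comparison_test'[where N = 0])
        show "summable (\<lambda>n. x ^ n)" using that by (intro summable_geometric) auto
        fix n :: nat
        have "1 / (real n + 1)\<^sup>2 * real (Suc n) \<le> 1" by (simp add: power2_eq_square divide_simps) (simp add: algebra_simps)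
        then have "1 / (real n + 1)\<^sup>2 * real (Suc n) * x ^ n \<le> 1 * x ^ n" using that by (intro mult_right_mono) auto
        then show "norm (1 / (real n + 1)\<^sup>2 * real (Suc n) * x ^ n) \<le> x ^ n"
          using that by (simp add: abs_mult)
      qed
    qed
    finally show ?thesis using that by simp
  qed
  finally show ?thesis unfolding dilog_def [abs_def] .
qed

lemma continuous_on_dilog: "continuous_on {0..1} dilog"
proof -
  have "uniform_limit {0..1} (\<lambda>n x. \<Sum>i<n. 1 / (real i + 1)\<^sup>2 * x ^ Suc i) (\<lambda>x. \<Sum>i. 1 / (real i + 1)\<^sup>2 * x ^ Suc i) sequentially"
  proof (rule Weierstrass_m_test)
    show "summable (\<lambda>n. 1 / (real n + 1)\<^sup>2)" using inverse_squares_sums by (simp add: sums_iff add.commute)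
    fix n and x :: real assume "x \<in> {0..1}"
    then show "norm (1 / (real n + 1)\<^sup>2 * x ^ Suc n) \<le> 1 / (real n + 1)\<^sup>2"
      using power_le_one[of x "Suc n"] by (simp add: abs_mult divide_right_mono)
  qed
  then show ?thesis unfolding dilog_def [abs_def]
    by (rule uniform_limit_theorem[rotated]) (auto intro!: always_eventually continuous_intros)
qed

text \<open>Normalized to vanish at infinity. Its limit at 0 is then minus the integral of
  \<open>bose\<close> over the half-line, and this is where the constant
  \<open>pi\<^sup>2 / 6\<close> enters, as \<open>dilog 1\<close>.\<close>

definition Bose :: "real \<Rightarrow> real" where "Bose u = u * ln (1 - exp (- u)) - dilog (exp (- u))"

lemma DERIV_Bose: "(Bose has_real_derivative bose u) (at u)" if "u > 0"
proof -
  have e: "exp (- u) < 1" using that by simp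
  have "((\<lambda>u. u * ln (1 - exp (- u)) - dilog (exp (- u))) has_real_derivative
     (ln (1 - exp (- u)) + u * (exp (-u) / (1 - exp (- u)))) - (- ln (1 - exp (- u)) / exp (- u)) * (- exp (- u))) (at u)"
    using e by (auto intro!: derivative_eq_intros DERIV_chain2[OF DERIV_dilog])
  moreover have "(ln (1 - exp (- u)) + u * (exp (-u) / (1 - exp (- u)))) - (- ln (1 - exp (- u)) / exp (- u)) * (- exp (- u))
     = bose u"
    using e by (simp add: bose_def exp_minus divide_simps)
  ultimately show ?thesis unfolding Bose_def [abs_def] by metis
qed

lemma Bose_at_right_0: "(Bose \<longlongrightarrow> - (pi\<^sup>2 / 6)) (at_right 0)"
proof -
  have "((\<lambda>u. dilog (exp (- u))) \<longlongrightarrow> dilog 1) (at_right 0)"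
  proof (rule continuous_on_tendsto_compose[OF continuous_on_dilog])
    show "((\<lambda>u::real. exp (- u)) \<longlongrightarrow> 1) (at_right 0)" by real_asymp
    show "\<forall>\<^sub>F u in at_right 0. exp (- u) \<in> {0..(1::real)}"
      using eventually_at_right_less[of "0::real"] by eventually_elim auto
  qed auto
  moreover have "((\<lambda>u::real. u * ln (1 - exp (- u))) \<longlongrightarrow> 0) (at_right 0)" by real_asymp
  ultimately show ?thesis unfolding Bose_def [abs_def] dilog_1 using tendsto_diff by fastforce
qed

lemma Bose_at_top: "(Bose \<longlongrightarrow> 0) at_top"
proof -
  have "((\<lambda>u. dilog (exp (- u))) \<longlongrightarrow> dilog 0) at_top"
  proof (rule continuous_on_tendsto_compose[OF continuous_on_dilog])
    show "((\<lambda>u::real. exp (- u)) \<longlongrightarrow> 0) at_top" by real_asymp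
    show "\<forall>\<^sub>F u in at_top. exp (- u) \<in> {0..(1::real)}"
      using eventually_ge_at_top[of "0::real"] by eventually_elim auto
  qed auto
  moreover have "((\<lambda>u::real. u * ln (1 - exp (- u))) \<longlongrightarrow> 0) at_top" by real_asymp
  moreover have "dilog 0 = 0" by (simp add: dilog_def)
  ultimately show ?thesis unfolding Bose_def [abs_def] using tendsto_diff by fastforce
qed

text \<open>The slope of \<open>Bose\<close> lies between \<open>1 - u / 2\<close> and 1. The
  comparison starts at some \<open>v > 0\<close>, and \<open>v\<close> then tends to 0, where only a
  limit of \<open>Bose\<close> is available.\<close>

lemma Bose_near_0: "\<bar>Bose u + pi\<^sup>2 / 6 - u\<bar> \<le> u\<^sup>2" if u: "u > 0"
proof -
  have le: "Bose u - u \<le> Bose v - v" if "0 < v" "v < u" for v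
  proof (rule DERIV_nonpos_imp_nonincreasing[of v u "\<lambda>x. Bose x - x"])
    fix x assume "v \<le> x"
    then have x: "x > 0" using that by simp
    have "((\<lambda>x. Bose x - x) has_real_derivative bose x - 1) (at x)"
      by (auto intro!: derivative_eq_intros DERIV_Bose x)
    then show "\<exists>y. ((\<lambda>x. Bose x - x) has_real_derivative y) (at x) \<and> y \<le> 0"
      using bose_le_1[OF x] by (intro exI[of _ "bose x - 1"]) auto
  qed (use that in auto)
  have ge: "Bose v - v + v\<^sup>2 / 4 \<le> Bose u - u + u\<^sup>2 / 4" if "0 < v" "v < u" for v
  proof (rule DERIV_nonneg_imp_nondecreasing[of v u "\<lambda>x. Bose x - x + x\<^sup>2 / 4"])
    fix x assume "v \<le> x"
    then have x: "x > 0" using that by simp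
    have "((\<lambda>x. Bose x - x + x\<^sup>2 / 4) has_real_derivative bose x - 1 + x / 2) (at x)"
      by (auto intro!: derivative_eq_intros DERIV_Bose x)
    then show "\<exists>y. ((\<lambda>x. Bose x - x + x\<^sup>2 / 4) has_real_derivative y) (at x) \<and> 0 \<le> y"
      using bose_ge[OF x] by (intro exI[of _ "bose x - 1 + x / 2"]) auto
  qed (use that in auto)
  have ev: "\<forall>\<^sub>F v in at_right 0. 0 < v \<and> v < u"
    using u by (simp add: eventually_at_right_field) (metis)
  have "((\<lambda>v. Bose v - v) \<longlongrightarrow> - (pi\<^sup>2 / 6) - 0) (at_right 0)"
    by (intro tendsto_diff Bose_at_right_0) real_asymp
  then have 1: "Bose u - u \<le> - (pi\<^sup>2 / 6) - 0"
    by (rule tendsto_lowerbound) (use ev in \<open>auto elim!: eventually_mono intro: le\<close>)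
  have "((\<lambda>v. Bose v - v + v\<^sup>2 / 4) \<longlongrightarrow> - (pi\<^sup>2 / 6) - 0 + 0) (at_right 0)"
    by (intro tendsto_diff tendsto_add Bose_at_right_0) real_asymp+
  then have 2: "- (pi\<^sup>2 / 6) - 0 + 0 \<le> Bose u - u + u\<^sup>2 / 4"
    by (rule tendsto_upperbound) (use ev in \<open>auto elim!: eventually_mono intro: ge\<close>)
  show ?thesis using 1 2 zero_le_power2[of u] by (simp only: abs_le_iff) linarith
qed

text \<open>By convexity of \<^const>\<open>bose\<close>.\<close>
lemma bose_midpoint:
  assumes "0 < h" "h < x"
  shows "2 * h * bose x \<le> Bose (x + h) - Bose (x - h)"
    and "Bose (x + h) - Bose (x - h) \<le> 2 * h * bose x + h\<^sup>2 * (bose' (x + h) - bose' (x - h))"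
proof -
  have diff: "bose b - bose a \<le> (b - a) * bose' b \<and> (b - a) * bose' a \<le> bose b - bose a" if "0 < a" "a \<le> b" for a b
  proof (cases "a = b")
    case False
    then have "a < b" using that by simp
    have "\<exists>z. a < z \<and> z < b \<and> bose b - bose a = (b - a) * bose' z"
      by (rule MVT2[OF \<open>a < b\<close>]) (use that DERIV_bose in auto)
    then obtain z where z: "a < z" "z < b" "bose b - bose a = (b - a) * bose' z" by blast
    then show ?thesis using that bose'_mono[of a z] bose'_mono[of z b] by (auto intro!: mult_left_mono)
  qed auto
  \<comment> \<open>The midpoint error as a function of the half width \<open>t\<close>: it vanishes
    at 0, and its derivative is a second difference of \<open>bose\<close>.\<close>
  have D: "((\<lambda>t. Bose (x + t) - Bose (x - t) - 2 * t * bose x) has_real_derivative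
      bose (x + t) + bose (x - t) - 2 * bose x) (at t)" if "0 \<le> t" "t \<le> h" for t
    using that assms by (auto intro!: derivative_eq_intros DERIV_chain2[OF DERIV_Bose])
  have bd: "0 \<le> bose (x + t) + bose (x - t) - 2 * bose x" 
       "bose (x + t) + bose (x - t) - 2 * bose x \<le> h * (bose' (x + h) - bose' (x - h))" if "0 \<le> t" "t \<le> h" for t
  proof -
    have 1: "bose (x + t) - bose x \<le> t * bose' (x + t)" "t * bose' x \<le> bose (x + t) - bose x"
      using diff[of x "x + t"] that assms by auto
    have 2: "bose x - bose (x - t) \<le> t * bose' x" "t * bose' (x - t) \<le> bose x - bose (x - t)"
      using diff[of "x - t" x] that assms by auto
    show "0 \<le> bose (x + t) + bose (x - t) - 2 * bose x" using 1 2 by linarith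
    have "bose (x + t) + bose (x - t) - 2 * bose x \<le> t * (bose' (x + t) - bose' (x - t))"
      using 1 2 by (simp add: algebra_simps)
    also have "\<dots> \<le> h * (bose' (x + h) - bose' (x - h))"
      using that assms bose'_mono[of "x + t" "x + h"] bose'_mono[of "x - h" "x - t"] bose'_mono[of "x - t" "x + t"]
      by (intro mult_mono) auto
    finally show "bose (x + t) + bose (x - t) - 2 * bose x \<le> h * (bose' (x + h) - bose' (x - h))" .
  qed
  have "\<exists>t. 0 < t \<and> t < h \<and> (Bose (x + h) - Bose (x - h) - 2 * h * bose x) - (Bose (x + 0) - Bose (x - 0) - 2 * 0 * bose x)
     = (h - 0) * (bose (x + t) + bose (x - t) - 2 * bose x)"
    by (rule MVT2) (use assms D in auto)
  then obtain t where t: "0 < t" "t < h" "Bose (x + h) - Bose (x - h) - 2 * h * bose x = h * (bose (x + t) + bose (x - t) - 2 * bose x)"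
    by auto
  show "2 * h * bose x \<le> Bose (x + h) - Bose (x - h)"
    using t bd(1)[of t] assms mult_nonneg_nonneg[of h "bose (x + t) + bose (x - t) - 2 * bose x"] by linarith
  have "h * (bose (x + t) + bose (x - t) - 2 * bose x) \<le> h * (h * (bose' (x + h) - bose' (x - h)))"
    using bd(2)[of t] t assms by (intro mult_left_mono) auto
  then show "Bose (x + h) - Bose (x - h) \<le> 2 * h * bose x + h\<^sup>2 * (bose' (x + h) - bose' (x - h))"
    using t(3) by (simp add: power2_eq_square mult.assoc algebra_simps)
qed

text \<open>The sample points are midpoints of cells of length \<open>s\<close> that begin at
  \<open>x - s / 2\<close>. The convexity errors of \<open>bose_midpoint\<close> telescope through
  \<open>bose'\<close>, so their total over infinitely many cells is still of order
  \<open>s\<^sup>2\<close>.\<close>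

lemma bose_riemann_sum:
  assumes s: "s > 0" and x: "x > s / 2"
  shows "summable (\<lambda>i. bose (x + s * real i))"
    and "\<bar>s * (\<Sum>i. bose (x + s * real i)) + Bose (x - s / 2)\<bar> \<le> s\<^sup>2"
proof -
  have xi: "s / 2 < x + s * real i" for i using s x mult_nonneg_nonneg[of s "real i"] by linarith
  have step: "x + s * real i + s / 2 = x + s * real (Suc i) - s / 2" for i by (simp add: algebra_simps)
  have mid: "s * bose (x + s * real i) \<le> Bose (x + s * real (Suc i) - s/2) - Bose (x + s * real i - s/2)"
      "Bose (x + s * real (Suc i) - s/2) - Bose (x + s * real i - s/2) \<le> s * bose (x + s * real i) +
       (s / 2)\<^sup>2 * (bose' (x + s * real (Suc i) - s / 2) - bose' (x + s * real i - s/2))" for i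
    using bose_midpoint[of "s/2" "x + s * real i"] s xi[of i] unfolding step by auto
  have lim: "filterlim (\<lambda>i. x + s * real i - s / 2) at_top sequentially" using s by real_asymp
  have tB: "(\<lambda>i. Bose (x + s * real (Suc i) - s/2) - Bose (x + s * real i - s/2)) sums (0 - Bose (x + s * real 0 - s / 2))"
    by (rule telescope_sums) (rule filterlim_compose[OF Bose_at_top lim])
  have tb: "(\<lambda>i. bose' (x + s * real (Suc i) - s/2) - bose' (x + s * real i - s/2)) sums (0 - bose' (x + s * real 0 - s / 2))"
    by (rule telescope_sums) (rule filterlim_compose[OF bose'_lim lim])
  have pos: "bose (x + s * real i) > 0" for i using xi[of i] s by (intro bose_pos) linarith
  have sm: "summable (\<lambda>i. s * bose (x + s * real i))"
  proof (rule summable_comparison_test'[where N = 0])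
    show "summable (\<lambda>i. Bose (x + s * real (Suc i) - s/2) - Bose (x + s * real i - s/2))"
      using tB by (rule sums_summable)
    show "norm (s * bose (x + s * real i)) \<le> Bose (x + s * real (Suc i) - s/2) - Bose (x + s * real i - s/2)" for i
      using mid(1)[of i] pos[of i] s by simp
  qed
  then show sm': "summable (\<lambda>i. bose (x + s * real i))" using s by (simp add: summable_cmult_iff)
  have eq: "(\<Sum>i. s * bose (x + s * real i)) = s * (\<Sum>i. bose (x + s * real i))"
    by (rule suminf_mult[OF sm'])
  have 1: "(\<Sum>i. s * bose (x + s * real i)) \<le> 0 - Bose (x + s * real 0 - s / 2)"
    using suminf_le[OF mid(1) sm sums_summable[OF tB]] tB by (simp add: sums_iff)
  have tb': "(\<lambda>i. s * bose (x + s * real i) + (s / 2)\<^sup>2 * (bose' (x + s * real (Suc i) - s / 2) - bose' (x + s * real i - s/2)))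
     sums (s * (\<Sum>i. bose (x + s * real i)) + (s/2)\<^sup>2 * (0 - bose' (x + s * real 0 - s / 2)))"
    using sums_add[OF sums_mult[OF summable_sums[OF sm']] sums_mult[OF tb]] .
  have 2: "0 - Bose (x + s * real 0 - s / 2) \<le> s * (\<Sum>i. bose (x + s * real i)) + (s/2)\<^sup>2 * (0 - bose' (x + s * real 0 - s / 2))"
    using suminf_le[OF mid(2) sums_summable[OF tB] sums_summable[OF tb']] tB tb' by (simp add: sums_iff)
  have "(s/2)\<^sup>2 * (0 - bose' (x + s * real 0 - s / 2)) \<le> (s/2)\<^sup>2 * 1"
    using bose'_ge[of "x - s/2"] x by (intro mult_left_mono) auto
  also have "\<dots> \<le> s\<^sup>2" by (simp add: power2_eq_square)
  finally show "\<bar>s * (\<Sum>i. bose (x + s * real i)) + Bose (x - s / 2)\<bar> \<le> s\<^sup>2"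
    using 1 2 eq by simp
qed

section \<open>Generating functions of almost arithmetic progressions\<close>

lemma bose_lipschitz: "\<bar>bose x - bose y\<bar> \<le> \<bar>x - y\<bar>" if "x > 0" "y > 0"
proof -
  have *: "\<bar>bose x - bose y\<bar> \<le> \<bar>x - y\<bar>" if "0 < x" "x < y" for x y
  proof -
    have "\<exists>z. x < z \<and> z < y \<and> bose y - bose x = (y - x) * bose' z"
      by (rule MVT2[OF \<open>x < y\<close>]) (use that DERIV_bose in auto)
    then obtain z where z: "x < z" "bose y - bose x = (y - x) * bose' z" by blast
    have "\<bar>(y - x) * bose' z\<bar> \<le> \<bar>y - x\<bar> * 1"
      unfolding abs_mult using bose'_ge[of z] bose'_le_0[of z] z that by (intro mult_left_mono) auto
    then show ?thesis unfolding z(2)[symmetric] by (simp add: abs_minus_commute)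
  qed
  show ?thesis
    using *[of x y] *[of y x] that by (cases x y rule: linorder_cases) auto
qed

text \<open>Mean of the geometric law of ratio \<open>exp (- u)\<close>, the Bose-Einstein
  occupation number. The variance of that law is
  \<open>bose_occ u + (bose_occ u)\<^sup>2\<close>.\<close>

definition bose_occ :: "real \<Rightarrow> real" where "bose_occ u = 1 / (exp u - 1)"

lemma bose_occ_pos: "u > 0 \<Longrightarrow> bose_occ u > 0"
  by (simp add: bose_occ_def)

lemma bose_occ_antimono: "0 < x \<Longrightarrow> x \<le> y \<Longrightarrow> bose_occ y \<le> bose_occ x"
  unfolding bose_occ_def by (intro divide_left_mono) (auto intro!: mult_pos_pos)

lemma mult_bose_occ: "u * bose_occ u = bose u"
  by (simp add: bose_occ_def bose_def)

lemma DERIV_bose_occ: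
  "((\<lambda>s. bose_occ (s * l)) has_real_derivative - l * (bose_occ (s * l) + (bose_occ (s * l))\<^sup>2)) (at s)"
  if "s > 0" "l > 0" for s l :: real
proof -
  define e where "e = exp (s * l)"
  have e: "e > 1" using that by (simp add: e_def)
  have "((\<lambda>s. 1 / (exp (s * l) - 1)) has_real_derivative - (l * e) / (e - 1)\<^sup>2) (at s)"
    using e unfolding e_def by (auto intro!: derivative_eq_intros simp: power2_eq_square)
  also have "- (l * e) / (e - 1)\<^sup>2 = - l * (1 / (e - 1) + (1 / (e - 1))\<^sup>2)"
  proof -
    have "1 / (e - 1) + (1 / (e - 1))\<^sup>2 = (e - 1) / (e - 1)\<^sup>2 + 1 / (e - 1)\<^sup>2"
      using e by (simp add: power2_eq_square)
    also have "\<dots> = e / (e - 1)\<^sup>2" by (simp flip: add_divide_distrib)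
    finally show ?thesis by simp
  qed
  finally show ?thesis unfolding bose_occ_def e_def .
qed

lemma exp_geometric_bound:
  assumes "x > (0::real)"
  shows "summable (\<lambda>j. exp (- x * (real j + 1)))" "(\<Sum>j. exp (- x * (real j + 1))) \<le> 1 / x"
proof -
  have eq: "exp (- x * (real j + 1)) = exp (-x) * exp (-x) ^ j" for j
    by (simp add: exp_of_nat_mult[symmetric] algebra_simps flip: exp_add)
  have q: "norm (exp (-x)) < 1" using assms by simp
  show "summable (\<lambda>j. exp (- x * (real j + 1)))"
    unfolding eq using q by (intro summable_mult summable_geometric)
  have "(\<Sum>j. exp (- x * (real j + 1))) = exp (-x) * (1 / (1 - exp (-x)))"
    unfolding eq using q by (subst suminf_mult) (auto intro!: summable_geometric simp: suminf_geometric)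
  also have "\<dots> = 1 / (exp x - 1)" using assms by (simp add: exp_minus field_simps)
  also have "\<dots> \<le> 1 / x"
  proof (rule divide_left_mono)
    show "x \<le> exp x - 1" using exp_ge_add_one_self[of x] by linarith
  qed (use assms in auto)
  finally show "(\<Sum>j. exp (- x * (real j + 1))) \<le> 1 / x" .
qed

text \<open>Summability of the deviations is what the Lipschitz bound for \<open>bose\<close> needs:
  the sums over \<open>bose (s * lam j)\<close> and over the exact progression then differ by
  O(\<open>s\<close>). Positivity concerns \<open>lam\<close> only; \<open>b\<close> may be any real
  number.\<close>

locale almost_arith_seq =
  fixes lam :: "nat \<Rightarrow> real" and b :: real
  assumes lam_pos: "lam j > 0"
    and lam_summable: "summable (\<lambda>j. \<bar>lam j - (real j + b)\<bar>)"
begin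

lemma lam_dev_bound: obtains K where "K > 0" "\<And>j. \<bar>lam j - real j\<bar> \<le> K"
proof
  have bd: "\<bar>lam j - (real j + b)\<bar> \<le> (\<Sum>j. \<bar>lam j - (real j + b)\<bar>)" for j
    using sum_le_suminf[OF lam_summable, of "{j}"] by auto
  show "\<bar>lam j - real j\<bar> \<le> (\<Sum>j. \<bar>lam j - (real j + b)\<bar>) + \<bar>b\<bar> + 1" for j
    using bd[of j] by linarith
  show "(\<Sum>j. \<bar>lam j - (real j + b)\<bar>) + \<bar>b\<bar> + 1 > 0"
    using suminf_nonneg[OF lam_summable] by auto
qed

lemma lam_ge: obtains c where "c > 0" "\<And>j. c * (real j + 1) \<le> lam j"
proof -
  obtain K where K: "K > 0" "\<And>j. \<bar>lam j - real j\<bar> \<le> K" by (rule lam_dev_bound) blast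
  define N where "N = nat \<lceil>2 * K + 1\<rceil>"
  have N: "real N \<ge> 2 * K + 1" unfolding N_def by linarith
  define c0 where "c0 = Min (lam ` {..N})"
  have c0: "c0 > 0" unfolding c0_def using lam_pos by (subst Min_gr_iff) auto
  define c where "c = min (1/2) (c0 / (real N + 1))"
  show ?thesis
  proof
    show "c > 0" using c0 by (simp add: c_def)
    fix j show "c * (real j + 1) \<le> lam j"
    proof (cases "j \<le> N")
      case True
      have "c * (real j + 1) \<le> (c0 / (real N + 1)) * (real N + 1)"
        using True c0 by (intro mult_mono) (auto simp: c_def)
      also have "\<dots> = c0" by simp
      also have "c0 \<le> lam j" unfolding c0_def using True by (intro Min_le) auto
      finally show ?thesis .
    next
      case False
      have "c \<le> 1/2" unfolding c_def by (rule min.cobounded1)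
      then have "c * (real j + 1) \<le> (1/2) * (real j + 1)" by (intro mult_right_mono) auto
      also have "\<dots> \<le> real j - K" using False N by simp
      also have "\<dots> \<le> lam j" using K(2)[of j] by linarith
      finally show ?thesis .
    qed
  qed
qed

lemma exp_sum_bound:
  obtains C where "C > 0" "\<And>s. s > 0 \<Longrightarrow> summable (\<lambda>j. exp (- (s * lam j / 2)))"
    "\<And>s. s > 0 \<Longrightarrow> (\<Sum>j. exp (- (s * lam j / 2))) \<le> C / s"
proof -
  obtain c where c: "c > 0" "\<And>j. c * (real j + 1) \<le> lam j" by (rule lam_ge) blast
  have le: "exp (- (s * lam j / 2)) \<le> exp (- (s * c / 2) * (real j + 1))" if "s > 0" for s j
    using mult_left_mono[OF c(2)[of j], of s] that by simp
  have sm: "summable (\<lambda>j. exp (- (s * lam j / 2)))" if "s > 0" for s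
    by (rule summable_comparison_test'[OF exp_geometric_bound(1)[of "s * c / 2"], of 0]) (use le c that in auto)
  show ?thesis
  proof
    show "2 / c > 0" using c by simp
    fix s :: real assume s: "s > 0"
    show "summable (\<lambda>j. exp (- (s * lam j / 2)))" by (rule sm[OF s])
    have "(\<Sum>j. exp (- (s * lam j / 2))) \<le> (\<Sum>j. exp (- (s * c / 2) * (real j + 1)))"
      by (rule suminf_le[OF le[OF s] sm[OF s]]) (use c s in \<open>intro exp_geometric_bound, auto\<close>)
    also have "\<dots> \<le> 1 / (s * c / 2)" using c s by (intro exp_geometric_bound) auto
    also have "\<dots> = 2 / c / s" by simp
    finally show "(\<Sum>j. exp (- (s * lam j / 2))) \<le> 2 / c / s" .
  qed
qed

text \<open>Quantities of the law with parameter \<open>s\<close>: \<open>occ\<close> is the mean of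
  the \<open>j\<close>-th multiplicity, \<open>mean_sum\<close> and \<open>var_sum\<close> are the
  mean and the variance of the total, and \<open>log_gf\<close> is the logarithm of the generating
  function.\<close>

definition occ :: "real \<Rightarrow> nat \<Rightarrow> real" where "occ s j = bose_occ (s * lam j)"
definition mean_sum :: "real \<Rightarrow> real" where "mean_sum s = (\<Sum>j. lam j * occ s j)"
definition log_gf :: "real \<Rightarrow> real" where "log_gf s = (\<Sum>j. - ln (1 - exp (- (s * lam j))))"
definition var_sum :: "real \<Rightarrow> real" where "var_sum s = (\<Sum>j. (lam j)\<^sup>2 * (occ s j + (occ s j)\<^sup>2))"

lemma occ_pos: "s > 0 \<Longrightarrow> occ s j > 0"
  unfolding occ_def using lam_pos[of j] by (intro bose_occ_pos) simp

lemma bose_summable: "summable (\<lambda>j. bose (s * lam j))" if s: "s > 0"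
proof -
  obtain C where C: "\<And>s. s > 0 \<Longrightarrow> summable (\<lambda>j. exp (- (s * lam j / 2)))" by (rule exp_sum_bound) blast
  show ?thesis
  proof (rule summable_comparison_test'[OF C[OF s], of 0])
    fix j show "norm (bose (s * lam j)) \<le> exp (- (s * lam j / 2))"
      using bose_le_exp[of "s * lam j"] bose_pos[of "s * lam j"] lam_pos[of j] s by simp
  qed
qed

lemma mean_term: "s * (lam j * occ s j) = bose (s * lam j)"
  unfolding occ_def by (simp flip: mult_bose_occ)

lemma mean_summable: "summable (\<lambda>j. lam j * occ s j)" if s: "s > 0"
  using bose_summable[OF s] s unfolding mean_term[symmetric] by (simp add: summable_cmult_iff)

lemma mean_sum_eq: "s * mean_sum s = (\<Sum>j. bose (s * lam j))" if s: "s > 0"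
  unfolding mean_sum_def suminf_mult[OF mean_summable[OF s], symmetric] mean_term ..

text \<open>Below \<open>j0\<close> each term \<open>bose (s * lam j)\<close> is 1 +
  O(\<open>s\<close>), which gives \<open>j0\<close> in total. From \<open>j0\<close> on the points
  of the progression lie beyond \<open>s / 2\<close>, and the Riemann sum is
  \<open>pi\<^sup>2 / (6 * s) - (j0 + b - 1/2)\<close> up to O(\<open>s\<close>). The two
  contributions of \<open>j0\<close> cancel; the \<open>1/2\<close> is the half cell of the midpoint
  rule.\<close>

lemma mean_sum_asymp:
  obtains C where "C > 0" "\<And>s. s > 0 \<Longrightarrow> \<bar>mean_sum s - (pi\<^sup>2 / (6 * s\<^sup>2) - (b - 1/2) / s)\<bar> \<le> C"
proof -
  define j0 where "j0 = nat \<lceil>2 - b\<rceil>"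
  have j0: "real j0 + b > 1" unfolding j0_def by linarith
  define E where "E = (\<Sum>i. \<bar>lam (i + j0) - (real (i + j0) + b)\<bar>)"
  have Esm: "summable (\<lambda>i. \<bar>lam (i + j0) - (real (i + j0) + b)\<bar>)"
    using lam_summable by (subst summable_iff_shift) 
  have E0: "E \<ge> 0" unfolding E_def by (rule suminf_nonneg[OF Esm]) auto
  define D where "D = (\<Sum>j<j0. lam j)"
  have D0: "D \<ge> 0" unfolding D_def using lam_pos by (intro sum_nonneg) (auto intro: less_imp_le)
  define C where "C = 1 + (real j0 + b)\<^sup>2 + E + D"
  show ?thesis
  proof
    show "C > 0" unfolding C_def using E0 D0 by (simp add: add_pos_nonneg)
    fix s :: real assume s: "s > 0"
    define x where "x = s * (real j0 + b)"
    have x: "x > s / 2" unfolding x_def using mult_strict_left_mono[OF j0 s] s by linarith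
    define T where "T = (\<Sum>i. bose (x + s * real i))"
    have r: "\<bar>s * T + Bose (x - s / 2)\<bar> \<le> s\<^sup>2" unfolding T_def by (rule bose_riemann_sum[OF s x])
    have "\<bar>Bose (x - s/2) + pi\<^sup>2 / 6 - (x - s/2)\<bar> \<le> (x - s/2)\<^sup>2" by (rule Bose_near_0) (use x in auto)
    also have "\<dots> \<le> x\<^sup>2" using x s by (intro power_mono) auto
    also have "\<dots> = s\<^sup>2 * (real j0 + b)\<^sup>2" by (simp add: x_def power_mult_distrib)
    finally have r2: "\<bar>s * T - pi\<^sup>2 / 6 + (x - s/2)\<bar> \<le> s\<^sup>2 + s\<^sup>2 * (real j0 + b)\<^sup>2" using r by linarith
    have sm1: "summable (\<lambda>i. bose (s * lam (i + j0)))"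
      using bose_summable[OF s] by (subst summable_iff_shift)
    have sm2: "summable (\<lambda>i. bose (x + s * real i))" by (rule bose_riemann_sum[OF s x])
    have term_le: "\<bar>bose (s * lam (i + j0)) - bose (x + s * real i)\<bar> \<le> s * \<bar>lam (i + j0) - (real (i + j0) + b)\<bar>" for i
    proof -
      have "\<bar>bose (s * lam (i + j0)) - bose (x + s * real i)\<bar> \<le> \<bar>s * lam (i + j0) - (x + s * real i)\<bar>"
      proof (rule bose_lipschitz)
        show "0 < x + s * real i" using x s mult_nonneg_nonneg[of s "real i"] by linarith
      qed (use s lam_pos in auto)
      also have "s * lam (i + j0) - (x + s * real i) = s * (lam (i + j0) - (real (i + j0) + b))"
        by (simp add: x_def algebra_simps)
      finally show ?thesis using s by (simp add: abs_mult)
    qed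
    have sm3: "summable (\<lambda>i. s * \<bar>lam (i + j0) - (real (i + j0) + b)\<bar>)" using Esm by (rule summable_mult)
    have sm4: "summable (\<lambda>i. \<bar>bose (s * lam (i + j0)) - bose (x + s * real i)\<bar>)"
      by (rule summable_comparison_test'[OF sm3, of 0]) (use term_le in auto)
    have "\<bar>(\<Sum>i. bose (s * lam (i + j0))) - T\<bar> = \<bar>\<Sum>i. bose (s * lam (i + j0)) - bose (x + s * real i)\<bar>"
      unfolding T_def by (simp add: suminf_diff[OF sm1 sm2])
    also have "\<dots> \<le> (\<Sum>i. \<bar>bose (s * lam (i + j0)) - bose (x + s * real i)\<bar>)"
      using sm4 by (rule summable_rabs)
    also have "\<dots> \<le> (\<Sum>i. s * \<bar>lam (i + j0) - (real (i + j0) + b)\<bar>)"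
      by (rule suminf_le[OF term_le sm4 sm3])
    also have "\<dots> = s * E" unfolding E_def by (rule suminf_mult[OF Esm])
    finally have t1: "\<bar>(\<Sum>i. bose (s * lam (i + j0))) - T\<bar> \<le> s * E" .
    have "\<bar>(\<Sum>j<j0. bose (s * lam j)) - real j0\<bar> = \<bar>\<Sum>j<j0. (bose (s * lam j) - 1)\<bar>"
      by (simp add: sum_subtractf)
    also have "\<dots> \<le> (\<Sum>j<j0. \<bar>bose (s * lam j) - 1\<bar>)" by (rule sum_abs)
    also have "\<dots> \<le> (\<Sum>j<j0. s * lam j)"
    proof (rule sum_mono)
      fix j
      have "s * lam j > 0" using s lam_pos by simp
      then show "\<bar>bose (s * lam j) - 1\<bar> \<le> s * lam j"
        using bose_ge[of "s * lam j"] bose_le_1[of "s * lam j"] by linarith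
    qed
    also have "\<dots> = s * D" by (simp add: D_def sum_distrib_left)
    finally have t2: "\<bar>(\<Sum>j<j0. bose (s * lam j)) - real j0\<bar> \<le> s * D" .
    have "s * mean_sum s = (\<Sum>i. bose (s * lam (i + j0))) + (\<Sum>j<j0. bose (s * lam j))"
      unfolding mean_sum_eq[OF s] by (rule suminf_split_initial_segment[OF bose_summable[OF s]])
    then have t3: "\<bar>s * mean_sum s - (T + real j0)\<bar> \<le> s * E + s * D" using t1 t2 by linarith
    have "s * \<bar>T - (pi\<^sup>2 / (6 * s) - (real j0 + b - 1/2))\<bar> = \<bar>s * T - pi\<^sup>2 / 6 + (x - s/2)\<bar>"
    proof -
      have "s * (T - (pi\<^sup>2 / (6 * s) - (real j0 + b - 1/2))) = s * T - pi\<^sup>2 / 6 + (x - s/2)"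
        using s by (simp add: x_def field_simps)
      then show ?thesis using s by (metis abs_mult abs_of_pos)
    qed
    also have "\<dots> \<le> s * (s * (1 + (real j0 + b)\<^sup>2))" using r2 by (simp add: power2_eq_square algebra_simps)
    finally have "\<bar>T - (pi\<^sup>2 / (6 * s) - (real j0 + b - 1/2))\<bar> \<le> s * (1 + (real j0 + b)\<^sup>2)"
      using s by simp
    then have t4: "\<bar>s * mean_sum s - (pi\<^sup>2 / (6 * s) - (b - 1/2))\<bar> \<le> s * C"
      using t3 unfolding C_def by (simp only: distrib_left abs_le_iff) linarith
    have "s * (pi\<^sup>2 / (6 * s\<^sup>2) - (b - 1/2) / s) = pi\<^sup>2 / (6 * s) - (b - 1/2)"
      using s by (simp add: power2_eq_square field_simps)
    then have "\<bar>s * (mean_sum s - (pi\<^sup>2 / (6 * s\<^sup>2) - (b - 1/2) / s))\<bar> \<le> s * C"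
      using t4 by (simp only: right_diff_distrib)
    then have "s * \<bar>mean_sum s - (pi\<^sup>2 / (6 * s\<^sup>2) - (b - 1/2) / s)\<bar> \<le> s * C"
      using s by (simp only: abs_mult abs_of_pos)
    then show "\<bar>mean_sum s - (pi\<^sup>2 / (6 * s\<^sup>2) - (b - 1/2) / s)\<bar> \<le> C" using s by simp
  qed
qed

lemma log_term_bound: "0 \<le> - ln (1 - exp (- u))" "- ln (1 - exp (- u)) \<le> bose_occ u" if "u > 0"
proof -
  have e: "exp (-u) < 1" "exp u > 1" using that by auto
  show "0 \<le> - ln (1 - exp (- u))" using e ln_le_zero_iff[of "1 - exp(-u)"] by simp
  have "- ln (1 - exp (-u)) = ln (1 / (1 - exp (-u)))" using e by (simp add: ln_div)
  also have "\<dots> \<le> 1 / (1 - exp (-u)) - 1" using e by (intro ln_le_minus_one) simp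
  also have "\<dots> = bose_occ u" using e by (simp add: bose_occ_def exp_minus divide_simps)
  finally show "- ln (1 - exp (- u)) \<le> bose_occ u" .
qed

lemma occ_summable: "summable (occ s)" if s: "s > 0"
proof -
  obtain c where c: "c > 0" "\<And>j. c * (real j + 1) \<le> lam j" by (rule lam_ge) blast
  have "c \<le> lam j" for j
    using c(2)[of j] mult_nonneg_nonneg[of c "real j"] c(1) unfolding distrib_left mult_1_right by linarith
  show ?thesis
  proof (rule summable_comparison_test'[OF summable_mult[OF mean_summable[OF s], of "1/c"], of 0])
    fix j
    have "c * occ s j \<le> lam j * occ s j"
      using \<open>c \<le> lam j\<close> occ_pos[OF s, of j] by (intro mult_right_mono) auto
    then show "norm (occ s j) \<le> 1 / c * (lam j * occ s j)"
      using c(1) occ_pos[OF s, of j] by (simp add: field_simps)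
  qed
qed

lemma log_gf_summable: "summable (\<lambda>j. - ln (1 - exp (- (s * lam j))))" if s: "s > 0"
proof (rule summable_comparison_test'[OF occ_summable[OF s], of 0])
  fix j show "norm (- ln (1 - exp (- (s * lam j)))) \<le> occ s j"
    using log_term_bound[of "s * lam j"] s lam_pos[of j] by (simp add: occ_def)
qed

lemma DERIV_log_gf: "(log_gf has_real_derivative - mean_sum s) (at s)" if s: "s > 0"
proof -
  have "((\<lambda>s. \<Sum>j. - ln (1 - exp (- (s * lam j)))) has_real_derivative (\<Sum>j. - (lam j * occ s j))) (at s)"
  proof (rule has_field_derivative_series'(2)[of "{s/2<..}" _ "\<lambda>j s. - (lam j * occ s j)" s])
    fix j and x :: real assume "x \<in> {s/2<..}"
    then have x: "x > 0" using s by auto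
    have e: "exp (- (x * lam j)) < 1" using x lam_pos[of j] by simp
    have "((\<lambda>x. - ln (1 - exp (- (x * lam j)))) has_real_derivative 
      - (lam j * exp (- (x * lam j)) / (1 - exp (- (x * lam j))))) (at x within {s/2<..})"
      using e by (auto intro!: derivative_eq_intros)
    also have "lam j * exp (- (x * lam j)) / (1 - exp (- (x * lam j))) = lam j * occ x j"
      using e by (simp add: occ_def bose_occ_def exp_minus divide_simps)
    finally show "((\<lambda>x. - ln (1 - exp (- (x * lam j)))) has_real_derivative - (lam j * occ x j)) (at x within {s/2<..})" .
  next
    show "uniformly_convergent_on {s/2<..} (\<lambda>n x. \<Sum>i<n. - (lam i * occ x i))"
    proof (rule Weierstrass_m_test'_ev)
      show "summable (\<lambda>j. lam j * occ (s/2) j)" using s by (intro mean_summable) auto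
      show "\<forall>\<^sub>F n in sequentially. \<forall>x\<in>{s / 2<..}. norm (- (lam n * occ x n)) \<le> lam n * occ (s / 2) n"
      proof (intro always_eventually allI ballI)
        fix n and x :: real assume x: "x \<in> {s/2<..}"
        have "occ x n \<le> occ (s/2) n" unfolding occ_def
          using x s lam_pos[of n] by (intro bose_occ_antimono mult_right_mono) auto
        then show "norm (- (lam n * occ x n)) \<le> lam n * occ (s / 2) n"
          using lam_pos[of n] occ_pos[of x n] x s by (auto simp: abs_mult)
      qed
    qed
  qed (use s log_gf_summable[of s] in \<open>auto simp: interior_open\<close>)
  also have "(\<Sum>j. - (lam j * occ s j)) = - mean_sum s"
    unfolding mean_sum_def by (rule suminf_minus[OF mean_summable[OF s]])
  finally show ?thesis unfolding log_gf_def [abs_def] .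
qed

text \<open>The remainder has bounded derivative, so it is Lipschitz and extends to \<open>s = 0\<close>.\<close>
lemma log_gf_asymp:
  obtains H0 C where "\<And>s. s > 0 \<Longrightarrow> \<bar>log_gf s - (pi\<^sup>2 / (6 * s) + (b - 1/2) * ln s + H0)\<bar> \<le> C * s"
proof -
  obtain C where C: "C > 0" "\<And>s. s > 0 \<Longrightarrow> \<bar>mean_sum s - (pi\<^sup>2 / (6 * s\<^sup>2) - (b - 1/2) / s)\<bar> \<le> C"
    by (rule mean_sum_asymp) blast
  define H where "H = (\<lambda>s. log_gf s - pi\<^sup>2 / (6 * s) - (b - 1/2) * ln s)"
  have D: "(H has_real_derivative - (mean_sum s - (pi\<^sup>2 / (6 * s\<^sup>2) - (b - 1/2) / s))) (at s)" if "s > 0" for s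
    unfolding H_def using that
    by (auto intro!: derivative_eq_intros DERIV_log_gf simp: power2_eq_square field_simps)
  have lip: "\<bar>H x - H y\<bar> \<le> C * \<bar>x - y\<bar>" if "0 < x" "x < y" for x y
  proof -
    have "\<exists>z. x < z \<and> z < y \<and> H y - H x = (y - x) * - (mean_sum z - (pi\<^sup>2 / (6 * z\<^sup>2) - (b - 1/2) / z))"
      by (rule MVT2[OF \<open>x < y\<close>]) (use that D in auto)
    then obtain z where z: "x < z" "H y - H x = (y - x) * - (mean_sum z - (pi\<^sup>2 / (6 * z\<^sup>2) - (b - 1/2) / z))" by blast
    then have "\<bar>H y - H x\<bar> = \<bar>y - x\<bar> * \<bar>mean_sum z - (pi\<^sup>2 / (6 * z\<^sup>2) - (b - 1/2) / z)\<bar>"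
      by (simp only: abs_mult abs_minus_cancel)
    also have "\<dots> \<le> \<bar>y - x\<bar> * C" using C(2)[of z] z that by (intro mult_left_mono) auto
    finally show ?thesis by (simp add: abs_minus_commute mult.commute)
  qed
  have lip': "\<bar>H x - H y\<bar> \<le> C * \<bar>x - y\<bar>" if "0 < x" "0 < y" for x y
    using lip[of x y] lip[of y x] that by (cases x y rule: linorder_cases) (auto simp: abs_minus_commute)
  define h where "h = (\<lambda>n. H (1 / real (Suc n)))"
  have inv: "(\<lambda>n. 1 / real (Suc n)) \<longlonglongrightarrow> 0" by real_asymp
  have "Cauchy h"
  proof (rule metric_CauchyI)
    fix e :: real assume e: "e > 0"
    have "Cauchy (\<lambda>n. 1 / real (Suc n))" using inv by (rule LIMSEQ_imp_Cauchy)
    then obtain M where M: "\<And>m n. m \<ge> M \<Longrightarrow> n \<ge> M \<Longrightarrow> dist (1 / real (Suc m)) (1 / real (Suc n)) < e / C"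
      using e C(1) by (meson metric_CauchyD divide_pos_pos)
    have "dist (h m) (h n) < e" if "m \<ge> M" "n \<ge> M" for m n
    proof -
      have "dist (h m) (h n) \<le> C * \<bar>1 / real (Suc m) - 1 / real (Suc n)\<bar>"
        unfolding h_def dist_real_def by (rule lip') auto
      also have "\<dots> < C * (e / C)" using M[OF that] C(1) unfolding dist_real_def by (intro mult_strict_left_mono)
      finally show ?thesis using C(1) by simp
    qed
    then show "\<exists>M. \<forall>m\<ge>M. \<forall>n\<ge>M. dist (h m) (h n) < e" by blast
  qed
  then obtain H0 where H0: "h \<longlonglongrightarrow> H0" using Cauchy_convergent convergent_def by blast
  show ?thesis
  proof
    fix s :: real assume s: "s > 0"
    have "\<bar>H s - H0\<bar> \<le> C * \<bar>s - 0\<bar>"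
    proof (rule tendsto_le[of sequentially])
      show "(\<lambda>n. \<bar>H s - h n\<bar>) \<longlonglongrightarrow> \<bar>H s - H0\<bar>" by (intro tendsto_intros H0)
      show "(\<lambda>n. C * \<bar>s - 1 / real (Suc n)\<bar>) \<longlonglongrightarrow> C * \<bar>s - 0\<bar>" by (intro tendsto_intros inv)
      show "\<forall>\<^sub>F n in sequentially. \<bar>H s - h n\<bar> \<le> C * \<bar>s - 1 / real (Suc n)\<bar>"
        unfolding h_def using s by (intro always_eventually allI lip') auto
    qed auto
    then show "\<bar>log_gf s - (pi\<^sup>2 / (6 * s) + (b - 1/2) * ln s + H0)\<bar> \<le> C * s"
      using s by (simp add: H_def algebra_simps)
  qed
qed

text \<open>The variance term is minus the derivative of \<open>lam j * occ s j\<close> and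
  decreases in \<open>s\<close>, so it lies between the difference quotients on both sides. This
  carries the asymptotics of the mean over to the variance without differentiating a series.\<close>

lemma var_term_le:
  assumes "0 < d" "d < s"
  shows "d * ((lam j)\<^sup>2 * (occ s j + (occ s j)\<^sup>2)) \<le> lam j * occ (s - d) j - lam j * occ s j"
    and "lam j * occ s j - lam j * occ (s + d) j \<le> d * ((lam j)\<^sup>2 * (occ s j + (occ s j)\<^sup>2))"
proof -
  have D: "((\<lambda>s. lam j * occ s j) has_real_derivative - ((lam j)\<^sup>2 * (occ x j + (occ x j)\<^sup>2))) (at x)" if "x > 0" for x
    unfolding occ_def using that lam_pos[of j]
    by (auto intro!: derivative_eq_intros DERIV_bose_occ simp: power2_eq_square algebra_simps)
  have anti: "(lam j)\<^sup>2 * (occ y j + (occ y j)\<^sup>2) \<le> (lam j)\<^sup>2 * (occ x j + (occ x j)\<^sup>2)" if "0 < x" "x \<le> y" for x y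
  proof -
    have "occ y j \<le> occ x j" unfolding occ_def
      using that lam_pos[of j] by (intro bose_occ_antimono mult_right_mono) auto
    then show ?thesis using occ_pos[of y j] that by (intro mult_left_mono add_mono power_mono) auto
  qed
  have "\<exists>z. s - d < z \<and> z < s \<and> lam j * occ s j - lam j * occ (s - d) j = (s - (s - d)) * - ((lam j)\<^sup>2 * (occ z j + (occ z j)\<^sup>2))"
    by (rule MVT2) (use assms D in auto)
  then obtain z where z: "s - d < z" "z < s" "lam j * occ (s - d) j - lam j * occ s j = d * ((lam j)\<^sup>2 * (occ z j + (occ z j)\<^sup>2))"
    by fastforce
  show "d * ((lam j)\<^sup>2 * (occ s j + (occ s j)\<^sup>2)) \<le> lam j * occ (s - d) j - lam j * occ s j"
    unfolding z(3) using z assms by (intro mult_left_mono anti) auto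
  have "\<exists>z. s < z \<and> z < s + d \<and> lam j * occ (s + d) j - lam j * occ s j = (s + d - s) * - ((lam j)\<^sup>2 * (occ z j + (occ z j)\<^sup>2))"
    by (rule MVT2) (use assms D in auto)
  then obtain z where z: "s < z" "z < s + d" "lam j * occ s j - lam j * occ (s + d) j = d * ((lam j)\<^sup>2 * (occ z j + (occ z j)\<^sup>2))"
    by fastforce
  show "lam j * occ s j - lam j * occ (s + d) j \<le> d * ((lam j)\<^sup>2 * (occ s j + (occ s j)\<^sup>2))"
    unfolding z(3) using z assms by (intro mult_left_mono anti) auto
qed

lemma var_summable: "summable (\<lambda>j. (lam j)\<^sup>2 * (occ s j + (occ s j)\<^sup>2))" if s: "s > 0"
proof (rule summable_comparison_test'[of _ 0])
  show "summable (\<lambda>j. (lam j * occ (s / 2) j - lam j * occ s j) / (s / 2))"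
    using s by (intro summable_divide summable_diff mean_summable) auto
  fix j
  have "(s / 2) * ((lam j)\<^sup>2 * (occ s j + (occ s j)\<^sup>2)) \<le> lam j * occ (s - s / 2) j - lam j * occ s j"
    by (rule var_term_le) (use s in auto)
  moreover have "0 \<le> (lam j)\<^sup>2 * (occ s j + (occ s j)\<^sup>2)" using occ_pos[OF s, of j] by simp
  ultimately show "norm ((lam j)\<^sup>2 * (occ s j + (occ s j)\<^sup>2)) \<le> (lam j * occ (s / 2) j - lam j * occ s j) / (s / 2)"
    using s by (simp add: pos_le_divide_eq mult.commute)
qed

lemma var_sum_bounds:
  assumes "0 < d" "d < s"
  shows "d * var_sum s \<le> mean_sum (s - d) - mean_sum s" and "mean_sum s - mean_sum (s + d) \<le> d * var_sum s"
proof -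
  note sm = var_summable[of s] mean_summable[of s] mean_summable[of "s - d"] mean_summable[of "s + d"]
  have "(\<Sum>j. d * ((lam j)\<^sup>2 * (occ s j + (occ s j)\<^sup>2))) \<le> (\<Sum>j. lam j * occ (s - d) j - lam j * occ s j)"
    using var_term_le(1)[OF assms] by (rule suminf_le) (use sm assms in \<open>auto intro!: summable_mult summable_diff\<close>)
  then show "d * var_sum s \<le> mean_sum (s - d) - mean_sum s"
    unfolding var_sum_def mean_sum_def using sm assms by (simp add: suminf_mult suminf_diff)
  have "(\<Sum>j. lam j * occ s j - lam j * occ (s + d) j) \<le> (\<Sum>j. d * ((lam j)\<^sup>2 * (occ s j + (occ s j)\<^sup>2)))"
    using var_term_le(2)[OF assms] by (rule suminf_le) (use sm assms in \<open>auto intro!: summable_mult summable_diff\<close>)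
  then show "mean_sum s - mean_sum (s + d) \<le> d * var_sum s"
    unfolding var_sum_def mean_sum_def using sm assms by (simp add: suminf_mult suminf_diff)
qed

text \<open>Difference quotients of the mean with step \<open>s\<^sup>2\<close>. The bounded error
  of the mean becomes O(\<open>1 / s\<^sup>2\<close>) after division by the step, and the curvature
  term, step times \<open>1 / s ^ 4\<close>, has the same size.\<close>

lemma var_sum_asymp:
  obtains C where "C > 0" "\<And>s. 0 < s \<Longrightarrow> s \<le> 1/2 \<Longrightarrow> \<bar>var_sum s - pi\<^sup>2 / (3 * s ^ 3)\<bar> \<le> C / s\<^sup>2"
proof -
  obtain C where C: "C > 0" "\<And>s. s > 0 \<Longrightarrow> \<bar>mean_sum s - (pi\<^sup>2 / (6 * s\<^sup>2) - (b - 1/2) / s)\<bar> \<le> C"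
    by (rule mean_sum_asymp) blast
  define A where "A = b - 1/2"
  define C' where "C' = 2 * pi\<^sup>2 + 2 * \<bar>A\<bar> + 2 * C"
  show ?thesis
  proof
    show "C' > 0" unfolding C'_def using C(1) by (intro add_nonneg_pos) auto
    fix s :: real assume s: "0 < s" "s \<le> 1/2"
    have d: "0 < s\<^sup>2" "s\<^sup>2 < s" using s by (auto simp: power2_eq_square mult_less_cancel_left2)
    have m: "\<bar>mean_sum s - (pi\<^sup>2 / (6 * s\<^sup>2) - A / s)\<bar> \<le> C" using C(2)[OF s(1)] by (simp add: A_def)
    have mm: "\<bar>mean_sum (s - s\<^sup>2) - (pi\<^sup>2 / (6 * (s - s\<^sup>2)\<^sup>2) - A / (s - s\<^sup>2))\<bar> \<le> C"
      using C(2)[of "s - s\<^sup>2"] d by (simp add: A_def)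
    have mp: "\<bar>mean_sum (s + s\<^sup>2) - (pi\<^sup>2 / (6 * (s + s\<^sup>2)\<^sup>2) - A / (s + s\<^sup>2))\<bar> \<le> C"
      using C(2)[of "s + s\<^sup>2"] d by (simp add: A_def)
    have up: "s\<^sup>2 * var_sum s \<le> (pi\<^sup>2 / (6 * (s - s\<^sup>2)\<^sup>2) - A / (s - s\<^sup>2)) - (pi\<^sup>2 / (6 * s\<^sup>2) - A / s) + 2 * C"
      using var_sum_bounds(1)[OF d] m mm by linarith
    have lo: "(pi\<^sup>2 / (6 * s\<^sup>2) - A / s) - (pi\<^sup>2 / (6 * (s + s\<^sup>2)\<^sup>2) - A / (s + s\<^sup>2)) - 2 * C \<le> s\<^sup>2 * var_sum s"
      using var_sum_bounds(2)[OF d] m mp by linarith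
    have e1: "pi\<^sup>2 / (6 * (s - s\<^sup>2)\<^sup>2) - pi\<^sup>2 / (6 * s\<^sup>2) - pi\<^sup>2 / (3 * s) = (pi\<^sup>2 / 6) * ((3 - 2 * s) / (1 - s)\<^sup>2)"
    proof -
      have "(s - s\<^sup>2)\<^sup>2 = s\<^sup>2 * (1 - s)\<^sup>2" by (simp add: power2_eq_square algebra_simps)
      then show ?thesis using s by (simp add: divide_simps) (simp add: power2_eq_square algebra_simps)
    qed
    have e2: "pi\<^sup>2 / (6 * s\<^sup>2) - pi\<^sup>2 / (6 * (s + s\<^sup>2)\<^sup>2) - pi\<^sup>2 / (3 * s) = - ((pi\<^sup>2 / 6) * ((3 + 2 * s) / (1 + s)\<^sup>2))"
    proof -
      have "(s + s\<^sup>2)\<^sup>2 = s\<^sup>2 * (1 + s)\<^sup>2" by (simp add: power2_eq_square algebra_simps)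
      then show ?thesis using s by (simp add: divide_simps) (simp add: power2_eq_square algebra_simps)
    qed
    have e3: "A / (s - s\<^sup>2) - A / s = A * (1 / (1 - s))" "A / s - A / (s + s\<^sup>2) = A * (1 / (1 + s))"
      using s add_pos_pos[of s "s * s"] by (simp_all add: power2_eq_square divide_simps) (auto simp: algebra_simps)
    have q1: "(3 - 2 * s) / (1 - s)\<^sup>2 \<le> 12"
    proof -
      have "(1/2)\<^sup>2 \<le> (1 - s)\<^sup>2" using s by (intro power_mono) auto
      then have "3 - 2 * s \<le> 12 * (1 - s)\<^sup>2" using s by (simp add: power2_eq_square)
      then show ?thesis using s by (simp add: pos_divide_le_eq)
    qed
    have q2: "(3 + 2 * s) / (1 + s)\<^sup>2 \<le> 12"
    proof -
      have "1 \<le> (1 + s)\<^sup>2" using s by (intro one_le_power) auto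
      then have "3 + 2 * s \<le> 12 * (1 + s)\<^sup>2" using s by linarith
      then show ?thesis using s by (simp add: pos_divide_le_eq)
    qed
    have a1: "\<bar>A * (1 / (1 - s))\<bar> \<le> \<bar>A\<bar> * 2"
    proof -
      have "\<bar>1 / (1 - s)\<bar> \<le> 2" using s by (simp add: divide_simps)
      then show ?thesis unfolding abs_mult by (intro mult_left_mono) auto
    qed
    have a2: "\<bar>A * (1 / (1 + s))\<bar> \<le> \<bar>A\<bar> * 2"
    proof -
      have "\<bar>1 / (1 + s)\<bar> \<le> 2" using s by (simp add: divide_simps)
      then show ?thesis unfolding abs_mult by (intro mult_left_mono) auto
    qed
    have p1: "(pi\<^sup>2 / 6) * ((3 - 2 * s) / (1 - s)\<^sup>2) \<le> (pi\<^sup>2 / 6) * 12" using q1 by (intro mult_left_mono) auto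
    have p2: "(pi\<^sup>2 / 6) * ((3 + 2 * s) / (1 + s)\<^sup>2) \<le> (pi\<^sup>2 / 6) * 12" using q2 by (intro mult_left_mono) auto
    have 1: "s\<^sup>2 * var_sum s - pi\<^sup>2 / (3 * s) \<le> C'"
      using up e1 e3(1) a1 p1 unfolding C'_def by (simp only: abs_le_iff) linarith
    have 2: "- C' \<le> s\<^sup>2 * var_sum s - pi\<^sup>2 / (3 * s)"
      using lo e2 e3(2) a2 p2 unfolding C'_def by (simp only: abs_le_iff) linarith
    have "s\<^sup>2 * \<bar>var_sum s - pi\<^sup>2 / (3 * s ^ 3)\<bar> = \<bar>s\<^sup>2 * (var_sum s - pi\<^sup>2 / (3 * s ^ 3))\<bar>"
      by (simp add: abs_mult)
    also have "s\<^sup>2 * (var_sum s - pi\<^sup>2 / (3 * s ^ 3)) = s\<^sup>2 * var_sum s - pi\<^sup>2 / (3 * s)"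
      using s by (simp add: right_diff_distrib power2_eq_square power3_eq_cube)
    finally have "s\<^sup>2 * \<bar>var_sum s - pi\<^sup>2 / (3 * s ^ 3)\<bar> \<le> C'" using 1 2 by linarith
    then show "\<bar>var_sum s - pi\<^sup>2 / (3 * s ^ 3)\<bar> \<le> C' / s\<^sup>2"
      using s by (simp add: pos_le_divide_eq mult.commute)
  qed
qed

end

section \<open>Gaussian smoothing\<close>

text \<open>Rescaling \<open>z\<close> by \<open>g = h / sqrt (h\<^sup>2 + B)\<close> merges the two
  Gaussians into one standard density, and the integral becomes a characteristic function of the
  normal law. It is the value of the smoothed expectation for a normal variable of variance
  \<open>B\<close>.\<close>

lemma iexp_gauss_integral:
  assumes "B \<ge> 0" "h > 0"
  shows "integrable lborel (\<lambda>z. std_normal_density z *\<^sub>R (iexp (u * z) * complex_of_real (exp (- (B * (z / h)\<^sup>2 / 2)))))" (is ?I)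
    and "(LINT z|lborel. std_normal_density z *\<^sub>R (iexp (u * z) * complex_of_real (exp (- (B * (z / h)\<^sup>2 / 2)))))
      = complex_of_real (h / sqrt (h\<^sup>2 + B) * exp (- ((u * h)\<^sup>2 / (2 * (h\<^sup>2 + B)))))" (is ?E)
proof -
  define g where "g = h / sqrt (h\<^sup>2 + B)"
  have hB: "h\<^sup>2 + B > 0" using assms by (simp add: add_pos_nonneg)
  have g: "g > 0" unfolding g_def using assms hB by simp
  have g2: "g\<^sup>2 = h\<^sup>2 / (h\<^sup>2 + B)" unfolding g_def using hB by (simp add: power_divide)
  let ?f = "\<lambda>z. std_normal_density z *\<^sub>R (iexp (u * z) * complex_of_real (exp (- (B * (z / h)\<^sup>2 / 2))))"
  have f: "?f (0 + g * z) = std_normal_density z *\<^sub>R iexp ((u * g) * z)" for z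
  proof -
    have "- (g * z)\<^sup>2 / 2 + - (B * (g * z / h)\<^sup>2 / 2) = - z\<^sup>2 / 2 * (g\<^sup>2 * (1 + B / h\<^sup>2))"
      by (simp add: power_mult_distrib power_divide algebra_simps)
    also have "g\<^sup>2 * (1 + B / h\<^sup>2) = 1" 
    proof -
      have "1 + B / h\<^sup>2 = (h\<^sup>2 + B) / h\<^sup>2" using assms by (simp add: add_divide_distrib)
      then show ?thesis unfolding g2 using assms hB by simp
    qed
    finally have *: "exp (- (g * z)\<^sup>2 / 2) * exp (- (B * (g * z / h)\<^sup>2 / 2)) = exp (- z\<^sup>2 / 2)"
      by (simp flip: exp_add)
    have "?f (0 + g * z) = complex_of_real (1 / sqrt (2 * pi) * (exp (- (g * z)\<^sup>2 / 2) * exp (- (B * (g * z / h)\<^sup>2 / 2)))) * iexp ((u * g) * z)"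
      by (simp add: std_normal_density_def scaleR_conv_of_real mult_ac)
    also have "\<dots> = std_normal_density z *\<^sub>R iexp ((u * g) * z)"
      unfolding * by (simp add: std_normal_density_def scaleR_conv_of_real)
    finally show ?thesis .
  qed
  have int: "integrable lborel (\<lambda>z. std_normal_density z *\<^sub>R iexp (v * z))" for v
  proof (rule Bochner_Integration.integrable_bound)
    show "integrable lborel std_normal_density" using integrable_normal_density[of 1 0] by simp
  qed (auto simp: norm_mult)
  have "integrable lborel (\<lambda>z. ?f (0 + g * z))" unfolding f by (rule int)
  then show ?I using g by (subst (asm) lborel_integrable_real_affine_iff) auto
  have "(LINT z|lborel. ?f z) = \<bar>g\<bar> *\<^sub>R (LINT z|lborel. ?f (0 + g * z))"
    using g by (intro lborel_integral_real_affine) auto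
  also have "(LINT z|lborel. ?f (0 + g * z)) = char std_normal_distribution (u * g)"
    unfolding f char_def by (subst integral_density) (auto simp: normal_density_nonneg)
  also have "\<dots> = complex_of_real (exp (- (u * g)\<^sup>2 / 2))" by (simp add: char_std_normal_distribution)
  also have "- (u * g)\<^sup>2 / 2 = - ((u * h)\<^sup>2 / (2 * (h\<^sup>2 + B)))" by (simp add: power_mult_distrib g2)
  finally show ?E using g unfolding g_def[symmetric] by (simp add: scaleR_conv_of_real)
qed

text \<open>The Gaussian bump at \<open>(X a - w) / h\<close> is the characteristic function of the
  standard normal law at that point; exchanging the two expectations turns it into one of
  \<open>X\<close>.\<close>

lemma (in prob_space) gaussian_smoothing_fourier:
  assumes X [measurable]: "X \<in> borel_measurable M" and h: "h > 0"
  shows "complex_of_real (expectation (\<lambda>a. exp (- ((X a - w) / h)\<^sup>2 / 2)))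
    = (LINT z|std_normal_distribution. iexp (- w / h * z) * char (distr M borel X) (z / h))"
proof -
  interpret N: prob_space std_normal_distribution by (rule real_distribution.axioms(1)[OF real_dist_normal_dist])
  interpret P: pair_prob_space M std_normal_distribution ..
  let ?f = "\<lambda>a z. iexp ((X a - w) / h * z)"
  have meas: "(\<lambda>(a, z). ?f a z) \<in> borel_measurable (M \<Otimes>\<^sub>M std_normal_distribution)" by measurable
  have int: "integrable (M \<Otimes>\<^sub>M std_normal_distribution) (\<lambda>(a, z). ?f a z)"
    by (rule P.integrable_const_bound[where B = 1]) (use meas in auto)
  have "complex_of_real (expectation (\<lambda>a. exp (- ((X a - w) / h)\<^sup>2 / 2)))
     = (LINT a|M. complex_of_real (exp (- ((X a - w) / h)\<^sup>2 / 2)))" by simp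
  also have "\<dots> = (LINT a|M. LINT z|std_normal_distribution. ?f a z)"
    unfolding char_std_normal_distribution[symmetric, THEN fun_cong] char_def by simp
  also have "\<dots> = (LINT z|std_normal_distribution. LINT a|M. ?f a z)"
    by (rule P.Fubini_integral[OF int, symmetric])
  also have "\<dots> = (LINT z|std_normal_distribution. iexp (- w / h * z) * char (distr M borel X) (z / h))"
  proof (rule Bochner_Integration.integral_cong[OF refl])
    fix z
    have "?f a z = iexp (- w / h * z) * iexp (z / h * X a)" for a
      by (simp add: diff_divide_distrib algebra_simps flip: exp_add)
    then have "(LINT a|M. ?f a z) = iexp (- w / h * z) * (LINT a|M. iexp (z / h * X a))"
      by simp
    also have "(LINT a|M. iexp (z / h * X a)) = char (distr M borel X) (z / h)"
      unfolding char_def by (subst integral_distr) auto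
    finally show "(LINT a|M. ?f a z) = iexp (- w / h * z) * char (distr M borel X) (z / h)" .
  qed
  finally show ?thesis .
qed

text \<open>The second term on the left belongs to a normal law of mean \<open>m\<close> and
  variance \<open>B\<close>. Frequencies \<open>t = z / h\<close> are weighted by the standard
  normal density: a window of length \<open>2 * h * t1\<close> carries the error \<open>e1\<close>,
  the range up to \<open>T0\<close> the error \<open>e2\<close>, and beyond \<open>T0\<close> the
  trivial bound 2 meets a Gaussian tail.\<close>

lemma (in prob_space) gaussian_smoothing_error:
  assumes X [measurable]: "X \<in> borel_measurable M" and h: "h > 0" and B: "B \<ge> 0" and t1: "t1 > 0" and T0: "T0 \<ge> 0"
    and e1: "e1 \<ge> 0" "\<And>t. \<bar>t\<bar> \<le> t1 \<Longrightarrow> norm (char (distr M borel X) t - iexp (m * t) * complex_of_real (exp (- (B * t\<^sup>2 / 2)))) \<le> e1"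
    and e2: "e2 \<ge> 0" "\<And>t. t1 \<le> \<bar>t\<bar> \<Longrightarrow> \<bar>t\<bar> \<le> T0 \<Longrightarrow> norm (char (distr M borel X) t - iexp (m * t) * complex_of_real (exp (- (B * t\<^sup>2 / 2)))) \<le> e2"
  shows "\<bar>expectation (\<lambda>a. exp (- ((X a - w) / h)\<^sup>2 / 2)) - h / sqrt (h\<^sup>2 + B) * exp (- ((w - m)\<^sup>2 / (2 * (h\<^sup>2 + B))))\<bar>
    \<le> e1 * (h * t1) + e2 + 3 * exp (- ((h * T0)\<^sup>2 / 4))"
proof -
  define ch where "ch = char (distr M borel X)"
  define tau where "tau = (\<lambda>t. iexp (m * t) * complex_of_real (exp (- (B * t\<^sup>2 / 2))))"
  interpret D: real_distribution "distr M borel X" by (rule real_distribution_distr) simp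
  have ch1: "norm (ch t) \<le> 1" for t unfolding ch_def by (rule D.cmod_char_le_1)
  have chm [measurable]: "ch \<in> borel_measurable borel" unfolding ch_def by (rule D.char_measurable)
  have tau1: "norm (tau t) \<le> 1" for t unfolding tau_def using B by (simp add: norm_mult)
  have taum [measurable]: "tau \<in> borel_measurable borel" unfolding tau_def by measurable
  have sn: "integrable lborel std_normal_density" "(LINT z|lborel. std_normal_density z) = 1"
    using integrable_normal_density[of 1 0] integral_normal_density[of 1 0] by auto
  have ind: "integrable lborel (indicator {- (h * t1)..h * t1} :: real \<Rightarrow> real)"
    by (rule integrable_real_indicator) (simp_all add: emeasure_lborel_Icc_eq)
  have i1: "integrable lborel (\<lambda>z. std_normal_density z *\<^sub>R (iexp (- w / h * z) * ch (z / h)))"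
    by (rule Bochner_Integration.integrable_bound[OF sn(1)]) (auto simp: norm_mult mult_left_le ch1)
  have eq: "std_normal_density z *\<^sub>R (iexp (- w / h * z) * tau (z / h)) =
       std_normal_density z *\<^sub>R (iexp ((m - w) / h * z) * complex_of_real (exp (- (B * (z / h)\<^sup>2 / 2))))" for z
    unfolding tau_def by (simp add: diff_divide_distrib algebra_simps flip: exp_add)
  have i2: "integrable lborel (\<lambda>z. std_normal_density z *\<^sub>R (iexp (- w / h * z) * tau (z / h)))"
    unfolding eq by (rule iexp_gauss_integral[OF B h])
  have v2: "(LINT z|lborel. std_normal_density z *\<^sub>R (iexp (- w / h * z) * tau (z / h)))
     = complex_of_real (h / sqrt (h\<^sup>2 + B) * exp (- ((w - m)\<^sup>2 / (2 * (h\<^sup>2 + B)))))"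
    unfolding eq iexp_gauss_integral(2)[OF B h] using h by (simp add: power2_commute)
  have v1: "complex_of_real (expectation (\<lambda>a. exp (- ((X a - w) / h)\<^sup>2 / 2))) = 
     (LINT z|lborel. std_normal_density z *\<^sub>R (iexp (- w / h * z) * ch (z / h)))"
    unfolding gaussian_smoothing_fourier[OF X h] ch_def[symmetric]
    by (subst integral_density) (auto simp: normal_density_nonneg)
  let ?F = "\<lambda>z. std_normal_density z *\<^sub>R (iexp (- w / h * z) * ch (z / h)) - std_normal_density z *\<^sub>R (iexp (- w / h * z) * tau (z / h))"
  define x where "x = h * T0"
  \<comment> \<open>In the window the density is at most 1/2. In the tail half of the exponent is
    kept as \<open>exp (- (x\<^sup>2 / 4))\<close>, and the other half is a normal density of
    variance 2; this costs \<open>2 * sqrt 2 \<le> 3\<close>.\<close>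
  let ?G = "\<lambda>z. e1 / 2 * indicator {- (h * t1)..h * t1} z + e2 * std_normal_density z + 3 * exp (- (x\<^sup>2 / 4)) * normal_density 0 (sqrt 2) z"
  have "complex_of_real (expectation (\<lambda>a. exp (- ((X a - w) / h)\<^sup>2 / 2))) - complex_of_real (h / sqrt (h\<^sup>2 + B) * exp (- ((w - m)\<^sup>2 / (2 * (h\<^sup>2 + B)))))
     = (LINT z|lborel. ?F z)"
    unfolding v1 v2[symmetric] by (rule Bochner_Integration.integral_diff[symmetric, OF i1 i2])
  then have "norm (complex_of_real (expectation (\<lambda>a. exp (- ((X a - w) / h)\<^sup>2 / 2)) - h / sqrt (h\<^sup>2 + B) * exp (- ((w - m)\<^sup>2 / (2 * (h\<^sup>2 + B))))))
     = norm (LINT z|lborel. ?F z)"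
    by (simp only: of_real_diff)
  then have "\<bar>expectation (\<lambda>a. exp (- ((X a - w) / h)\<^sup>2 / 2)) - h / sqrt (h\<^sup>2 + B) * exp (- ((w - m)\<^sup>2 / (2 * (h\<^sup>2 + B))))\<bar>
     = norm (LINT z|lborel. ?F z)"
    by (simp only: norm_of_real)
  also have "\<dots> \<le> (LINT z|lborel. norm (?F z))" by (rule integral_norm_bound)
  also have "\<dots> \<le> (LINT z|lborel. ?G z)"
  proof (rule integral_mono)
    show "integrable lborel (\<lambda>z. norm (?F z))" by (intro integrable_norm Bochner_Integration.integrable_diff i1 i2)
    show "integrable lborel ?G"
      by (intro Bochner_Integration.integrable_add integrable_mult_right sn integrable_normal_density ind) auto
    fix z
    have nF: "norm (?F z) = std_normal_density z * norm (ch (z / h) - tau (z / h))"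
    proof -
      have "?F z = std_normal_density z *\<^sub>R (iexp (- w / h * z) * (ch (z / h) - tau (z / h)))"
        by (simp only: right_diff_distrib scaleR_diff_right)
      then show ?thesis by (simp add: norm_mult normal_density_nonneg)
    qed
    have sd: "std_normal_density z \<le> 1 / 2"
    proof -
      have "2 \<le> sqrt (2 * pi)" using pi_gt3 by (intro real_le_rsqrt) auto
      then have "1 / sqrt (2 * pi) \<le> 1 / 2" by (intro divide_left_mono) auto
      moreover have "exp (- z\<^sup>2 / 2) \<le> 1" by simp
      ultimately show ?thesis unfolding std_normal_density_def
        using mult_mono[of "1 / sqrt (2 * pi)" "1/2" "exp (- z\<^sup>2 / 2)" 1] by simp
    qed
    have sd0: "0 \<le> std_normal_density z" by (rule normal_density_nonneg)
    have nd0: "0 \<le> normal_density 0 (sqrt 2) z" by (rule normal_density_nonneg)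
    have n: "0 \<le> e1 / 2 * indicator {- (h * t1)..h * t1} z" "0 \<le> e2 * std_normal_density z"
        "0 \<le> 3 * exp (- (x\<^sup>2 / 4)) * normal_density 0 (sqrt 2) z"
      using e1(1) e2(1) sd0 nd0 by auto
    consider "\<bar>z / h\<bar> \<le> t1" | "t1 \<le> \<bar>z / h\<bar>" "\<bar>z / h\<bar> \<le> T0" | "\<bar>z / h\<bar> > T0" by linarith
    then show "norm (?F z) \<le> ?G z"
    proof cases
      case 1
      then have "z \<in> {- (h * t1)..h * t1}" using h by (auto simp: abs_le_iff field_simps)
      then have ind1: "indicator {- (h * t1)..h * t1} z = (1::real)" by simp
      have "std_normal_density z * norm (ch (z / h) - tau (z / h)) \<le> 1 / 2 * e1"
        using e1(2)[OF 1] sd sd0 unfolding ch_def tau_def by (intro mult_mono) auto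
      then show ?thesis unfolding nF ind1 using n by linarith
    next
      case 2
      have "std_normal_density z * norm (ch (z / h) - tau (z / h)) \<le> std_normal_density z * e2"
        using e2(2)[OF 2] sd0 unfolding ch_def tau_def by (intro mult_left_mono) auto
      then show ?thesis unfolding nF mult.commute[of _ e2] using n by linarith
    next
      case 3
      then have "\<bar>z\<bar> > x" using h by (simp add: x_def abs_divide pos_less_divide_eq mult.commute)
      moreover have "x \<ge> 0" using h T0 by (simp add: x_def)
      ultimately have "x\<^sup>2 \<le> z\<^sup>2" by (intro abs_le_square_iff[THEN iffD1]) auto
      then have "- z\<^sup>2 / 2 \<le> - (x\<^sup>2 / 4) + - (z - 0)\<^sup>2 / (2 * (sqrt 2)\<^sup>2)" by simp
      then have e: "exp (- z\<^sup>2 / 2) \<le> exp (- (x\<^sup>2 / 4)) * exp (- (z - 0)\<^sup>2 / (2 * (sqrt 2)\<^sup>2))"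
        by (subst exp_add[symmetric]) simp
      have n': "norm (ch (z / h) - tau (z / h)) \<le> 2"
        using norm_triangle_ineq4[of "ch (z / h)" "tau (z / h)"] ch1[of "z/h"] tau1[of "z/h"] by linarith
      have "norm (?F z) \<le> std_normal_density z * 2" unfolding nF using n' sd0 by (rule mult_left_mono)
      also have "\<dots> = 2 / sqrt (2 * pi) * exp (- z\<^sup>2 / 2)" by (simp add: std_normal_density_def)
      also have "\<dots> \<le> 2 / sqrt (2 * pi) * (exp (- (x\<^sup>2 / 4)) * exp (- (z - 0)\<^sup>2 / (2 * (sqrt 2)\<^sup>2)))"
        using e by (intro mult_left_mono) auto
      also have "\<dots> = (2 * sqrt 2) * exp (- (x\<^sup>2 / 4)) * normal_density 0 (sqrt 2) z"
        unfolding normal_density_def by (simp add: real_sqrt_mult field_simps)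
      also have "\<dots> \<le> 3 * exp (- (x\<^sup>2 / 4)) * normal_density 0 (sqrt 2) z"
      proof -
        have "sqrt 2 \<le> 3 / 2" by (rule real_le_lsqrt) (auto simp: power2_eq_square)
        then show ?thesis using nd0 by (intro mult_right_mono) auto
      qed
      finally show ?thesis using n by linarith
    qed
  qed
  also have "\<dots> = e1 / 2 * (2 * (h * t1)) + e2 * 1 + 3 * exp (- (x\<^sup>2 / 4)) * 1"
  proof -
    have "(LINT z|lborel. indicator {- (h * t1)..h * t1} z) = 2 * (h * t1)"
      using h t1 by simp
    moreover have "(LINT z|lborel. normal_density 0 (sqrt 2) z) = 1" by (rule integral_normal_density) simp
    moreover note ind
    moreover have "integrable lborel (normal_density 0 (sqrt 2))" by (rule integrable_normal_density) simp
    ultimately show ?thesis using sn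
      by (simp add: Bochner_Integration.integral_add)
  qed
  finally show ?thesis by (simp add: x_def)
qed

lemma char_geometric_pmf:
  assumes p: "0 < p" "p \<le> 1"
  shows "(LINT k|measure_pmf (geometric_pmf p). iexp (\<theta> * real k)) = complex_of_real p / (1 - complex_of_real (1 - p) * cis \<theta>)"
proof -
  have pp: "p \<in> {0<..1}" using p by auto
  let ?z = "complex_of_real (1 - p) * cis \<theta>"
  have nz: "norm ?z < 1" unfolding norm_mult norm_of_real using p by simp
  have eq: "pmf (geometric_pmf p) k *\<^sub>R iexp (\<theta> * real k) = complex_of_real p * ?z ^ k" for k
  proof -
    have "iexp (\<theta> * real k) = cis \<theta> ^ k"
      unfolding cis_conv_exp exp_of_nat_mult[symmetric] by (simp add: mult_ac)
    then show ?thesis using p pmf_geometric[of p k] pp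
      by (simp add: scaleR_conv_of_real power_mult_distrib mult_ac)
  qed
  have sm: "summable (\<lambda>k. norm (complex_of_real p * ?z ^ k))"
    unfolding norm_mult norm_power using nz by (intro summable_mult summable_geometric) (auto simp: norm_mult)
  have "(LINT k|measure_pmf (geometric_pmf p). iexp (\<theta> * real k)) = (LINT k|count_space UNIV. pmf (geometric_pmf p) k *\<^sub>R iexp (\<theta> * real k))"
    unfolding measure_pmf_eq_density by (subst integral_density) auto
  also have "\<dots> = (LINT k|count_space UNIV. complex_of_real p * ?z ^ k)" unfolding eq ..
  also have "\<dots> = (\<Sum>k. complex_of_real p * ?z ^ k)"
    using sm by (intro integral_count_space_nat) (simp add: integrable_count_space_nat_iff)
  also have "\<dots> = complex_of_real p * (1 / (1 - ?z))"
    using nz by (simp add: suminf_mult suminf_geometric summable_geometric)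
  finally show ?thesis by simp
qed

section \<open>Characteristic functions of sums of geometric variables\<close>

text \<open>Characteristic function of a geometric law in terms of its mean \<open>r\<close>. In
  this form the denominator is \<open>1 - w\<close> with \<open>w\<close> small near
  \<open>\<theta> = 0\<close>.\<close>

definition geom_char :: "real \<Rightarrow> real \<Rightarrow> complex" where
  "geom_char r \<theta> = 1 / (1 - complex_of_real r * (cis \<theta> - 1))"

lemma geom_char_denom_norm2: "(norm (1 - complex_of_real r * (cis \<theta> - 1)))\<^sup>2 = 1 + 2 * r * (1 + r) * (1 - cos \<theta>)"
proof -
  have "(norm (1 - complex_of_real r * (cis \<theta> - 1)))\<^sup>2 = (1 - r * (cos \<theta> - 1))\<^sup>2 + (r * sin \<theta>)\<^sup>2"
    by (simp add: cmod_power2)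
  also have "\<dots> = 1 + 2 * r * (1 + r) * (1 - cos \<theta>)"
    unfolding power_mult_distrib sin_squared_eq by (simp add: power2_eq_square algebra_simps)
  finally show ?thesis .
qed

lemma geom_char_denom_ge_1: "1 \<le> norm (1 - complex_of_real r * (cis \<theta> - 1))" if "r \<ge> 0"
proof -
  have "1\<^sup>2 \<le> (norm (1 - complex_of_real r * (cis \<theta> - 1)))\<^sup>2"
    unfolding geom_char_denom_norm2 using that by simp
  then show ?thesis by (rule power2_le_imp_le) simp
qed

lemma geom_char_le_1: "norm (geom_char r \<theta>) \<le> 1" if "r \<ge> 0"
  using geom_char_denom_ge_1[OF that, of \<theta>] by (simp add: geom_char_def norm_divide divide_le_eq_1)

text \<open>Both sides agree to second order in \<open>\<theta>\<close>. The hypotheses keep a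
  factor \<open>a\<close>, later summable over the parts, apart from the common scale
  \<open>x\<close>. The constants 4 and 32 bound \<open>u * exp (- u / 4)\<close> and
  \<open>u\<^sup>2 * exp (- u / 4)\<close> in \<open>char_conf_taylor\<close>.\<close>

lemma geom_char_taylor:
  assumes r: "r \<ge> 0" and R1: "r * \<bar>\<theta>\<bar> \<le> a" and R2: "r * \<theta>\<^sup>2 \<le> 4 * a * x" and R3: "r * \<bar>\<theta>\<bar> ^ 3 \<le> 32 * a * x\<^sup>2"
    and a: "0 \<le> a" "a \<le> x" and x: "x \<le> 1"
  shows "norm (geom_char r \<theta> - iexp (r * \<theta>) * complex_of_real (exp (- ((r + r\<^sup>2) * \<theta>\<^sup>2 / 2)))) \<le> 700 * a * x\<^sup>2"
proof -
  define w where "w = complex_of_real r * (cis \<theta> - 1)"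
  define d where "d = \<i> * complex_of_real (r * \<theta>)"
  define q where "q = (r + r\<^sup>2) * \<theta>\<^sup>2 / 2"
  define z where "z = d - complex_of_real q"
  have x0: "0 \<le> x" using a by simp
  have aa: "a * a \<le> a * x" using a by (intro mult_left_mono)
  have nd: "norm d \<le> a" using R1 r by (simp add: d_def norm_mult abs_mult)
  have "(r * \<bar>\<theta>\<bar>)\<^sup>2 \<le> a\<^sup>2" using R1 r by (intro power_mono) auto
  moreover have "(r * \<bar>\<theta>\<bar>)\<^sup>2 = r\<^sup>2 * \<theta>\<^sup>2" by (simp add: power_mult_distrib)
  ultimately have "r\<^sup>2 * \<theta>\<^sup>2 \<le> a * x" using aa by (simp add: power2_eq_square[of a])
  then have q: "0 \<le> q" "q \<le> 5/2 * a * x" using R2 r by (auto simp: q_def algebra_simps)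
  have ax1: "a * x \<le> x" "a * x \<le> a" using a x x0 by (auto simp: mult_left_le_one_le mult_left_le)
  have q1: "q \<le> 5/2" using q ax1 x by linarith
  have w1: "norm (w - (d - complex_of_real (r * \<theta>\<^sup>2 / 2))) \<le> 16/3 * a * x\<^sup>2"
  proof -
    have "norm (iexp \<theta> - (\<Sum>k\<le>2. (\<i> * complex_of_real \<theta>) ^ k / fact k)) \<le> \<bar>\<theta>\<bar> ^ Suc 2 / fact (Suc 2)"
      by (rule iexp_approx1)
    also have "(\<Sum>k\<le>2. (\<i> * complex_of_real \<theta>) ^ k / fact k) = 1 + \<i> * complex_of_real \<theta> - complex_of_real (\<theta>\<^sup>2 / 2)"
      by (simp add: numeral_2_eq_2 power2_eq_square algebra_simps)
    finally have t: "norm (cis \<theta> - (1 + \<i> * complex_of_real \<theta> - complex_of_real (\<theta>\<^sup>2 / 2))) \<le> \<bar>\<theta>\<bar> ^ 3 / 6"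
      by (simp add: cis_conv_exp fact_numeral eval_nat_numeral)
    have "w - (d - complex_of_real (r * \<theta>\<^sup>2 / 2)) = complex_of_real r * (cis \<theta> - (1 + \<i> * complex_of_real \<theta> - complex_of_real (\<theta>\<^sup>2 / 2)))"
      by (simp add: w_def d_def algebra_simps)
    then have "norm (w - (d - complex_of_real (r * \<theta>\<^sup>2 / 2))) = r * norm (cis \<theta> - (1 + \<i> * complex_of_real \<theta> - complex_of_real (\<theta>\<^sup>2 / 2)))"
      using r by (simp add: norm_mult)
    also have "\<dots> \<le> r * (\<bar>\<theta>\<bar> ^ 3 / 6)" using t r by (rule mult_left_mono)
    also have "\<dots> \<le> 16/3 * a * x\<^sup>2" using R3 by simp
    finally show ?thesis .
  qed
  have nw: "norm w \<le> a"
  proof -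
    have "norm (iexp \<theta> - (\<Sum>k\<le>0. (\<i> * complex_of_real \<theta>) ^ k / fact k)) \<le> \<bar>\<theta>\<bar> ^ Suc 0 / fact (Suc 0)"
      by (rule iexp_approx1)
    then have "norm (cis \<theta> - 1) \<le> \<bar>\<theta>\<bar>" by (simp add: cis_conv_exp)
    then have "r * norm (cis \<theta> - 1) \<le> r * \<bar>\<theta>\<bar>" using r by (rule mult_left_mono)
    then show ?thesis using r R1 by (simp add: w_def norm_mult)
  qed
  have wd: "norm (w - d) \<le> 2 * a * x"
  proof -
    have "norm (iexp \<theta> - (\<Sum>k\<le>1. (\<i> * complex_of_real \<theta>) ^ k / fact k)) \<le> \<bar>\<theta>\<bar> ^ Suc 1 / fact (Suc 1)"
      by (rule iexp_approx1)
    then have "norm (cis \<theta> - (1 + \<i> * complex_of_real \<theta>)) \<le> \<theta>\<^sup>2 / 2"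
      by (simp add: cis_conv_exp power2_eq_square abs_mult_self_eq fact_numeral)
    then have "r * norm (cis \<theta> - (1 + \<i> * complex_of_real \<theta>)) \<le> r * (\<theta>\<^sup>2 / 2)" using r by (rule mult_left_mono)
    moreover have "w - d = complex_of_real r * (cis \<theta> - (1 + \<i> * complex_of_real \<theta>))"
      by (simp add: w_def d_def algebra_simps)
    ultimately show ?thesis using r R2 by (simp add: norm_mult)
  qed
  have w2: "norm (w\<^sup>2 - d\<^sup>2) \<le> 4 * a * x\<^sup>2"
  proof -
    have "norm (w\<^sup>2 - d\<^sup>2) = norm (w - d) * norm (w + d)"
      by (simp add: power2_eq_square algebra_simps flip: norm_mult)
    also have "\<dots> \<le> (2 * a * x) * (2 * x)"
      using wd norm_triangle_ineq[of w d] nw nd a by (intro mult_mono) auto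
    finally show ?thesis by (simp add: power2_eq_square mult_ac)
  qed
  have z2: "norm (z\<^sup>2 - d\<^sup>2) \<le> 45/4 * a * x\<^sup>2"
  proof -
    have "norm (z\<^sup>2 - d\<^sup>2) = norm (z - d) * norm (z + d)"
      by (simp add: power2_eq_square algebra_simps flip: norm_mult)
    also have "\<dots> \<le> (5/2 * a * x) * (9/2 * x)"
    proof (rule mult_mono)
      show "norm (z - d) \<le> 5/2 * a * x" using q by (simp add: z_def norm_minus_commute)
      have "norm (z + d) \<le> 2 * norm d + q" using norm_triangle_ineq4[of "2 * d" "complex_of_real q"] q
        by (simp add: z_def norm_mult)
      then show "norm (z + d) \<le> 9/2 * x" using nd q a ax1 by linarith
    qed (use a x0 in auto)
    finally show ?thesis by (simp add: power2_eq_square mult_ac)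
  qed
  have w3: "norm (geom_char r \<theta> - (1 + w + w\<^sup>2)) \<le> a * x\<^sup>2"
  proof -
    have n: "1 \<le> norm (1 - w)" unfolding w_def by (rule geom_char_denom_ge_1[OF r])
    then have "1 - w \<noteq> 0" by auto
    then have "geom_char r \<theta> - (1 + w + w\<^sup>2) = w ^ 3 / (1 - w)"
      by (simp add: geom_char_def flip: w_def) (simp add: field_simps power2_eq_square power3_eq_cube)
    then have "norm (geom_char r \<theta> - (1 + w + w\<^sup>2)) = norm w ^ 3 / norm (1 - w)" by (simp add: norm_divide norm_power)
    also have "\<dots> \<le> norm w ^ 3 / 1" using n by (intro divide_left_mono) auto
    also have "\<dots> = norm w * (norm w)\<^sup>2" by (simp add: power2_eq_square power3_eq_cube)
    also have "\<dots> \<le> a * x\<^sup>2" using nw a by (intro mult_mono power_mono) auto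
    finally show ?thesis .
  qed
  have nz: "norm z \<le> 7/2 * a" using norm_triangle_ineq4[of d "complex_of_real q"] nd q ax1 by (simp add: z_def)
  have Rez: "Re z = - q" by (simp add: z_def d_def)
  have ez: "norm (exp z - (1 + z + z\<^sup>2 / 2)) \<le> 600 * a * x\<^sup>2"
  proof -
    have "norm (exp z - (\<Sum>k\<le>2. z ^ k / fact k)) \<le> exp \<bar>Re z\<bar> * norm z ^ Suc 2 / fact 2"
      by (rule Taylor_exp)
    also have "(\<Sum>k\<le>2. z ^ k / fact k) = 1 + z + z\<^sup>2 / 2" by (simp add: numeral_2_eq_2)
    also have "exp \<bar>Re z\<bar> * norm z ^ Suc 2 / fact 2 \<le> 27 * (7/2 * a) ^ 3 / fact 2"
    proof (intro divide_right_mono mult_mono)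
      have "exp \<bar>Re z\<bar> \<le> exp (3 * 1)" unfolding Rez using q q1 by simp
      also have "\<dots> = exp 1 ^ 3" using exp_of_nat_mult[of 3 "1::real"] by simp
      also have "\<dots> \<le> 3 ^ 3" using exp_le by (intro power_mono) auto
      finally show "exp \<bar>Re z\<bar> \<le> 27" by simp
      show "norm z ^ Suc 2 \<le> (7/2 * a) ^ 3" using power_mono[OF nz, of 3] by simp
    qed auto
    also have "\<dots> \<le> 600 * (a * (a * a))" using a by (simp add: power3_eq_cube)
    also have "\<dots> \<le> 600 * (a * (x * x))" using a x0 by (intro mult_left_mono mult_mono) auto
    finally show ?thesis by (simp add: power2_eq_square)
  qed
  \<comment> \<open>The variance \<open>r + r\<^sup>2\<close> has two sources: \<open>r\<close>
    comes from expanding \<open>cis\<close>, and \<open>r\<^sup>2\<close> from the square in the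
    geometric series, because \<open>d\<^sup>2 = - (r * \<theta>)\<^sup>2\<close>.\<close>
  have main: "1 + (d - complex_of_real (r * \<theta>\<^sup>2 / 2)) + d\<^sup>2 = 1 + z + d\<^sup>2 / 2"
    by (simp add: z_def d_def q_def power2_eq_square field_simps)
  have eqz: "iexp (r * \<theta>) * complex_of_real (exp (- ((r + r\<^sup>2) * \<theta>\<^sup>2 / 2))) = exp z"
  proof -
    have "z = d + complex_of_real (- q)" by (simp add: z_def)
    then have "exp z = exp d * complex_of_real (exp (- q))" by (simp only: exp_add exp_of_real)
    then show ?thesis by (simp add: d_def q_def)
  qed
  have axx: "0 \<le> a * x\<^sup>2" using a by simp
  let ?G = "geom_char r \<theta>"
  have "?G - exp z = (?G - (1 + w + w\<^sup>2)) + (w - (d - complex_of_real (r * \<theta>\<^sup>2 / 2))) + (w\<^sup>2 - d\<^sup>2)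
     - (z\<^sup>2 - d\<^sup>2) / 2 - (exp z - (1 + z + z\<^sup>2 / 2))"
    using main by (simp add: field_simps)
  also have "norm \<dots> \<le> norm (?G - (1 + w + w\<^sup>2)) + norm (w - (d - complex_of_real (r * \<theta>\<^sup>2 / 2))) + norm (w\<^sup>2 - d\<^sup>2)
     + norm ((z\<^sup>2 - d\<^sup>2) / 2) + norm (exp z - (1 + z + z\<^sup>2 / 2))"
    by (intro order_trans[OF norm_triangle_ineq4] order_trans[OF norm_triangle_ineq] add_mono order_refl)
  also have "norm ((z\<^sup>2 - d\<^sup>2) / 2) = norm (z\<^sup>2 - d\<^sup>2) / 2" by (simp add: norm_divide)
  also have "norm (?G - (1 + w + w\<^sup>2)) + norm (w - (d - complex_of_real (r * \<theta>\<^sup>2 / 2))) + norm (w\<^sup>2 - d\<^sup>2)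
     + norm (z\<^sup>2 - d\<^sup>2) / 2 + norm (exp z - (1 + z + z\<^sup>2 / 2)) \<le> 700 * a * x\<^sup>2"
    using w1 w2 z2 w3 ez axx unfolding mult.assoc by linarith
  finally show ?thesis unfolding eqz .
qed

text \<open>With \<open>1 - cos \<theta> \<ge> \<theta>\<^sup>2 / 3\<close> the squared norm of the
  denominator is at least \<open>1 + c\<^sup>2 / 6\<close>, and for \<open>c \<le> 1\<close> this is
  at least \<open>exp (c\<^sup>2 / 12)\<close>.\<close>

lemma geom_char_upper:
  assumes r: "r \<ge> y" and y: "y \<ge> 0" and \<theta>: "\<bar>\<theta>\<bar> \<le> 1" and c: "0 \<le> c" "c \<le> 1" "c\<^sup>2 \<le> 4 * (y * \<theta>)\<^sup>2"
  shows "norm (geom_char r \<theta>) \<le> exp (- (c\<^sup>2 / 24))"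
proof -
  have "norm (iexp \<theta> - (\<Sum>k\<le>2. (\<i> * complex_of_real \<theta>) ^ k / fact k)) \<le> \<bar>\<theta>\<bar> ^ Suc 2 / fact (Suc 2)"
    by (rule iexp_approx1)
  also have "(\<Sum>k\<le>2. (\<i> * complex_of_real \<theta>) ^ k / fact k) = 1 + \<i> * complex_of_real \<theta> - complex_of_real (\<theta>\<^sup>2 / 2)"
    by (simp add: numeral_2_eq_2 power2_eq_square algebra_simps)
  finally have t: "norm (cis \<theta> - (1 + \<i> * complex_of_real \<theta> - complex_of_real (\<theta>\<^sup>2 / 2))) \<le> \<bar>\<theta>\<bar> ^ 3 / 6"
    by (simp add: cis_conv_exp fact_numeral eval_nat_numeral)
  then have "\<bar>Re (cis \<theta> - (1 + \<i> * complex_of_real \<theta> - complex_of_real (\<theta>\<^sup>2 / 2)))\<bar> \<le> \<bar>\<theta>\<bar> ^ 3 / 6"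
    using abs_Re_le_cmod order_trans by blast
  moreover have "Re (cis \<theta> - (1 + \<i> * complex_of_real \<theta> - complex_of_real (\<theta>\<^sup>2 / 2))) = cos \<theta> - (1 - \<theta>\<^sup>2 / 2)" by simp
  ultimately have "cos \<theta> - (1 - \<theta>\<^sup>2 / 2) \<le> \<bar>\<theta>\<bar> ^ 3 / 6" by linarith
  also have "\<dots> \<le> \<theta>\<^sup>2 / 6" using \<theta> mult_left_le[of "\<bar>\<theta>\<bar>" "\<theta>\<^sup>2"] by (simp add: power2_eq_square power3_eq_cube flip: abs_mult)
  finally have cos: "\<theta>\<^sup>2 / 3 \<le> 1 - cos \<theta>" by simp
  have "y\<^sup>2 * (\<theta>\<^sup>2 / 3) \<le> (r * (1 + r)) * (1 - cos \<theta>)"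
  proof (rule mult_mono)
    show "y\<^sup>2 \<le> r * (1 + r)" unfolding power2_eq_square using r y by (intro mult_mono) auto
  qed (use cos r y in auto)
  then have "c\<^sup>2 / 6 \<le> 2 * r * (1 + r) * (1 - cos \<theta>)" using c(3) by (simp add: power_mult_distrib)
  moreover have "exp (c\<^sup>2 / 12) \<le> 1 + c\<^sup>2 / 12 + (c\<^sup>2 / 12)\<^sup>2"
  proof (rule exp_bound)
    show "c\<^sup>2 / 12 \<le> 1" using power_le_one[OF c(1,2), of 2] by simp
  qed auto
  moreover have "(c\<^sup>2 / 12)\<^sup>2 \<le> c\<^sup>2 / 12"
  proof -
    have "(c\<^sup>2 / 12) * (c\<^sup>2 / 12) \<le> (c\<^sup>2 / 12) * 1"
      using power_le_one[OF c(1,2), of 2] by (intro mult_left_mono) auto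
    then show ?thesis by (simp add: power2_eq_square[of "c\<^sup>2 / 12"])
  qed
  ultimately have "exp (c\<^sup>2 / 12) \<le> (norm (1 - complex_of_real r * (cis \<theta> - 1)))\<^sup>2"
    unfolding geom_char_denom_norm2 by linarith
  then have "(exp (c\<^sup>2 / 24))\<^sup>2 \<le> (norm (1 - complex_of_real r * (cis \<theta> - 1)))\<^sup>2"
    by (simp add: exp_double[symmetric])
  then have "exp (c\<^sup>2 / 24) \<le> norm (1 - complex_of_real r * (cis \<theta> - 1))"
    by (rule power2_le_imp_le) simp
  then have "1 / norm (1 - complex_of_real r * (cis \<theta> - 1)) \<le> 1 / exp (c\<^sup>2 / 24)"
    by (intro frac_le) auto
  then show ?thesis by (simp add: geom_char_def norm_divide exp_minus inverse_eq_divide)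
qed

context almost_arith_seq
begin

text \<open>The product law is taken over finitely many parts, with default multiplicity 0 from
  \<open>J\<close> on. Later \<open>J\<close> is so large that no part of size at most
  \<open>y\<close> is lost.\<close>

definition conf_pmf :: "real \<Rightarrow> nat \<Rightarrow> (nat \<Rightarrow> nat) pmf" where
  "conf_pmf s J = Pi_pmf {..<J} 0 (\<lambda>j. geometric_pmf (1 - exp (- (s * lam j))))"

definition energy :: "nat \<Rightarrow> (nat \<Rightarrow> nat) \<Rightarrow> real" where
  "energy J a = (\<Sum>j<J. lam j * real (a j))"

definition log_gf_upto :: "real \<Rightarrow> nat \<Rightarrow> real" where "log_gf_upto s J = (\<Sum>j<J. - ln (1 - exp (- (s * lam j))))"
definition mean_upto :: "real \<Rightarrow> nat \<Rightarrow> real" where "mean_upto s J = (\<Sum>j<J. lam j * occ s j)"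
definition var_upto :: "real \<Rightarrow> nat \<Rightarrow> real" where "var_upto s J = (\<Sum>j<J. (lam j)\<^sup>2 * (occ s j + (occ s j)\<^sup>2))"

lemma exp_lam_less_1: "s > 0 \<Longrightarrow> exp (- (s * lam j)) < 1"
  using lam_pos[of j] by simp

text \<open>The ratios \<open>exp (- (s * lam j))\<close> are chosen so that the probability depends
  on a configuration only through its energy. Reweighting by \<open>exp (s * energy J a)\<close>
  therefore counts configurations.\<close>

lemma pmf_conf:
  assumes s: "s > 0" and a: "\<And>j. j \<ge> J \<Longrightarrow> a j = 0"
  shows "pmf (conf_pmf s J) a = exp (- (s * energy J a) - log_gf_upto s J)"
proof -
  have "pmf (conf_pmf s J) a = (\<Prod>j<J. pmf (geometric_pmf (1 - exp (- (s * lam j)))) (a j))"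
    unfolding conf_pmf_def using a by (intro pmf_Pi') auto
  also have "\<dots> = (\<Prod>j<J. exp (- (s * (lam j * real (a j))) + ln (1 - exp (- (s * lam j)))))"
  proof (rule prod.cong[OF refl])
    fix j
    have "1 - exp (- (s * lam j)) \<in> {0<..1}" using exp_lam_less_1[OF s, of j] by simp
    then have "pmf (geometric_pmf (1 - exp (- (s * lam j)))) (a j) = exp (- (s * lam j)) ^ a j * (1 - exp (- (s * lam j)))"
      by (subst pmf_geometric) auto
    also have "\<dots> = exp (- (s * (lam j * real (a j))) + ln (1 - exp (- (s * lam j))))"
    proof -
      have "exp (- (s * lam j)) ^ a j = exp (- (s * (lam j * real (a j))))"
        by (simp add: mult_ac flip: exp_of_nat_mult)
      then show ?thesis unfolding exp_add using exp_lam_less_1[OF s, of j] by simp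
    qed
    finally show "pmf (geometric_pmf (1 - exp (- (s * lam j)))) (a j) = exp (- (s * (lam j * real (a j))) + ln (1 - exp (- (s * lam j))))" .
  qed
  also have "\<dots> = exp (\<Sum>j<J. - (s * (lam j * real (a j))) + ln (1 - exp (- (s * lam j))))"
    by (simp add: exp_sum)
  also have "(\<Sum>j<J. - (s * (lam j * real (a j))) + ln (1 - exp (- (s * lam j)))) = - (s * energy J a) - log_gf_upto s J"
    by (simp add: energy_def log_gf_upto_def sum.distrib sum_distrib_left sum_negf sum_subtractf)
  finally show ?thesis .
qed

lemma char_conf:
  assumes s: "s > 0"
  shows "char (distr (measure_pmf (conf_pmf s J)) borel (energy J)) t = (\<Prod>j<J. geom_char (occ s j) (t * lam j))"
proof -
  let ?p = "\<lambda>j. geometric_pmf (1 - exp (- (s * lam j)))"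
  let ?M = "measure_pmf (conf_pmf s J)"
  have "prob_space.indep_vars ?M (\<lambda>_. count_space UNIV) (\<lambda>j a. a j) {..<J}"
    unfolding conf_pmf_def by (rule indep_vars_Pi_pmf) simp
  then have iv: "prob_space.indep_vars ?M (\<lambda>_. borel) (\<lambda>j a. lam j * real (a j)) {..<J}"
    by (rule prob_space.indep_vars_compose2[OF prob_space_measure_pmf]) auto
  have "char (distr ?M borel (\<lambda>a. \<Sum>j<J. lam j * real (a j))) t = (\<Prod>j<J. char (distr ?M borel (\<lambda>a. lam j * real (a j))) t)"
    by (rule prob_space.char_distr_sum[OF prob_space_measure_pmf iv])
  also have "\<dots> = (\<Prod>j<J. geom_char (occ s j) (t * lam j))"
  proof (rule prod.cong[OF refl])
    fix j assume j: "j \<in> {..<J}"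
    define q where "q = exp (- (s * lam j))"
    have q: "0 < q" "q < 1" using exp_lam_less_1[OF s, of j] by (auto simp: q_def)
    have "char (distr ?M borel (\<lambda>a. lam j * real (a j))) t = (LINT a|?M. iexp (t * (lam j * real (a j))))"
      unfolding char_def by (subst integral_distr) auto
    also have "\<dots> = (LINT k|measure_pmf (map_pmf (\<lambda>a. a j) (conf_pmf s J)). iexp (t * (lam j * real k)))"
      by simp
    also have "map_pmf (\<lambda>a. a j) (conf_pmf s J) = geometric_pmf (1 - q)"
      unfolding conf_pmf_def q_def using j by (subst Pi_pmf_component) auto
    also have "(LINT k|measure_pmf (geometric_pmf (1 - q)). iexp (t * (lam j * real k))) =
       complex_of_real (1 - q) / (1 - complex_of_real (1 - (1 - q)) * cis (t * lam j))"
      using char_geometric_pmf[of "1 - q" "t * lam j"] q by (simp add: mult.assoc)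
    also have "\<dots> = geom_char (occ s j) (t * lam j)"
    proof -
      have o: "occ s j = q / (1 - q)" using q
        by (simp add: occ_def bose_occ_def q_def exp_minus divide_simps)
      have c: "complex_of_real (1 - q) \<noteq> 0" using q by (simp del: of_real_diff)
      have "1 - complex_of_real (q / (1 - q)) * (cis (t * lam j) - 1) = (1 - complex_of_real q * cis (t * lam j)) / complex_of_real (1 - q)"
        using c by (simp add: field_simps)
      then show ?thesis by (simp add: geom_char_def o)
    qed
    finally show "char (distr ?M borel (\<lambda>a. lam j * real (a j))) t = geom_char (occ s j) (t * lam j)" .
  qed
  finally show ?thesis by (simp add: energy_def [abs_def])
qed

text \<open>With \<open>x = \<bar>t\<bar> / s\<close>, the \<open>j\<close>-th factor is off by a
  multiple of \<open>x ^ 3 * exp (- (s * lam j / 4))\<close>, and summation over \<open>j\<close>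
  costs a factor \<open>C / s\<close>. The constant does not depend on \<open>J\<close>, which will
  depend on \<open>s\<close>.\<close>

lemma char_conf_taylor:
  obtains C where "C > 0" "\<And>s J t. s > 0 \<Longrightarrow> \<bar>t\<bar> \<le> s \<Longrightarrow>
    norm (char (distr (measure_pmf (conf_pmf s J)) borel (energy J)) t -
      iexp (mean_upto s J * t) * complex_of_real (exp (- (var_upto s J * t\<^sup>2 / 2)))) \<le> C * \<bar>t\<bar> ^ 3 / s ^ 4"
proof -
  obtain C where C: "C > 0" "\<And>s. s > 0 \<Longrightarrow> summable (\<lambda>j. exp (- (s * lam j / 2)))"
    "\<And>s. s > 0 \<Longrightarrow> (\<Sum>j. exp (- (s * lam j / 2))) \<le> C / s" by (rule exp_sum_bound) blast
  show ?thesis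
  proof
    show "1400 * C > 0" using C by simp
    fix s t :: real and J :: nat assume s: "s > 0" and t: "\<bar>t\<bar> \<le> s"
    define x where "x = \<bar>t\<bar> / s"
    have x: "0 \<le> x" "x \<le> 1" using s t by (auto simp: x_def divide_le_eq_1)
    let ?g = "\<lambda>j. iexp (occ s j * (t * lam j)) * complex_of_real (exp (- ((occ s j + (occ s j)\<^sup>2) * (t * lam j)\<^sup>2 / 2)))"
    have each: "norm (geom_char (occ s j) (t * lam j) - ?g j) \<le> 700 * x ^ 3 * exp (- (s / 2 * lam j / 2))" for j
    proof -
      define u where "u = s * lam j"
      have u: "u > 0" using s lam_pos by (simp add: u_def)
      \<comment> \<open>\<open>bose u\<close> is at most \<open>e * e\<close>: one factor
        \<open>e\<close> absorbs \<open>u\<close> and \<open>u\<^sup>2\<close>, the other keeps the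
        sum over \<open>j\<close> bounded.\<close>
      define e where "e = exp (- (u / 4))"
      have e: "e > 0" "e \<le> 1" using u by (auto simp: e_def)
      have ee: "exp (- (u / 2)) = e * e" by (simp add: e_def flip: exp_add)
      have ue: "u * e \<le> 4"
      proof -
        have "u / 4 \<le> exp (u / 4)" using exp_ge_add_one_self[of "u/4"] by linarith
        then have "u / 4 * e \<le> exp (u / 4) * e" using e by (intro mult_right_mono) auto
        then show ?thesis by (simp add: e_def flip: exp_add)
      qed
      have ue2: "u\<^sup>2 * e \<le> 32"
      proof -
        have "1 + u / 4 + (u / 4)\<^sup>2 / 2 \<le> exp (u / 4)" using u by (intro exp_lower_Taylor_quadratic) auto
        moreover have "(u / 4)\<^sup>2 / 2 = u\<^sup>2 / 32" by (simp add: power_divide)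
        ultimately have "u\<^sup>2 / 32 \<le> exp (u / 4)" using u by linarith
        then have "u\<^sup>2 / 32 * e \<le> exp (u / 4) * e" using e by (intro mult_right_mono) auto
        then show ?thesis by (simp add: e_def flip: exp_add)
      qed
      have b: "0 < bose u" "bose u \<le> e * e" using bose_pos[OF u] bose_le_exp[OF u] ee by auto
      have ob: "occ s j * lam j = bose u / s" using mean_term[of s j] s by (simp add: u_def field_simps)
      have R1: "occ s j * \<bar>t * lam j\<bar> = x * bose u"
      proof -
        have "occ s j * \<bar>t * lam j\<bar> = \<bar>t\<bar> * (occ s j * lam j)"
          using lam_pos[of j] by (simp add: abs_mult)
        then show ?thesis by (simp add: ob x_def)
      qed
      have tl: "\<bar>t * lam j\<bar> = x * u" using s lam_pos[of j] by (simp add: x_def u_def abs_mult)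
      have R1': "occ s j * (x * u) = x * bose u" using R1 unfolding tl .
      have "bose u \<le> e" using b e mult_left_le[of e e] by linarith
      have "norm (geom_char (occ s j) (t * lam j) - ?g j) \<le> 700 * (x * e) * x\<^sup>2"
      proof (rule geom_char_taylor)
        show "occ s j \<ge> 0" using occ_pos[OF s, of j] by simp
        show "occ s j * \<bar>t * lam j\<bar> \<le> x * e" unfolding R1 using \<open>bose u \<le> e\<close> x by (intro mult_left_mono)
        have ube: "bose u * u \<le> e * 4"
        proof -
          have "bose u * u \<le> e * e * u" using b u by (intro mult_right_mono) auto
          also have "\<dots> = e * (u * e)" by simp
          also have "\<dots> \<le> e * 4" using ue e by (intro mult_left_mono) auto
          finally show ?thesis .
        qed
        have ube2: "bose u * u\<^sup>2 \<le> e * 32"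
        proof -
          have "bose u * u\<^sup>2 \<le> e * e * u\<^sup>2" using b u by (intro mult_right_mono) auto
          also have "\<dots> = e * (u\<^sup>2 * e)" by simp
          also have "\<dots> \<le> e * 32" using ue2 e by (intro mult_left_mono) auto
          finally show ?thesis .
        qed
        have "occ s j * (t * lam j)\<^sup>2 = (occ s j * \<bar>t * lam j\<bar>) * \<bar>t * lam j\<bar>"
          by (simp add: power2_eq_square flip: abs_mult)
        also have "\<dots> = x * x * (bose u * u)" unfolding tl R1' by simp
        also have "\<dots> \<le> x * x * (e * 4)" using ube x by (intro mult_left_mono) auto
        finally show "occ s j * (t * lam j)\<^sup>2 \<le> 4 * (x * e) * x" by (simp add: mult_ac)
        have "occ s j * \<bar>t * lam j\<bar> ^ 3 = (occ s j * \<bar>t * lam j\<bar>) * (\<bar>t * lam j\<bar>)\<^sup>2"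
          by (simp add: power2_eq_square power3_eq_cube)
        also have "\<dots> = x ^ 3 * (bose u * u\<^sup>2)" unfolding tl R1' by (simp add: power2_eq_square power3_eq_cube)
        also have "\<dots> \<le> x ^ 3 * (e * 32)" using ube2 x by (intro mult_left_mono) auto
        finally show "occ s j * \<bar>t * lam j\<bar> ^ 3 \<le> 32 * (x * e) * x\<^sup>2" by (simp add: power2_eq_square power3_eq_cube mult_ac)
        show "x * e \<le> x" using x e by (simp add: mult_left_le)
      qed (use x e in auto)
      also have "700 * (x * e) * x\<^sup>2 = 700 * x ^ 3 * exp (- (s / 2 * lam j / 2))"
        by (simp add: power2_eq_square power3_eq_cube e_def u_def)
      finally show ?thesis .
    qed
    have gp: "(\<Prod>j<J. ?g j) = iexp (mean_upto s J * t) * complex_of_real (exp (- (var_upto s J * t\<^sup>2 / 2)))"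
    proof -
      have "(\<Prod>j<J. ?g j) = (\<Prod>j<J. iexp (occ s j * (t * lam j))) * complex_of_real (\<Prod>j<J. exp (- ((occ s j + (occ s j)\<^sup>2) * (t * lam j)\<^sup>2 / 2)))"
        by (simp only: prod.distrib of_real_prod)
      also have "(\<Prod>j<J. iexp (occ s j * (t * lam j))) = exp (\<Sum>j<J. \<i> * complex_of_real (occ s j * (t * lam j)))"
        by (simp only: exp_sum[OF finite_lessThan])
      also have "(\<Sum>j<J. \<i> * complex_of_real (occ s j * (t * lam j))) = \<i> * complex_of_real (mean_upto s J * t)"
        by (simp add: mean_upto_def sum_distrib_left sum_distrib_right mult_ac)
      also have "(\<Prod>j<J. exp (- ((occ s j + (occ s j)\<^sup>2) * (t * lam j)\<^sup>2 / 2))) = exp (\<Sum>j<J. - ((occ s j + (occ s j)\<^sup>2) * (t * lam j)\<^sup>2 / 2))"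
        by (simp only: exp_sum[OF finite_lessThan])
      also have "(\<Sum>j<J. - ((occ s j + (occ s j)\<^sup>2) * (t * lam j)\<^sup>2 / 2)) = - (var_upto s J * t\<^sup>2 / 2)"
      proof -
        have "(\<Sum>j<J. - ((occ s j + (occ s j)\<^sup>2) * (t * lam j)\<^sup>2 / 2)) = (\<Sum>j<J. (lam j)\<^sup>2 * (occ s j + (occ s j)\<^sup>2) * (- (t\<^sup>2 / 2)))"
          by (intro sum.cong) (simp_all add: power_mult_distrib)
        also have "\<dots> = var_upto s J * (- (t\<^sup>2 / 2))" unfolding var_upto_def sum_distrib_right ..
        finally show ?thesis by simp
      qed
      finally show ?thesis .
    qed
    have "norm ((\<Prod>j<J. geom_char (occ s j) (t * lam j)) - (\<Prod>j<J. ?g j)) \<le> (\<Sum>j<J. norm (geom_char (occ s j) (t * lam j) - ?g j))"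
    proof (rule norm_prod_diff)
      fix j
      show "norm (geom_char (occ s j) (t * lam j)) \<le> 1" using occ_pos[OF s, of j] by (intro geom_char_le_1) auto
      have "exp (- ((occ s j + (occ s j)\<^sup>2) * (t * lam j)\<^sup>2 / 2)) \<le> 1" using occ_pos[OF s, of j] by simp
      then show "norm (?g j) \<le> 1" by (simp add: norm_mult)
    qed
    also have "\<dots> \<le> (\<Sum>j<J. 700 * x ^ 3 * exp (- (s / 2 * lam j / 2)))" by (rule sum_mono) (rule each)
    also have "\<dots> = 700 * x ^ 3 * (\<Sum>j<J. exp (- (s / 2 * lam j / 2)))" by (simp add: sum_distrib_left)
    also have "\<dots> \<le> 700 * x ^ 3 * (C / (s / 2))"
      using sum_le_suminf[OF C(2)[of "s/2"], of "{..<J}"] C(3)[of "s/2"] s x by (intro mult_left_mono) auto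
    also have "\<dots> = 1400 * C * \<bar>t\<bar> ^ 3 / s ^ 4" by (simp add: x_def power_divide eval_nat_numeral mult_ac)
    finally show "norm (char (distr (measure_pmf (conf_pmf s J)) borel (energy J)) t -
      iexp (mean_upto s J * t) * complex_of_real (exp (- (var_upto s J * t\<^sup>2 / 2)))) \<le> 1400 * C * \<bar>t\<bar> ^ 3 / s ^ 4"
      unfolding char_conf[OF s] gp .
  qed
qed

text \<open>If \<open>lam j \<le> 1 / M\<close>, both \<open>s * lam j\<close> and
  \<open>\<bar>t\<bar> * lam j\<close> are at most 1, so \<open>occ s j\<close> is at least
  \<open>1 / (2 * s * lam j)\<close> and \<open>geom_char_upper\<close> applies with
  \<open>c = min 1 (\<bar>t\<bar> / s)\<close>. The bound \<open>M \<le> \<delta>\<close> ensures at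
  least \<open>1 / (2 * M)\<close> such parts, and \<open>J \<ge> 1 / s\<close> ensures that they
  are not truncated.\<close>

lemma char_conf_upper:
  obtains \<delta> where "\<delta> > 0" "\<And>s J t M. s > 0 \<Longrightarrow> M = max \<bar>t\<bar> s \<Longrightarrow> M \<le> \<delta> \<Longrightarrow> real J \<ge> 1 / s \<Longrightarrow>
    norm (char (distr (measure_pmf (conf_pmf s J)) borel (energy J)) t) \<le> exp (- ((min 1 (\<bar>t\<bar> / s))\<^sup>2 / (48 * M)))"
proof -
  obtain K where K: "K > 0" "\<And>j. \<bar>lam j - real j\<bar> \<le> K" by (rule lam_dev_bound) blast
  show ?thesis
  proof
    show "1 / (2 * K) > 0" using K by simp
    fix s t M :: real and J :: nat
    assume s: "s > 0" and M: "M = max \<bar>t\<bar> s" and Mle: "M \<le> 1 / (2 * K)" and J: "real J \<ge> 1 / s"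
    have M0: "M > 0" "s \<le> M" "\<bar>t\<bar> \<le> M" using M s by auto
    define c where "c = min 1 (\<bar>t\<bar> / s)"
    have c: "0 \<le> c" "c \<le> 1" "c \<le> \<bar>t\<bar> / s" using s by (auto simp: c_def)
    define N where "N = nat \<lceil>1 / M - K\<rceil>"
    have KM: "K \<le> 1 / (2 * M)" using Mle K M0 by (simp add: field_simps)
    have N1: "real N \<ge> 1 / M - K" "N > 0 \<Longrightarrow> real N < 1 / M - K + 1" unfolding N_def by linarith+
    have NJ: "N \<le> J"
    proof (cases "N > 0")
      case True
      have "1 / M \<le> 1 / s" using M0 s by (intro divide_left_mono) auto
      then have "real N < real J + 1" using N1(2)[OF True] J K by linarith
      then show ?thesis by simp
    qed auto
    have lamj: "lam j \<le> 1 / M" if "j < N" for j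
    proof -
      have "real j \<le> real N - 1" using that by simp
      then show ?thesis using K(2)[of j] N1(2) that by linarith
    qed
    have small: "norm (geom_char (occ s j) (t * lam j)) \<le> exp (- (c\<^sup>2 / 24))" if j: "j < N" for j
    proof -
      define u where "u = s * lam j"
      have Mlam: "M * lam j \<le> 1" using lamj[OF j] M0 by (simp add: field_simps)
      have u: "u > 0" using s lam_pos by (simp add: u_def)
      have "u \<le> M * lam j" unfolding u_def using M0 lam_pos[of j] by (intro mult_right_mono) auto
      then have u1: "u \<le> 1" using Mlam by simp
      have "exp u \<le> 1 + u + u\<^sup>2" using u u1 by (intro exp_bound) auto
      moreover have "u\<^sup>2 \<le> u" using u u1 by (simp add: power2_eq_square mult_left_le)
      ultimately have "exp u - 1 \<le> 2 * u" by linarith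
      then have y: "1 / (2 * u) \<le> occ s j" unfolding occ_def bose_occ_def u_def[symmetric] using u by (intro divide_left_mono) auto
      have th: "\<bar>t * lam j\<bar> \<le> 1"
      proof -
        have "\<bar>t\<bar> * lam j \<le> M * lam j" using M0 lam_pos[of j] by (intro mult_right_mono) auto
        moreover have "\<bar>t * lam j\<bar> = \<bar>t\<bar> * lam j" using lam_pos[of j] by (simp add: abs_mult)
        ultimately show ?thesis using Mlam by linarith
      qed
      have "4 * (1 / (2 * u) * (t * lam j))\<^sup>2 = (\<bar>t\<bar> / s)\<^sup>2"
        using s lam_pos[of j] by (simp add: u_def power_mult_distrib power_divide)
      moreover have "c\<^sup>2 \<le> (\<bar>t\<bar> / s)\<^sup>2" using c by (intro power_mono) auto
      ultimately have cc: "c\<^sup>2 \<le> 4 * (1 / (2 * u) * (t * lam j))\<^sup>2" by linarith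
      show ?thesis using geom_char_upper[OF y _ th c(1,2) cc] u by simp
    qed
    have "norm (\<Prod>j<J. geom_char (occ s j) (t * lam j)) = (\<Prod>j<J. norm (geom_char (occ s j) (t * lam j)))"
      by (simp add: prod_norm)
    also have "\<dots> \<le> (\<Prod>j<J. if j < N then exp (- (c\<^sup>2 / 24)) else 1)"
      using occ_pos[OF s] by (intro prod_mono) (auto intro: small geom_char_le_1 simp: less_imp_le)
    also have "\<dots> = (\<Prod>j<N. exp (- (c\<^sup>2 / 24)))"
    proof -
      have "(\<Prod>j<J. if j < N then exp (- (c\<^sup>2 / 24)) else 1) = (\<Prod>j\<in>{..<N}. if j < N then exp (- (c\<^sup>2 / 24)) else 1)"
        using NJ by (intro prod.mono_neutral_right) auto
      then show ?thesis by simp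
    qed
    also have "\<dots> = exp (- (c\<^sup>2 / 24 * real N))" by (simp add: mult.commute flip: exp_of_nat_mult)
    also have "\<dots> \<le> exp (- (c\<^sup>2 / (48 * M)))"
    proof -
      have "c\<^sup>2 / (48 * M) = c\<^sup>2 / 24 * (1 / (2 * M))" by simp
      also have "1 / (2 * M) \<le> real N"
      proof -
        have "1 / M = 1 / (2 * M) + 1 / (2 * M)" by (simp add: field_simps)
        then show ?thesis using N1(1) KM by linarith
      qed
      then have "c\<^sup>2 / 24 * (1 / (2 * M)) \<le> c\<^sup>2 / 24 * real N" by (intro mult_left_mono) auto
      finally show ?thesis by simp
    qed
    finally show "norm (char (distr (measure_pmf (conf_pmf s J)) borel (energy J)) t) \<le> exp (- ((min 1 (\<bar>t\<bar> / s))\<^sup>2 / (48 * M)))"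
      unfolding char_conf[OF s] c_def .
  qed
qed

end

section \<open>Removing the smoothing\<close>

lemma gauss_eq_density:
  "h > 0 \<Longrightarrow> exp (- ((e - w) / h)\<^sup>2 / 2) = h * sqrt (2 * pi) * normal_density e h w"
  by (simp add: normal_density_def real_sqrt_mult power_divide power2_commute)

lemma integrable_Icc_cont:
  fixes f :: "real \<Rightarrow> real"
  assumes "continuous_on UNIV f"
  shows "integrable lborel (\<lambda>w. indicator {\<alpha>..\<beta>} w * f w)"
  using borel_integrable_atLeastAtMost[of \<alpha> \<beta> f] assms
  by (simp add: continuous_on_eq_continuous_at mult.commute)

text \<open>Outside the interval the bump is at most \<open>exp (- (K\<^sup>2 / 4))\<close> times a
  bump that is wider by the factor \<open>sqrt 2\<close>, so subtracting the latter on the whole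
  line gives a minorant with known integral.\<close>

lemma gauss_mass_central:
  assumes h: "h > 0" and K: "K \<ge> 0"
  shows "h * sqrt (2 * pi) * (1 - sqrt 2 * exp (- (K\<^sup>2 / 4))) \<le> 
    (LINT w|lborel. indicator {e - K * h..e + K * h} w * exp (- ((e - w) / h)\<^sup>2 / 2))"
proof -
  let ?c = "h * sqrt (2 * pi)"
  let ?i = "indicator {e - K * h..e + K * h} :: real \<Rightarrow> real"
  have i1: "integrable lborel (\<lambda>w. ?c * normal_density e h w - ?c * (sqrt 2 * exp (- (K\<^sup>2 / 4))) * normal_density e (sqrt 2 * h) w)"
    using h by (intro Bochner_Integration.integrable_diff integrable_mult_right integrable_normal_density) auto
  have i2: "integrable lborel (\<lambda>w. ?i w * exp (- ((e - w) / h)\<^sup>2 / 2))"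
    using h by (intro integrable_Icc_cont continuous_intros) auto
  have "?c * (1 - sqrt 2 * exp (- (K\<^sup>2 / 4))) = (LINT w|lborel. ?c * normal_density e h w - ?c * (sqrt 2 * exp (- (K\<^sup>2 / 4))) * normal_density e (sqrt 2 * h) w)"
    using h by (subst Bochner_Integration.integral_diff) (auto simp: right_diff_distrib intro!: integrable_mult_right integrable_normal_density)
  also have "\<dots> \<le> (LINT w|lborel. ?i w * exp (- ((e - w) / h)\<^sup>2 / 2))"
  proof (rule integral_mono[OF i1 i2])
    fix w
    show "?c * normal_density e h w - ?c * (sqrt 2 * exp (- (K\<^sup>2 / 4))) * normal_density e (sqrt 2 * h) w \<le> ?i w * exp (- ((e - w) / h)\<^sup>2 / 2)"
    proof (cases "w \<in> {e - K * h..e + K * h}")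
      case True
      have "0 \<le> ?c * (sqrt 2 * exp (- (K\<^sup>2 / 4))) * normal_density e (sqrt 2 * h) w"
        using h by (intro mult_nonneg_nonneg normal_density_nonneg) auto
      then show ?thesis using True gauss_eq_density[OF h, of e w] by simp
    next
      case False
      then have "K * h \<le> \<bar>w - e\<bar>" by (auto simp: abs_real_def)
      then have "(K * h)\<^sup>2 \<le> (w - e)\<^sup>2" using K h by (metis abs_le_square_iff abs_mult abs_of_nonneg less_imp_le)
      then have "K\<^sup>2 \<le> (w - e)\<^sup>2 / h\<^sup>2" using h by (simp add: power_mult_distrib pos_le_divide_eq)
      then have "- ((w - e)\<^sup>2) / (2 * h\<^sup>2) \<le> - (K\<^sup>2 / 4) + - ((w - e)\<^sup>2) / (2 * (sqrt 2 * h)\<^sup>2)"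
        by (simp add: power_mult_distrib field_simps)
      then have "exp (- ((w - e)\<^sup>2) / (2 * h\<^sup>2)) \<le> exp (- (K\<^sup>2 / 4)) * exp (- ((w - e)\<^sup>2) / (2 * (sqrt 2 * h)\<^sup>2))"
        by (subst exp_add[symmetric]) simp
      then have "1 / sqrt (2 * pi * h\<^sup>2) * exp (- ((w - e)\<^sup>2) / (2 * h\<^sup>2)) \<le> 1 / sqrt (2 * pi * h\<^sup>2) * (exp (- (K\<^sup>2 / 4)) * exp (- ((w - e)\<^sup>2) / (2 * (sqrt 2 * h)\<^sup>2)))"
        by (intro mult_left_mono) auto
      also have "\<dots> = sqrt 2 * exp (- (K\<^sup>2 / 4)) * normal_density e (sqrt 2 * h) w"
        using h by (simp add: normal_density_def real_sqrt_mult power_mult_distrib) (simp add: field_simps)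
      finally have "normal_density e h w \<le> sqrt 2 * exp (- (K\<^sup>2 / 4)) * normal_density e (sqrt 2 * h) w"
        by (simp add: normal_density_def)
      then have "?c * normal_density e h w \<le> ?c * (sqrt 2 * exp (- (K\<^sup>2 / 4)) * normal_density e (sqrt 2 * h) w)"
        using h by (intro mult_left_mono) auto
      then show ?thesis using False by (simp add: mult.assoc)
    qed
  qed
  finally show ?thesis .
qed

text \<open>Completing the square moves the centre of the Gaussian to
  \<open>e + s * h\<^sup>2\<close>. On the whole line equality would hold; the cut to an interval
  only decreases the integral.\<close>

lemma exp_gauss_mass:
  assumes h: "h > 0"
  shows "(LINT w|lborel. indicator {\<alpha>..\<beta>} w * (exp (- (s * (c - w))) * exp (- ((e - w) / h)\<^sup>2 / 2))) \<le>
    h * sqrt (2 * pi) * exp (- (s * (c - e)) + s\<^sup>2 * h\<^sup>2 / 2)"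
proof -
  let ?X = "h * sqrt (2 * pi) * exp (- (s * (c - e)) + s\<^sup>2 * h\<^sup>2 / 2)"
  have eq: "exp (- (s * (c - w))) * exp (- ((e - w) / h)\<^sup>2 / 2) = ?X * normal_density (e + s * h\<^sup>2) h w" for w
  proof -
    have "- (s * (c - w)) + - ((e - w) / h)\<^sup>2 / 2 = (- (s * (c - e)) + s\<^sup>2 * h\<^sup>2 / 2) + - ((e + s * h\<^sup>2 - w) / h)\<^sup>2 / 2"
      using h by (simp add: field_simps power2_eq_square)
    then have "exp (- (s * (c - w))) * exp (- ((e - w) / h)\<^sup>2 / 2) = exp (- (s * (c - e)) + s\<^sup>2 * h\<^sup>2 / 2) * exp (- ((e + s * h\<^sup>2 - w) / h)\<^sup>2 / 2)"
      by (simp flip: exp_add)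
    then show ?thesis unfolding gauss_eq_density[OF h] by simp
  qed
  have "(LINT w|lborel. indicator {\<alpha>..\<beta>} w * (exp (- (s * (c - w))) * exp (- ((e - w) / h)\<^sup>2 / 2))) \<le> (LINT w|lborel. ?X * normal_density (e + s * h\<^sup>2) h w)"
  proof (rule integral_mono)
    show *: "integrable lborel (\<lambda>w. ?X * normal_density (e + s * h\<^sup>2) h w)"
      using h by (intro integrable_mult_right integrable_normal_density) auto
    show "integrable lborel (\<lambda>w. indicator {\<alpha>..\<beta>} w * (exp (- (s * (c - w))) * exp (- ((e - w) / h)\<^sup>2 / 2)))"
      using h by (intro integrable_Icc_cont continuous_intros) auto
    show "indicator {\<alpha>..\<beta>} w * (exp (- (s * (c - w))) * exp (- ((e - w) / h)\<^sup>2 / 2)) \<le> ?X * normal_density (e + s * h\<^sup>2) h w" for w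
      using h unfolding eq by (auto simp: indicator_def normal_density_nonneg)
  qed
  also have "\<dots> = ?X" using h by simp
  finally show ?thesis .
qed

lemma exp_interval_integral:
  fixes s \<alpha> \<beta> c M :: real
  assumes "s \<noteq> 0" "\<alpha> \<le> \<beta>"
  shows "(LINT w|lborel. indicator {\<alpha>..\<beta>} w * (exp (- (s * (c - w))) * M)) = M * (exp (- (s * (c - \<beta>))) - exp (- (s * (c - \<alpha>)))) / s"
proof -
  have "(LINT w|lborel. (exp (- (s * (c - w))) * M) * indicator {\<alpha>..\<beta>} w) = exp (- (s * (c - \<beta>))) * M / s - exp (- (s * (c - \<alpha>))) * M / s"
    by (rule integral_FTC_Icc_real[OF assms(2)]) (use assms in \<open>auto intro!: derivative_eq_intros continuous_intros\<close>)
  then show ?thesis by (simp add: mult.commute left_diff_distrib right_diff_distrib diff_divide_distrib)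
qed

context almost_arith_seq
begin

text \<open>Stated without \<open>J\<close>, so that its cardinality depends on \<open>y\<close>
  alone; \<open>low_confs_eq\<close> makes the link to \<open>energy J\<close>.\<close>

definition low_confs :: "real \<Rightarrow> (nat \<Rightarrow> nat) set" where
  "low_confs y = {a. finite {j. a j \<noteq> 0} \<and> (\<Sum>j | a j \<noteq> 0. lam j * real (a j)) \<le> y}"

lemma low_confs_eq:
  assumes J: "\<And>j. j \<ge> J \<Longrightarrow> lam j > y"
  shows "low_confs y = {a. (\<forall>j\<ge>J. a j = 0) \<and> energy J a \<le> y}"
proof (rule equalityI; rule subsetI)
  fix a assume a: "a \<in> low_confs y"
  then have fin: "finite {j. a j \<noteq> 0}" and le: "(\<Sum>j | a j \<noteq> 0. lam j * real (a j)) \<le> y" by (auto simp: low_confs_def)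
  have z: "a j = 0" if "j \<ge> J" for j
  proof (rule ccontr)
    assume n: "a j \<noteq> 0"
    have "lam j * 1 \<le> lam j * real (a j)" using lam_pos[of j] n by (intro mult_left_mono) auto
    also have "\<dots> \<le> (\<Sum>j | a j \<noteq> 0. lam j * real (a j))"
      using fin n lam_pos by (intro member_le_sum) (auto simp: less_imp_le)
    finally show False using le J[OF that] by simp
  qed
  have sub: "{j. a j \<noteq> 0} \<subseteq> {..<J}" using z by (metis (mono_tags) lessThan_iff mem_Collect_eq not_le subsetI)
  have "energy J a = (\<Sum>j | a j \<noteq> 0. lam j * real (a j))"
    unfolding energy_def using sub by (intro sum.mono_neutral_right) auto
  then show "a \<in> {a. (\<forall>j\<ge>J. a j = 0) \<and> energy J a \<le> y}" using z le by auto
next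
  fix a assume a: "a \<in> {a. (\<forall>j\<ge>J. a j = 0) \<and> energy J a \<le> y}"
  have sub: "{j. a j \<noteq> 0} \<subseteq> {..<J}" using a by (metis (mono_tags, lifting) lessThan_iff mem_Collect_eq not_le subsetI)
  have "energy J a = (\<Sum>j | a j \<noteq> 0. lam j * real (a j))"
    unfolding energy_def using sub by (intro sum.mono_neutral_right) auto
  then show "a \<in> low_confs y" using a sub by (auto simp: low_confs_def intro: finite_subset)
qed

lemma finite_low_confs: "finite (low_confs y)"
proof -
  obtain K where K: "K > 0" "\<And>j. \<bar>lam j - real j\<bar> \<le> K" by (rule lam_dev_bound) blast
  define J where "J = nat \<lceil>y + K\<rceil> + 1"
  have J: "lam j > y" if "j \<ge> J" for j
  proof -
    have "real J > y + K" unfolding J_def by linarith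
    then show ?thesis using K(2)[of j] that by linarith
  qed
  have "low_confs y \<subseteq> PiE_dflt {..<J} 0 (\<lambda>j. {..nat \<lceil>y / lam j\<rceil>})"
  proof
    fix a assume "a \<in> low_confs y"
    then have a: "\<forall>j\<ge>J. a j = 0" "energy J a \<le> y" using low_confs_eq[of J y] J by auto
    have "a j \<le> nat \<lceil>y / lam j\<rceil>" if "j < J" for j
    proof -
      have "lam j * real (a j) \<le> energy J a" unfolding energy_def
        using that lam_pos by (intro member_le_sum) (auto simp: less_imp_le)
      then have "real (a j) \<le> y / lam j" using a lam_pos[of j] by (simp add: field_simps)
      then show ?thesis by linarith
    qed
    then show "a \<in> PiE_dflt {..<J} 0 (\<lambda>j. {..nat \<lceil>y / lam j\<rceil>})" using a by (auto simp: PiE_dflt_def)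
  qed
  moreover have "finite (PiE_dflt {..<J} 0 (\<lambda>j. {..nat \<lceil>y / lam j\<rceil>}))" by (intro finite_PiE_dflt) auto
  ultimately show ?thesis by (rule finite_subset)
qed

lemma energy_nonneg: "energy J a \<ge> 0"
  unfolding energy_def using lam_pos by (intro sum_nonneg) (simp add: less_imp_le)

text \<open>Configurations in the support vanish from \<open>J\<close> on, so those outside
  \<open>low_confs y\<close> are the ones of energy above \<open>y\<close>.\<close>

lemma expectation_low_split:
  fixes f :: "(nat \<Rightarrow> nat) \<Rightarrow> real"
  assumes J: "\<And>j. j \<ge> J \<Longrightarrow> lam j > y" and f: "\<And>a. 0 \<le> f a" "\<And>a. f a \<le> 1"
  shows "(\<Sum>a\<in>low_confs y. pmf (conf_pmf s J) a * f a) \<le> measure_pmf.expectation (conf_pmf s J) f"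
    and "(\<And>a. energy J a > y \<Longrightarrow> f a \<le> \<epsilon>) \<Longrightarrow> \<epsilon> \<ge> 0 \<Longrightarrow> measure_pmf.expectation (conf_pmf s J) f \<le> (\<Sum>a\<in>low_confs y. pmf (conf_pmf s J) a * f a) + \<epsilon>"
proof -
  have int: "integrable (measure_pmf (conf_pmf s J)) f"
    by (rule measure_pmf.integrable_const_bound[where B = 1]) (use f in auto)
  have int2: "integrable (measure_pmf (conf_pmf s J)) (\<lambda>a. f a * indicator (low_confs y) a)"
    by (rule measure_pmf.integrable_const_bound[where B = 1]) (use f in \<open>auto simp: indicator_def\<close>)
  have eq: "measure_pmf.expectation (conf_pmf s J) (\<lambda>a. f a * indicator (low_confs y) a) = (\<Sum>a\<in>low_confs y. pmf (conf_pmf s J) a * f a)"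
    using finite_low_confs[of y]
    by (subst integral_measure_pmf_real[where A = "low_confs y"]) (auto simp: indicator_def mult.commute intro!: sum.cong split: if_splits)
  show "(\<Sum>a\<in>low_confs y. pmf (conf_pmf s J) a * f a) \<le> measure_pmf.expectation (conf_pmf s J) f"
    unfolding eq[symmetric] using f by (intro integral_mono int int2) (auto simp: indicator_def)
  assume e: "\<And>a. energy J a > y \<Longrightarrow> f a \<le> \<epsilon>" "\<epsilon> \<ge> 0"
  have "measure_pmf.expectation (conf_pmf s J) f \<le> measure_pmf.expectation (conf_pmf s J) (\<lambda>a. f a * indicator (low_confs y) a + \<epsilon>)"
  proof (rule integral_mono_AE)
    show "AE a in measure_pmf (conf_pmf s J). f a \<le> f a * indicator (low_confs y) a + \<epsilon>"
    proof (intro AE_pmfI)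
      fix a assume "a \<in> set_pmf (conf_pmf s J)"
      then have "\<forall>j\<ge>J. a j = 0" unfolding conf_pmf_def using set_Pi_pmf_subset[of "{..<J}" "0::nat"] by fastforce
      then show "f a \<le> f a * indicator (low_confs y) a + \<epsilon>"
        using e low_confs_eq[of J y] J by (cases "energy J a \<le> y") (auto simp: indicator_def)
    qed
  qed (use int int2 in auto)
  also have "\<dots> = (\<Sum>a\<in>low_confs y. pmf (conf_pmf s J) a * f a) + \<epsilon>" using int2 eq by simp
  finally show "measure_pmf.expectation (conf_pmf s J) f \<le> (\<Sum>a\<in>low_confs y. pmf (conf_pmf s J) a * f a) + \<epsilon>" .
qed

text \<open>\<open>R\<close> is the sum of \<open>pmf * exp (- (s * (y - energy)))\<close> over the
  low configurations. It is compared with the integral over \<open>w\<close> of an exponential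
  weight times the smoothed law, which is known through \<open>D\<close>. \<open>K\<close> is the
  cut-off of the Gaussian in units of \<open>h\<close>; \<open>U\<close> is the length of the window
  used for the lower bound, meant to be long against \<open>1 / s\<close> and short against
  \<open>sqrt V\<close>.\<close>

lemma count_sandwich:
  fixes y s h K U V m err \<delta> :: real and J :: nat
  defines "D \<equiv> \<lambda>w. measure_pmf.expectation (conf_pmf s J) (\<lambda>a. exp (- ((energy J a - w) / h)\<^sup>2 / 2))"
    and "R \<equiv> real (card (low_confs y)) * exp (- (s * y) - log_gf_upto s J)"
  assumes s: "s > 0" and h: "h > 0" and K: "K > 0" and U: "U > 0" and y: "y \<ge> 0" and V: "V > 0" and err: "err \<ge> 0"
    and J: "\<And>j. j \<ge> J \<Longrightarrow> lam j > y"
    and D: "\<And>w. \<bar>D w - h / sqrt V * exp (- ((w - m)\<^sup>2 / (2 * V)))\<bar> \<le> err"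
    and \<delta>: "\<And>w. y - K * h - U \<le> w \<Longrightarrow> w \<le> y - K * h \<Longrightarrow> (w - m)\<^sup>2 / (2 * V) \<le> \<delta>"
  shows "R * (s * (h * sqrt (2 * pi)) * (1 - sqrt 2 * exp (- (K\<^sup>2 / 4)))) \<le> (h / sqrt V + err) * exp (2 * (s * (K * h)))"
    and "(1 - exp (- (s * U))) * (h / sqrt V * (1 - \<delta>) - err - exp (- (K\<^sup>2 / 2))) \<le>
       R * (s * (h * sqrt (2 * pi)) * exp (s * (K * h) + s\<^sup>2 * h\<^sup>2 / 2))"
proof -
  let ?p = "\<lambda>a. pmf (conf_pmf s J) a"
  let ?g = "\<lambda>a w. exp (- ((energy J a - w) / h)\<^sup>2 / 2)"
  let ?L = "low_confs y"
  have g: "0 \<le> ?g a w" "?g a w \<le> 1" for a w by auto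
  have cont: "continuous_on UNIV (?g a)" for a using h by (intro continuous_intros) auto
  have Rsum: "(\<Sum>a\<in>?L. ?p a * exp (- (s * (y - energy J a)))) = R"
  proof -
    have "?p a * exp (- (s * (y - energy J a))) = exp (- (s * y) - log_gf_upto s J)" if "a \<in> ?L" for a
    proof -
      have "\<And>j. j \<ge> J \<Longrightarrow> a j = 0" using that low_confs_eq[of J y] J by auto
      from pmf_conf[OF s this] show ?thesis by (simp add: algebra_simps flip: exp_add)
    qed
    then show ?thesis by (simp add: R_def)
  qed
  have Len: "energy J a \<le> y" if "a \<in> ?L" for a using that low_confs_eq[of J y] J by auto
  have Dle: "(\<Sum>a\<in>?L. ?p a * ?g a w) \<le> h / sqrt V + err" for w
  proof -
    have "(\<Sum>a\<in>?L. ?p a * ?g a w) \<le> D w" unfolding D_def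
      by (rule expectation_low_split(1)[OF J g])
    also have "\<dots> \<le> h / sqrt V * exp (- ((w - m)\<^sup>2 / (2 * V))) + err" using D[of w] by linarith
    also have "h / sqrt V * exp (- ((w - m)\<^sup>2 / (2 * V))) \<le> h / sqrt V * 1"
      using h V by (intro mult_left_mono) auto
    finally show ?thesis by simp
  qed
  have exch: "(\<Sum>a\<in>?L. ?p a * (LINT w|lborel. indicator {\<alpha>..\<beta>} w * (exp (- (s * (c - w))) * ?g a w))) =
      (LINT w|lborel. indicator {\<alpha>..\<beta>} w * (exp (- (s * (c - w))) * (\<Sum>a\<in>?L. ?p a * ?g a w)))" for \<alpha> \<beta> c
  proof -
    have "(\<Sum>a\<in>?L. ?p a * (LINT w|lborel. indicator {\<alpha>..\<beta>} w * (exp (- (s * (c - w))) * ?g a w))) =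
       (LINT w|lborel. (\<Sum>a\<in>?L. ?p a * (indicator {\<alpha>..\<beta>} w * (exp (- (s * (c - w))) * ?g a w))))"
      using h by (subst Bochner_Integration.integral_sum) (auto intro!: integrable_mult_right integrable_Icc_cont continuous_intros)
    then show ?thesis by (simp add: sum_distrib_left mult_ac)
  qed
  have intS: "integrable lborel (\<lambda>w. indicator {\<alpha>..\<beta>} w * (exp (- (s * (c - w))) * (\<Sum>a\<in>?L. ?p a * ?g a w)))" for \<alpha> \<beta> c
    using h by (intro integrable_Icc_cont continuous_intros) auto
  have intM: "integrable lborel (\<lambda>w. indicator {\<alpha>..\<beta>} w * (exp (- (s * (c - w))) * M))" for \<alpha> \<beta> c M
    by (intro integrable_Icc_cont continuous_intros)
  let ?T = "1 - sqrt 2 * exp (- (K\<^sup>2 / 4))"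
  \<comment> \<open>Upper bound: the window contains the neighbourhood of radius
    \<open>K * h\<close> of every energy between 0 and \<open>y\<close>, and the weight drops there
    by at most \<open>exp (- (s * (K * h)))\<close>.\<close>
  let ?I = "\<lambda>a. (LINT w|lborel. indicator {- (K * h)..y + K * h} w * (exp (- (s * (y - w))) * ?g a w))"
  have Ilow: "exp (- (s * (y - energy J a))) * (exp (- (s * (K * h))) * (h * sqrt (2 * pi) * ?T)) \<le> ?I a" if a: "a \<in> ?L" for a
  proof -
    let ?e = "energy J a"
    have Kh: "K * h > 0" using K h by simp
    have "exp (- (s * (y - ?e))) * (exp (- (s * (K * h))) * (h * sqrt (2 * pi) * ?T)) \<le>
       exp (- (s * (y - ?e))) * (exp (- (s * (K * h))) * (LINT w|lborel. indicator {?e - K * h..?e + K * h} w * ?g a w))"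
      using gauss_mass_central[OF h, of K ?e] K by (intro mult_left_mono) auto
    also have "\<dots> = (LINT w|lborel. exp (- (s * (y - ?e))) * (exp (- (s * (K * h))) * (indicator {?e - K * h..?e + K * h} w * ?g a w)))"
      by simp
    also have "\<dots> \<le> ?I a"
    proof (rule integral_mono)
      show "integrable lborel (\<lambda>w. exp (- (s * (y - ?e))) * (exp (- (s * (K * h))) * (indicator {?e - K * h..?e + K * h} w * ?g a w)))"
        using h by (intro integrable_mult_right integrable_Icc_cont continuous_intros) auto
      show "integrable lborel (\<lambda>w. indicator {- (K * h)..y + K * h} w * (exp (- (s * (y - w))) * ?g a w))"
        using h by (intro integrable_Icc_cont continuous_intros) auto
      fix w
      show "exp (- (s * (y - ?e))) * (exp (- (s * (K * h))) * (indicator {?e - K * h..?e + K * h} w * ?g a w)) \<le>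
         indicator {- (K * h)..y + K * h} w * (exp (- (s * (y - w))) * ?g a w)"
      proof (cases "w \<in> {?e - K * h..?e + K * h}")
        case True
        then have "w \<in> {- (K * h)..y + K * h}" using energy_nonneg[of J a] Len[OF a] Kh by auto
        moreover have "exp (- (s * (y - ?e))) * exp (- (s * (K * h))) \<le> exp (- (s * (y - w)))"
        proof -
          have "s * (?e - K * h) \<le> s * w" using True s by (intro mult_left_mono) auto
          then show ?thesis by (simp add: algebra_simps flip: exp_add)
        qed
        then have "exp (- (s * (y - ?e))) * exp (- (s * (K * h))) * ?g a w \<le> exp (- (s * (y - w))) * ?g a w"
          by (intro mult_right_mono) auto
        ultimately show ?thesis using True by (simp add: mult.assoc)
      qed (auto simp: indicator_def)
    qed
    finally show ?thesis .
  qed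
  have "R * (exp (- (s * (K * h))) * (h * sqrt (2 * pi) * ?T)) = (\<Sum>a\<in>?L. ?p a * (exp (- (s * (y - energy J a))) * (exp (- (s * (K * h))) * (h * sqrt (2 * pi) * ?T))))"
    unfolding Rsum[symmetric] sum_distrib_right by (simp add: mult_ac)
  also have "\<dots> \<le> (\<Sum>a\<in>?L. ?p a * ?I a)" by (intro sum_mono mult_left_mono Ilow) auto
  also have "\<dots> = (LINT w|lborel. indicator {- (K * h)..y + K * h} w * (exp (- (s * (y - w))) * (\<Sum>a\<in>?L. ?p a * ?g a w)))"
    by (rule exch)
  also have "\<dots> \<le> (LINT w|lborel. indicator {- (K * h)..y + K * h} w * (exp (- (s * (y - w))) * (h / sqrt V + err)))"
    by (intro integral_mono intS intM mult_left_mono Dle) auto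
  also have "\<dots> = (h / sqrt V + err) * (exp (- (s * (y - (y + K * h)))) - exp (- (s * (y - - (K * h))))) / s"
    using s K h y by (intro exp_interval_integral) auto
  also have "\<dots> \<le> (h / sqrt V + err) * exp (s * (K * h)) / s"
    using s h V err by (intro divide_right_mono mult_left_mono add_nonneg_nonneg) auto
  finally have up: "R * (exp (- (s * (K * h))) * (h * sqrt (2 * pi) * ?T)) \<le> (h / sqrt V + err) * exp (s * (K * h)) / s" .
  \<comment> \<open>One factor \<open>exp (s * (K * h))\<close> is the weight at the upper end of
    the window, the other undoes the drop inside a neighbourhood.\<close>
  have "R * (s * (h * sqrt (2 * pi)) * ?T) = (R * (exp (- (s * (K * h))) * (h * sqrt (2 * pi) * ?T))) * (s * exp (s * (K * h)))"
    by (simp add: exp_minus field_simps)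
  also have "\<dots> \<le> ((h / sqrt V + err) * exp (s * (K * h)) / s) * (s * exp (s * (K * h)))"
    using up s by (intro mult_right_mono) auto
  also have "\<dots> = (h / sqrt V + err) * (exp (s * (K * h)) * exp (s * (K * h)))" using s by simp
  also have "exp (s * (K * h)) * exp (s * (K * h)) = exp (2 * (s * (K * h)))" by (simp flip: exp_add)
  finally show "R * (s * (h * sqrt (2 * pi)) * ?T) \<le> (h / sqrt V + err) * exp (2 * (s * (K * h)))" .
  \<comment> \<open>Lower bound: the window ends \<open>K * h\<close> below \<open>y\<close>, so
    that configurations of energy above \<open>y\<close> contribute at most
    \<open>exp (- (K\<^sup>2 / 2))\<close> to the smoothed law there.\<close>
  define c where "c = y - K * h"
  let ?M = "h / sqrt V * (1 - \<delta>) - err - exp (- (K\<^sup>2 / 2))"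
  have low: "?M \<le> (\<Sum>a\<in>?L. ?p a * ?g a w)" if w: "c - U \<le> w" "w \<le> c" for w
  proof -
    have "1 - \<delta> \<le> exp (- ((w - m)\<^sup>2 / (2 * V)))"
      using exp_ge_add_one_self[of "- ((w - m)\<^sup>2 / (2 * V))"] \<delta>[of w] w unfolding c_def by linarith
    then have "h / sqrt V * (1 - \<delta>) \<le> h / sqrt V * exp (- ((w - m)\<^sup>2 / (2 * V)))"
      using h V by (intro mult_left_mono) auto
    also have "\<dots> \<le> D w + err" using D[of w] by linarith
    also have "D w \<le> (\<Sum>a\<in>?L. ?p a * ?g a w) + exp (- (K\<^sup>2 / 2))" unfolding D_def
    proof (rule expectation_low_split(2)[OF J g])
      fix a assume "energy J a > y"
      then have "K * h \<le> energy J a - w" using w by (simp add: c_def)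
      then have "K \<le> (energy J a - w) / h" using h by (simp add: pos_le_divide_eq)
      then have "K\<^sup>2 \<le> ((energy J a - w) / h)\<^sup>2" using K by (intro power_mono) auto
      then show "?g a w \<le> exp (- (K\<^sup>2 / 2))" by simp
    qed auto
    finally show ?thesis by linarith
  qed
  have "?M * (exp (- (s * (c - c))) - exp (- (s * (c - (c - U))))) / s = (LINT w|lborel. indicator {c - U..c} w * (exp (- (s * (c - w))) * ?M))"
    using s U by (intro exp_interval_integral[symmetric]) auto
  also have "\<dots> \<le> (LINT w|lborel. indicator {c - U..c} w * (exp (- (s * (c - w))) * (\<Sum>a\<in>?L. ?p a * ?g a w)))"
  proof (intro integral_mono intS intM)
    fix w
    show "indicator {c - U..c} w * (exp (- (s * (c - w))) * ?M) \<le> indicator {c - U..c} w * (exp (- (s * (c - w))) * (\<Sum>a\<in>?L. ?p a * ?g a w))"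
    proof (cases "w \<in> {c - U..c}")
      case True
      then show ?thesis using low[of w] by (intro mult_left_mono) auto
    next
      case False
      then have "indicator {c - U..c} w = (0::real)" by simp
      then show ?thesis by (simp only: mult_zero_left order_refl)
    qed
  qed
  also have "\<dots> = (\<Sum>a\<in>?L. ?p a * (LINT w|lborel. indicator {c - U..c} w * (exp (- (s * (c - w))) * ?g a w)))"
    by (rule exch[symmetric])
  also have "\<dots> \<le> (\<Sum>a\<in>?L. ?p a * (h * sqrt (2 * pi) * exp (- (s * (c - energy J a)) + s\<^sup>2 * h\<^sup>2 / 2)))"
    by (intro sum_mono mult_left_mono exp_gauss_mass h) auto
  also have "\<dots> = (\<Sum>a\<in>?L. ?p a * exp (- (s * (y - energy J a)))) * (h * sqrt (2 * pi) * exp (s * (K * h) + s\<^sup>2 * h\<^sup>2 / 2))"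
    unfolding sum_distrib_right
  proof (rule sum.cong[OF refl])
    fix a
    have "exp (- (s * (c - energy J a)) + s\<^sup>2 * h\<^sup>2 / 2) = exp (- (s * (y - energy J a))) * exp (s * (K * h) + s\<^sup>2 * h\<^sup>2 / 2)"
      unfolding exp_add[symmetric] by (simp add: c_def algebra_simps)
    then show "?p a * (h * sqrt (2 * pi) * exp (- (s * (c - energy J a)) + s\<^sup>2 * h\<^sup>2 / 2)) = 
      ?p a * exp (- (s * (y - energy J a))) * (h * sqrt (2 * pi) * exp (s * (K * h) + s\<^sup>2 * h\<^sup>2 / 2))" by simp
  qed
  also have "\<dots> = R * (h * sqrt (2 * pi) * exp (s * (K * h) + s\<^sup>2 * h\<^sup>2 / 2))" unfolding Rsum ..
  finally have "?M * (1 - exp (- (s * U))) / s \<le> R * (h * sqrt (2 * pi) * exp (s * (K * h) + s\<^sup>2 * h\<^sup>2 / 2))" by simp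
  then have "?M * (1 - exp (- (s * U))) \<le> R * (h * sqrt (2 * pi) * exp (s * (K * h) + s\<^sup>2 * h\<^sup>2 / 2)) * s"
    using s by (simp only: pos_divide_le_eq)
  then show "(1 - exp (- (s * U))) * ?M \<le> R * (s * (h * sqrt (2 * pi)) * exp (s * (K * h) + s\<^sup>2 * h\<^sup>2 / 2))"
    by (simp only: mult_ac)
qed

end

section \<open>Asymptotics of the number of configurations\<close>

text \<open>The bound of \<open>gaussian_smoothing_error\<close> for
  \<open>h = s powr (-3/4)\<close>, \<open>t1 = s powr (29/20)\<close> and
  \<open>T0 = s powr (7/10)\<close>. The variance has order \<open>1 / s ^ 3\<close>, and
  \<open>t1\<close> is slightly above the scale \<open>s powr (3/2)\<close> on which the normal
  characteristic function decays: \<open>t1\<^sup>2 / s ^ 3 = s powr (-1/10)\<close>. Likewise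
  \<open>h * T0 = s powr (-1/20)\<close>, so all exponentials are negligible.\<close>

definition smoothing_err :: "real \<Rightarrow> real \<Rightarrow> real" where
  "smoothing_err C s = C * (s powr (29/20)) ^ 3 / s ^ 4 * (s powr (-3/4) * s powr (29/20))
     + (exp (- ((s powr (29/20))\<^sup>2 / (48 * s ^ 3))) + exp (- (1 / (48 * s powr (7/10)))) + exp (- ((s powr (29/20))\<^sup>2 / (2 * s ^ 3))))
     + 3 * exp (- ((s powr (-3/4) * s powr (7/10))\<^sup>2 / 4))"

text \<open>The extra factor bounds \<open>sqrt B / h\<close> for the variance \<open>B\<close>, so
  this is the error relative to the main term. Its polynomial part has order
  \<open>s powr (3/10)\<close>.\<close>

lemma smoothing_err_bigo:
  assumes "C > 0"
  shows "(\<lambda>s. smoothing_err C s * (3 * s powr (-3/2)) / s powr (-3/4)) \<in> O[at_right 0](\<lambda>s. s powr (1/5))"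
proof -
  let ?f = "\<lambda>s::real. 3 * s powr (-3/2) / s powr (-3/4)"
  have "(\<lambda>s. C * (s powr (29/20)) ^ 3 / s ^ 4 * (s powr (-3/4) * s powr (29/20)) * ?f s) \<in> O[at_right 0](\<lambda>s. s powr (1/5))"
    using assms by real_asymp
  moreover have "(\<lambda>s. exp (- ((s powr (29/20))\<^sup>2 / (48 * s ^ 3))) * ?f s) \<in> O[at_right 0](\<lambda>s. s powr (1/5))" by real_asymp
  moreover have "(\<lambda>s. exp (- (1 / (48 * s powr (7/10)))) * ?f s) \<in> O[at_right 0](\<lambda>s. s powr (1/5))" by real_asymp
  moreover have "(\<lambda>s. exp (- ((s powr (29/20))\<^sup>2 / (2 * s ^ 3))) * ?f s) \<in> O[at_right 0](\<lambda>s. s powr (1/5))" by real_asymp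
  moreover have "(\<lambda>s. 3 * exp (- ((s powr (-3/4) * s powr (7/10))\<^sup>2 / 4)) * ?f s) \<in> O[at_right 0](\<lambda>s. s powr (1/5))" by real_asymp
  ultimately have "(\<lambda>s. C * (s powr (29/20)) ^ 3 / s ^ 4 * (s powr (-3/4) * s powr (29/20)) * ?f s
     + (exp (- ((s powr (29/20))\<^sup>2 / (48 * s ^ 3))) * ?f s + exp (- (1 / (48 * s powr (7/10)))) * ?f s + exp (- ((s powr (29/20))\<^sup>2 / (2 * s ^ 3))) * ?f s)
     + 3 * exp (- ((s powr (-3/4) * s powr (7/10))\<^sup>2 / 4)) * ?f s) \<in> O[at_right 0](\<lambda>s. s powr (1/5))"
    by (intro sum_in_bigo)
  also have "(\<lambda>s. C * (s powr (29/20)) ^ 3 / s ^ 4 * (s powr (-3/4) * s powr (29/20)) * ?f s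
     + (exp (- ((s powr (29/20))\<^sup>2 / (48 * s ^ 3))) * ?f s + exp (- (1 / (48 * s powr (7/10)))) * ?f s + exp (- ((s powr (29/20))\<^sup>2 / (2 * s ^ 3))) * ?f s)
     + 3 * exp (- ((s powr (-3/4) * s powr (7/10))\<^sup>2 / 4)) * ?f s) = (\<lambda>s. smoothing_err C s * (3 * s powr (-3/2)) / s powr (-3/4))"
    unfolding smoothing_err_def by (simp only: distrib_right times_divide_eq_right add_divide_distrib)
  finally show ?thesis .
qed

lemma bigo_at_right_0D:
  assumes "f \<in> O[at_right 0](\<lambda>s::real. s powr p)"
  obtains c :: real where "c > 0" "\<forall>\<^sub>F s in at_right 0. \<bar>f s\<bar> \<le> c * s powr p"
proof -
  obtain c where "c > 0" "\<forall>\<^sub>F s in at_right 0. norm (f s) \<le> c * norm (s powr p)"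
    using assms by (rule landau_o.bigE)
  then show ?thesis using that by simp
qed

context almost_arith_seq
begin

lemma conf_smoothing:
  obtains C \<delta> where "C > 0" "\<delta> > 0" "\<And>s J w. 0 < s \<Longrightarrow> s < 1 \<Longrightarrow> s powr (7/10) \<le> \<delta> \<Longrightarrow> real J \<ge> 1 / s \<Longrightarrow> var_upto s J * s ^ 3 \<ge> 1 \<Longrightarrow>
    \<bar>measure_pmf.expectation (conf_pmf s J) (\<lambda>a. exp (- ((energy J a - w) / (s powr (-3/4)))\<^sup>2 / 2))
      - s powr (-3/4) / sqrt ((s powr (-3/4))\<^sup>2 + var_upto s J) * exp (- ((w - mean_upto s J)\<^sup>2 / (2 * ((s powr (-3/4))\<^sup>2 + var_upto s J))))\<bar> \<le> smoothing_err C s"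
proof -
  obtain C where C: "C > 0" "\<And>s J t. s > 0 \<Longrightarrow> \<bar>t\<bar> \<le> s \<Longrightarrow>
    norm (char (distr (measure_pmf (conf_pmf s J)) borel (energy J)) t -
      iexp (mean_upto s J * t) * complex_of_real (exp (- (var_upto s J * t\<^sup>2 / 2)))) \<le> C * \<bar>t\<bar> ^ 3 / s ^ 4"
    by (rule char_conf_taylor) blast
  obtain \<delta> where \<delta>: "\<delta> > 0" "\<And>s J t M. s > 0 \<Longrightarrow> M = max \<bar>t\<bar> s \<Longrightarrow> M \<le> \<delta> \<Longrightarrow> real J \<ge> 1 / s \<Longrightarrow>
    norm (char (distr (measure_pmf (conf_pmf s J)) borel (energy J)) t) \<le> exp (- ((min 1 (\<bar>t\<bar> / s))\<^sup>2 / (48 * M)))"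
    by (rule char_conf_upper) blast
  show ?thesis
  proof (rule that[OF C(1) \<delta>(1)])
    fix s w :: real and J :: nat
    assume s: "0 < s" "s < 1" and sd: "s powr (7/10) \<le> \<delta>" and J: "real J \<ge> 1 / s" and B1: "var_upto s J * s ^ 3 \<ge> 1"
    define t1 where "t1 = s powr (29/20)"
    define T0 where "T0 = s powr (7/10)"
    define B where "B = var_upto s J"
    let ?ch = "char (distr (measure_pmf (conf_pmf s J)) borel (energy J))"
    let ?ta = "\<lambda>t. iexp (mean_upto s J * t) * complex_of_real (exp (- (B * t\<^sup>2 / 2)))"
    have t1: "0 < t1" "t1 \<le> s" using s powr_mono'[of 1 "29/20" s] by (auto simp: t1_def)
    have T0: "0 < T0" "s \<le> T0" using s powr_mono'[of "7/10" 1 s] by (auto simp: T0_def)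
    have Bge: "1 / s ^ 3 \<le> B" using B1 s by (simp add: B_def field_simps)
    have B0: "B \<ge> 0" using Bge s by (meson order_trans zero_le_divide_1_iff zero_le_power less_imp_le)
    have e1: "norm (?ch t - ?ta t) \<le> C * t1 ^ 3 / s ^ 4" if "\<bar>t\<bar> \<le> t1" for t
    proof -
      have "norm (?ch t - ?ta t) \<le> C * \<bar>t\<bar> ^ 3 / s ^ 4" unfolding B_def using that t1 s by (intro C(2)) auto
      also have "\<dots> \<le> C * t1 ^ 3 / s ^ 4" using that C(1) s by (intro divide_right_mono mult_left_mono power_mono) auto
      finally show ?thesis .
    qed
    let ?e2 = "exp (- (t1\<^sup>2 / (48 * s ^ 3))) + exp (- (1 / (48 * T0))) + exp (- (t1\<^sup>2 / (2 * s ^ 3)))"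
    have e2: "norm (?ch t - ?ta t) \<le> ?e2" if t: "t1 \<le> \<bar>t\<bar>" "\<bar>t\<bar> \<le> T0" for t
    proof -
      have Md: "max \<bar>t\<bar> s \<le> \<delta>" using t T0 sd unfolding T0_def by auto
      have "norm (?ch t) \<le> exp (- ((min 1 (\<bar>t\<bar> / s))\<^sup>2 / (48 * max \<bar>t\<bar> s)))"
        by (rule \<delta>(2)[OF s(1) refl Md J])
      also have "\<dots> \<le> exp (- (t1\<^sup>2 / (48 * s ^ 3))) + exp (- (1 / (48 * T0)))"
      \<comment> \<open>Up to \<open>s\<close> the exponent is
        \<open>t\<^sup>2 / (48 * s ^ 3)\<close>, smallest at \<open>t1\<close>; beyond
        \<open>s\<close> it is \<open>1 / (48 * \<bar>t\<bar>)\<close>, smallest at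
        \<open>T0\<close>. Adding both exponentials gives one bound for the two ranges.\<close>
      proof (cases "\<bar>t\<bar> \<le> s")
        case True
        then have m: "min 1 (\<bar>t\<bar> / s) = \<bar>t\<bar> / s" "max \<bar>t\<bar> s = s" using s by (auto simp: min_def max_def divide_le_eq_1)
        have "t1\<^sup>2 \<le> \<bar>t\<bar>\<^sup>2" using t t1 by (intro power_mono) auto
        then have "t1\<^sup>2 / (48 * s ^ 3) \<le> \<bar>t\<bar>\<^sup>2 / (48 * s ^ 3)" using s by (intro divide_right_mono) auto
        also have "\<dots> = (\<bar>t\<bar> / s)\<^sup>2 / (48 * s)" using s by (simp add: power_divide power2_eq_square power3_eq_cube)
        finally have "exp (- ((\<bar>t\<bar> / s)\<^sup>2 / (48 * s))) \<le> exp (- (t1\<^sup>2 / (48 * s ^ 3)))" by simp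
        then show ?thesis unfolding m using exp_gt_zero[of "- (1 / (48 * T0))"] by linarith
      next
        case False
        then have m: "min 1 (\<bar>t\<bar> / s) = 1" "max \<bar>t\<bar> s = \<bar>t\<bar>" using s by (auto simp: min_def max_def divide_le_eq_1)
        have "1 / (48 * T0) \<le> 1 / (48 * \<bar>t\<bar>)" using t t1 by (intro divide_left_mono) auto
        then have "exp (- (1\<^sup>2 / (48 * \<bar>t\<bar>))) \<le> exp (- (1 / (48 * T0)))" by simp
        then show ?thesis unfolding m using exp_gt_zero[of "- (t1\<^sup>2 / (48 * s ^ 3))"] by linarith
      qed
      finally have c1: "norm (?ch t) \<le> exp (- (t1\<^sup>2 / (48 * s ^ 3))) + exp (- (1 / (48 * T0)))" .
      have "t1\<^sup>2 / (2 * s ^ 3) = 1 / s ^ 3 * t1\<^sup>2 / 2" by simp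
      also have "\<dots> \<le> B * \<bar>t\<bar>\<^sup>2 / 2" using Bge t t1 B0 by (intro divide_right_mono mult_mono power_mono) auto
      finally have "norm (?ta t) \<le> exp (- (t1\<^sup>2 / (2 * s ^ 3)))" by (simp add: norm_mult)
      then show ?thesis using c1 norm_triangle_ineq4[of "?ch t" "?ta t"] by linarith
    qed
    have "\<bar>measure_pmf.expectation (conf_pmf s J) (\<lambda>a. exp (- ((energy J a - w) / (s powr (-3/4)))\<^sup>2 / 2))
      - s powr (-3/4) / sqrt ((s powr (-3/4))\<^sup>2 + B) * exp (- ((w - mean_upto s J)\<^sup>2 / (2 * ((s powr (-3/4))\<^sup>2 + B))))\<bar>
     \<le> C * t1 ^ 3 / s ^ 4 * (s powr (-3/4) * t1) + ?e2 + 3 * exp (- ((s powr (-3/4) * T0)\<^sup>2 / 4))"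
    proof (rule measure_pmf.gaussian_smoothing_error)
      show "0 \<le> C * t1 ^ 3 / s ^ 4" using C(1) s t1 by simp
      show "0 \<le> ?e2" by (intro add_nonneg_nonneg) auto
    qed (use s t1 T0 B0 e1 e2 in auto)
    then show "\<bar>measure_pmf.expectation (conf_pmf s J) (\<lambda>a. exp (- ((energy J a - w) / (s powr (-3/4)))\<^sup>2 / 2))
      - s powr (-3/4) / sqrt ((s powr (-3/4))\<^sup>2 + var_upto s J) * exp (- ((w - mean_upto s J)\<^sup>2 / (2 * ((s powr (-3/4))\<^sup>2 + var_upto s J))))\<bar> \<le> smoothing_err C s"
      unfolding smoothing_err_def B_def t1_def T0_def .
  qed
qed

text \<open>The limit in \<open>J\<close> is taken for fixed \<open>s\<close>, before
  \<open>s\<close> tends to 0; all estimates in \<open>s\<close> are uniform in \<open>J\<close>, so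
  no explicit \<open>J\<close> is called for.\<close>

lemma truncation:
  assumes s: "s > 0" and e: "e > 0"
  obtains J where "\<And>j. j \<ge> J \<Longrightarrow> lam j > y" "real J \<ge> 1 / s" "\<bar>mean_upto s J - mean_sum s\<bar> \<le> e"
    "\<bar>var_upto s J - var_sum s\<bar> \<le> e" "\<bar>log_gf_upto s J - log_gf s\<bar> \<le> e"
proof -
  obtain K where K: "K > 0" "\<And>j. \<bar>lam j - real j\<bar> \<le> K" by (rule lam_dev_bound) blast
  have near: "\<forall>\<^sub>F n in sequentially. \<bar>X n - x\<bar> \<le> e" if "X \<longlonglongrightarrow> x" for X :: "nat \<Rightarrow> real" and x
    using tendstoD[OF that e] by eventually_elim (simp add: dist_real_def)
  have 1: "\<forall>\<^sub>F n in sequentially. \<bar>mean_upto s n - mean_sum s\<bar> \<le> e"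
    unfolding mean_upto_def mean_sum_def by (intro near summable_LIMSEQ mean_summable s)
  have 2: "\<forall>\<^sub>F n in sequentially. \<bar>var_upto s n - var_sum s\<bar> \<le> e"
    unfolding var_upto_def var_sum_def by (intro near summable_LIMSEQ var_summable s)
  have 3: "\<forall>\<^sub>F n in sequentially. \<bar>log_gf_upto s n - log_gf s\<bar> \<le> e"
    unfolding log_gf_upto_def log_gf_def by (intro near summable_LIMSEQ log_gf_summable s)
  have 4: "\<forall>\<^sub>F n in sequentially. real n \<ge> 1 / s \<and> real n \<ge> y + K + 1"
    by (intro eventually_conj) real_asymp+
  have "\<forall>\<^sub>F n in sequentially. \<bar>mean_upto s n - mean_sum s\<bar> \<le> e \<and> \<bar>var_upto s n - var_sum s\<bar> \<le> e \<and> \<bar>log_gf_upto s n - log_gf s\<bar> \<le> e \<and> real n \<ge> 1 / s \<and> real n \<ge> y + K + 1"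
    using 1 2 3 4 by eventually_elim auto
  then obtain J where J: "\<bar>mean_upto s J - mean_sum s\<bar> \<le> e" "\<bar>var_upto s J - var_sum s\<bar> \<le> e" "\<bar>log_gf_upto s J - log_gf s\<bar> \<le> e" "real J \<ge> 1 / s" "real J \<ge> y + K + 1"
    by (auto simp: eventually_sequentially)
  have "lam j > y" if "j \<ge> J" for j using K(2)[of j] J(5) that by linarith
  then show ?thesis using that J by blast
qed

text \<open>Here \<open>y = pi\<^sup>2 / (6 * s\<^sup>2)\<close>. Both \<open>s * y\<close> and the
  main term of \<open>log_gf s\<close> are \<open>pi\<^sup>2 / (6 * s)\<close>, together the
  exponent \<open>pi\<^sup>2 / (3 * s)\<close>. The remaining factor
  \<open>s powr (b - 1/2)\<close>, divided by \<open>s * sqrt (2 * pi * B)\<close> with a variance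
  \<open>B\<close> close to \<open>pi\<^sup>2 / (3 * s ^ 3)\<close>, leaves a multiple of
  \<open>s powr b\<close>.\<close>

lemma count_asymp:
  obtains \<kappa> c where "\<kappa> > 0" "\<forall>\<^sub>F s in at_right 0.
     \<bar>real (card (low_confs (pi\<^sup>2 / (6 * s\<^sup>2)))) * exp (- (pi\<^sup>2 / (3 * s))) * s powr (- b) / \<kappa> - 1\<bar> \<le> c * s powr (1/5)"
proof -
  obtain Ce \<delta>0 where E: "Ce > 0" "\<delta>0 > 0" "\<And>s J w. 0 < s \<Longrightarrow> s < 1 \<Longrightarrow> s powr (7/10) \<le> \<delta>0 \<Longrightarrow> real J \<ge> 1 / s \<Longrightarrow> var_upto s J * s ^ 3 \<ge> 1 \<Longrightarrow>
    \<bar>measure_pmf.expectation (conf_pmf s J) (\<lambda>a. exp (- ((energy J a - w) / (s powr (-3/4)))\<^sup>2 / 2))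
      - s powr (-3/4) / sqrt ((s powr (-3/4))\<^sup>2 + var_upto s J) * exp (- ((w - mean_upto s J)\<^sup>2 / (2 * ((s powr (-3/4))\<^sup>2 + var_upto s J))))\<bar> \<le> smoothing_err Ce s"
    by (rule conf_smoothing) blast
  obtain Cm0 where M: "Cm0 > 0" "\<And>s. s > 0 \<Longrightarrow> \<bar>mean_sum s - (pi\<^sup>2 / (6 * s\<^sup>2) - (b - 1/2) / s)\<bar> \<le> Cm0"
    by (rule mean_sum_asymp) blast
  obtain Cv where Va: "Cv > 0" "\<And>s. 0 < s \<Longrightarrow> s \<le> 1/2 \<Longrightarrow> \<bar>var_sum s - pi\<^sup>2 / (3 * s ^ 3)\<bar> \<le> Cv / s\<^sup>2"
    by (rule var_sum_asymp) blast
  obtain H0 Cl where L: "\<And>s. s > 0 \<Longrightarrow> \<bar>log_gf s - (pi\<^sup>2 / (6 * s) + (b - 1/2) * ln s + H0)\<bar> \<le> Cl * s"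
    by (rule log_gf_asymp) blast
  define Cm where "Cm = Cm0 + \<bar>b - 1/2\<bar> + 1"
  define C2 where "C2 = \<bar>Cl\<bar> + 1"
  define C3 where "C3 = Cv + 1"
  have pos: "Cm > 0" "C2 > 0" "C3 > 0" using M(1) Va(1) by (auto simp: Cm_def C2_def C3_def)
  \<comment> \<open>The lengths are \<open>K * h\<close>, \<open>U\<close> and the offset
    \<open>Cm / s\<close> of the mean from \<open>y\<close>. The largest is
    \<open>U = s powr (-21/20)\<close>; its square against a variance of at least
    \<open>1 / s ^ 3\<close> has order \<open>s powr (9/10)\<close>.\<close>
  define \<delta> where "\<delta> = (\<lambda>s::real. (s powr (-1/20) * s powr (-3/4) + s powr (-21/20) + Cm / s + 1)\<^sup>2 * s ^ 3 / 2)"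
  define \<eta> where "\<eta> = (\<lambda>s. smoothing_err Ce s * (3 * s powr (-3/2)) / s powr (-3/4))"
  obtain c1 where c1: "c1 > 0" "\<forall>\<^sub>F s in at_right 0. \<bar>\<eta> s\<bar> \<le> c1 * s powr (1/5)"
    using smoothing_err_bigo[OF E(1)] unfolding \<eta>_def by (rule bigo_at_right_0D)
  have "\<delta> \<in> O[at_right 0](\<lambda>s. s powr (1/5))" unfolding \<delta>_def using pos(1) by real_asymp
  then obtain c2 where c2: "c2 > 0" "\<forall>\<^sub>F s in at_right 0. \<bar>\<delta> s\<bar> \<le> c2 * s powr (1/5)"
    by (rule bigo_at_right_0D)
  define Tt where "Tt = (\<lambda>s::real. 1 - sqrt 2 * exp (- ((s powr (-1/20))\<^sup>2 / 4)))"
  \<comment> \<open>\<open>UP\<close> and \<open>LO\<close> are the two bounds of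
    \<open>count_sandwich\<close> for \<open>R * s * sqrt (2 * pi * B)\<close>. The error functions
    are already replaced by multiples of \<open>s powr (1/5)\<close>, so only explicit functions of
    \<open>s\<close> remain.\<close>
  define UP where "UP = (\<lambda>s::real. (1 + c1 * s powr (1/5)) * exp (2 * (s * (s powr (-1/20) * s powr (-3/4)))) / Tt s)"
  define LO where "LO = (\<lambda>s::real. (1 - exp (- (s * s powr (-21/20)))) * ((1 - c2 * s powr (1/5)) / sqrt (1 + (s powr (-3/4))\<^sup>2 * s ^ 3) - (c1 * s powr (1/5) + exp (- ((s powr (-1/20))\<^sup>2 / 2)) * (3 * s powr (-3/2)) / s powr (-3/4)))
   * exp (- (s * (s powr (-1/20) * s powr (-3/4)) + s\<^sup>2 * (s powr (-3/4))\<^sup>2 / 2)))"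
  have "(\<lambda>s. UP s - 1) \<in> O[at_right 0](\<lambda>s. s powr (1/5))" unfolding UP_def Tt_def using c1(1) by real_asymp
  then obtain d1 where d1: "d1 > 0" "\<forall>\<^sub>F s in at_right 0. \<bar>UP s - 1\<bar> \<le> d1 * s powr (1/5)"
    by (rule bigo_at_right_0D)
  have "(\<lambda>s. LO s - 1) \<in> O[at_right 0](\<lambda>s. s powr (1/5))" unfolding LO_def using c1(1) c2(1) by real_asymp
  then obtain d2 where d2: "d2 > 0" "\<forall>\<^sub>F s in at_right 0. \<bar>LO s - 1\<bar> \<le> d2 * s powr (1/5)"
    by (rule bigo_at_right_0D)
  define d where "d = max d1 d2"
  have d: "d > 0" using d1(1) by (simp add: d_def less_max_iff_disj)
  \<comment> \<open>A second layer: \<open>C2 * s\<close> covers the passage from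
    \<open>log_gf_upto\<close> to its expansion, and \<open>C3 * s\<close> that from the variance to
    its leading term.\<close>
  define UP2 where "UP2 = (\<lambda>s::real. (1 + d * s powr (1/5)) * exp (C2 * s) / sqrt (1 - C3 * s))"
  define LO2 where "LO2 = (\<lambda>s::real. (1 - d * s powr (1/5)) * exp (- C2 * s) / sqrt (1 + C3 * s))"
  have "(\<lambda>s. UP2 s - 1) \<in> O[at_right 0](\<lambda>s. s powr (1/5))" unfolding UP2_def using pos d by real_asymp
  then obtain f1 where f1: "f1 > 0" "\<forall>\<^sub>F s in at_right 0. \<bar>UP2 s - 1\<bar> \<le> f1 * s powr (1/5)"
    by (rule bigo_at_right_0D)
  have "(\<lambda>s. LO2 s - 1) \<in> O[at_right 0](\<lambda>s. s powr (1/5))" unfolding LO2_def using pos d by real_asymp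
  then obtain f2 where f2: "f2 > 0" "\<forall>\<^sub>F s in at_right 0. \<bar>LO2 s - 1\<bar> \<le> f2 * s powr (1/5)"
    by (rule bigo_at_right_0D)
  define \<kappa> where "\<kappa> = exp H0 / sqrt (2 * pi * (pi\<^sup>2 / 3))"
  have \<kappa>: "\<kappa> > 0" by (simp add: \<kappa>_def)
  have small: "\<forall>\<^sub>F s in at_right 0. 0 < s \<and> s \<le> 1/2 \<and> s powr (7/10) \<le> \<delta>0 \<and> C3 * s \<le> 1/2 \<and> Tt s > 0 \<and> c2 * s powr (1/5) \<le> 1 \<and> d * s powr (1/5) \<le> 1"
  proof (intro eventually_conj)
    show "\<forall>\<^sub>F s in at_right 0. 0 < (s::real)" by (rule eventually_at_right_less)
    show "\<forall>\<^sub>F s in at_right 0. s \<le> (1/2::real)" by real_asymp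
    show "\<forall>\<^sub>F s in at_right 0. s powr (7/10) \<le> \<delta>0" using E(2) by real_asymp
    show "\<forall>\<^sub>F s in at_right 0. C3 * s \<le> 1/2" by real_asymp
    show "\<forall>\<^sub>F s in at_right 0. Tt s > 0" unfolding Tt_def by real_asymp
    show "\<forall>\<^sub>F s in at_right 0. c2 * s powr (1/5) \<le> 1" by real_asymp
    show "\<forall>\<^sub>F s in at_right 0. d * s powr (1/5) \<le> 1" by real_asymp
  qed
  have "\<forall>\<^sub>F s in at_right 0. \<bar>real (card (low_confs (pi\<^sup>2 / (6 * s\<^sup>2)))) * exp (- (pi\<^sup>2 / (3 * s))) * s powr (- b) / \<kappa> - 1\<bar> \<le> max f1 f2 * s powr (1/5)"
    using small c1(2) c2(2) d1(2) d2(2) f1(2) f2(2)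
  proof eventually_elim
    case (elim s)
    then have s: "0 < s" "s \<le> 1/2" "s powr (7/10) \<le> \<delta>0" "C3 * s \<le> 1/2" "Tt s > 0" "c2 * s powr (1/5) \<le> 1" "d * s powr (1/5) \<le> 1"
      and \<eta>le: "\<bar>\<eta> s\<bar> \<le> c1 * s powr (1/5)" and \<delta>le: "\<bar>\<delta> s\<bar> \<le> c2 * s powr (1/5)" by auto
    define y where "y = pi\<^sup>2 / (6 * s\<^sup>2)"
    obtain J where J: "\<And>j. j \<ge> J \<Longrightarrow> lam j > y" "real J \<ge> 1 / s" "\<bar>mean_upto s J - mean_sum s\<bar> \<le> s"
      "\<bar>var_upto s J - var_sum s\<bar> \<le> s" "\<bar>log_gf_upto s J - log_gf s\<bar> \<le> s"
      by (rule truncation[OF s(1) s(1), of y]) blast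
    define B where "B = var_upto s J"
    define m where "m = mean_upto s J"
    define h where "h = s powr (-3/4)"
    define K where "K = s powr (-1/20)"
    define U where "U = s powr (-21/20)"
    define V where "V = h\<^sup>2 + B"
    define err where "err = smoothing_err Ce s"
    have hp: "h > 0" "K > 0" "U > 0" using s by (auto simp: h_def K_def U_def)
    have y0: "y \<ge> 0" by (simp add: y_def)
    have s3: "s ^ 3 > 0" using s by simp
    have Bs: "\<bar>B * s ^ 3 - pi\<^sup>2 / 3\<bar> \<le> C3 * s"
    proof -
      have "\<bar>B - pi\<^sup>2 / (3 * s ^ 3)\<bar> \<le> Cv / s\<^sup>2 + s" using Va(2)[OF s(1,2)] J(4) unfolding B_def by linarith
      also have "s \<le> 1 / s\<^sup>2"
      proof -
        have "s * s\<^sup>2 \<le> 1 * 1" using s by (intro mult_mono power_le_one) auto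
        then show ?thesis using s by (simp add: pos_le_divide_eq)
      qed
      then have "Cv / s\<^sup>2 + s \<le> C3 / s\<^sup>2" by (simp add: C3_def add_divide_distrib)
      finally have "\<bar>B - pi\<^sup>2 / (3 * s ^ 3)\<bar> * s ^ 3 \<le> C3 / s\<^sup>2 * s ^ 3" using s3 by (intro mult_right_mono) auto
      also have "C3 / s\<^sup>2 * s ^ 3 = C3 * s" using s by (simp add: power2_eq_square power3_eq_cube)
      also have "\<bar>B - pi\<^sup>2 / (3 * s ^ 3)\<bar> * s ^ 3 = \<bar>(B - pi\<^sup>2 / (3 * s ^ 3)) * s ^ 3\<bar>" using s3 by (simp add: abs_mult)
      also have "(B - pi\<^sup>2 / (3 * s ^ 3)) * s ^ 3 = B * s ^ 3 - pi\<^sup>2 / 3" using s3 by (simp add: left_diff_distrib)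
      finally show ?thesis .
    qed
    have pi9: "9 \<le> pi\<^sup>2" "pi\<^sup>2 \<le> 16"
      using power_mono[of 3 pi 2] power_mono[of pi 4 2] pi_gt3 pi_less_4 by auto
    have B1: "1 \<le> B * s ^ 3" "B * s ^ 3 \<le> 9" using Bs s(4) pi9 by (simp_all only: abs_le_iff) linarith+
    have Bge: "1 / s ^ 3 \<le> B" "B \<le> 9 / s ^ 3" using B1 s3 by (simp_all add: pos_divide_le_eq pos_le_divide_eq)
    have B0: "B > 0" using Bge(1) s3 by (meson less_le_trans zero_less_divide_1_iff)
    have V: "V > 0" "V \<ge> B" using B0 by (auto simp: V_def add_nonneg_pos)
    have D: "\<bar>measure_pmf.expectation (conf_pmf s J) (\<lambda>a. exp (- ((energy J a - w) / h)\<^sup>2 / 2)) - h / sqrt V * exp (- ((w - m)\<^sup>2 / (2 * V)))\<bar> \<le> err" for w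
      unfolding h_def V_def B_def m_def err_def using s J(2) B1(1) by (intro E(3)) (auto simp: B_def)
    have err0: "err \<ge> 0" using D[of 0] by linarith
    have ym: "\<bar>y - m\<bar> \<le> Cm / s"
    proof -
      have "\<bar>mean_sum s - y\<bar> \<le> Cm0 + \<bar>b - 1/2\<bar> / s"
        using M(2)[OF s(1)] s(1) abs_ge_self[of "(b - 1/2) / s"] abs_ge_minus_self[of "(b - 1/2) / s"] unfolding y_def by (simp add: abs_le_iff)
      then have "\<bar>y - m\<bar> \<le> Cm0 + \<bar>b - 1/2\<bar> / s + s" using J(3) unfolding m_def by linarith
      also have "\<dots> \<le> Cm0 / s + \<bar>b - 1/2\<bar> / s + 1 / s"
        using s M(1) mult_mono[of s 1 s 1] by (intro add_mono order_refl) (auto simp: pos_le_divide_eq mult_left_le)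
      finally show ?thesis by (simp add: Cm_def add_divide_distrib)
    qed
    have \<delta>w: "(w - m)\<^sup>2 / (2 * V) \<le> \<delta> s" if w: "y - K * h - U \<le> w" "w \<le> y - K * h" for w
    proof -
      have "\<bar>w - m\<bar> \<le> K * h + U + Cm / s + 1" using w ym hp mult_pos_pos[OF hp(2,1)] unfolding abs_le_iff by linarith
      then have "\<bar>w - m\<bar>\<^sup>2 \<le> (K * h + U + Cm / s + 1)\<^sup>2" by (intro power_mono) auto
      then have "(w - m)\<^sup>2 / (2 * V) \<le> (K * h + U + Cm / s + 1)\<^sup>2 / (2 * (1 / s ^ 3))"
        using V Bge(1) s3 by (intro frac_le) auto
      then show ?thesis by (simp add: \<delta>_def K_def h_def U_def)
    qed
    define R where "R = real (card (low_confs y)) * exp (- (s * y) - log_gf_upto s J)"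
    note sand = count_sandwich[OF s(1) hp(1,2,3) y0 V(1) err0 J(1) D \<delta>w, folded R_def]
    \<comment> \<open>\<open>R\<close> divided by its expected value; the sandwich shows that
      \<open>Q\<close> is 1 + O(\<open>s powr (1/5)\<close>).\<close>
    define Q where "Q = R * s * sqrt (2 * pi) * sqrt B"
    have sB: "sqrt B > 0" using B0 by simp
    have r32: "(s powr (-3/2))\<^sup>2 = 1 / s ^ 3"
    proof -
      have "(s powr (-3/2))\<^sup>2 = s powr (- 3)" using s by (simp add: power2_eq_square flip: powr_add)
      also have "\<dots> = 1 / s ^ 3" by (rule powr_neg_numeral[OF s(1)])
      finally show ?thesis .
    qed
    have sBle: "sqrt B \<le> 3 * s powr (-3/2)"
    proof (rule real_le_lsqrt)
      show "B \<le> (3 * s powr (-3/2))\<^sup>2" unfolding power_mult_distrib r32 using Bge(2) by simp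
    qed (use B0 in auto)
    have Q_up: "Q \<le> UP s"
    proof -
      have "R * (s * (h * sqrt (2 * pi)) * Tt s) \<le> (h / sqrt V + err) * exp (2 * (s * (K * h)))"
        using sand(1) unfolding Tt_def K_def by simp
      then have "R * (s * (h * sqrt (2 * pi)) * Tt s) * (sqrt B / h) \<le> (h / sqrt V + err) * exp (2 * (s * (K * h))) * (sqrt B / h)"
        using sB hp by (intro mult_right_mono) auto
      also have "R * (s * (h * sqrt (2 * pi)) * Tt s) * (sqrt B / h) = Q * Tt s" using hp by (simp add: Q_def)
      also have "(h / sqrt V + err) * exp (2 * (s * (K * h))) * (sqrt B / h) = (sqrt B / sqrt V + err * sqrt B / h) * exp (2 * (s * (K * h)))"
        using hp by (simp add: field_simps)
      also have "\<dots> \<le> (1 + c1 * s powr (1/5)) * exp (2 * (s * (K * h)))"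
      proof (intro mult_right_mono add_mono)
        show "sqrt B / sqrt V \<le> 1" using V by simp
        have "err * sqrt B / h \<le> err * (3 * s powr (-3/2)) / h"
          using err0 sBle hp by (intro divide_right_mono mult_left_mono) auto
        also have "\<dots> = \<eta> s" by (simp add: \<eta>_def err_def h_def)
        finally show "err * sqrt B / h \<le> c1 * s powr (1/5)" using \<eta>le by linarith
      qed auto
      finally show ?thesis using s(5) by (simp add: UP_def pos_le_divide_eq h_def K_def)
    qed
    have Q_lo: "LO s \<le> Q"
    proof -
      define X where "X = exp (s * (K * h) + s\<^sup>2 * h\<^sup>2 / 2)"
      have X: "X > 0" by (simp add: X_def)
      have u1: "0 \<le> 1 - exp (- (s * U))" using s hp by simp
      have "(1 - exp (- (s * U))) * (h / sqrt V * (1 - \<delta> s) - err - exp (- (K\<^sup>2 / 2))) * (sqrt B / h) \<le> R * (s * (h * sqrt (2 * pi)) * X) * (sqrt B / h)"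
        using sand(2) sB hp unfolding X_def by (intro mult_right_mono) auto
      also have "R * (s * (h * sqrt (2 * pi)) * X) * (sqrt B / h) = Q * X" using hp by (simp add: Q_def)
      finally have q1: "(1 - exp (- (s * U))) * (h / sqrt V * (1 - \<delta> s) - err - exp (- (K\<^sup>2 / 2))) * (sqrt B / h) \<le> Q * X" .
      have "(1 - exp (- (s * U))) * ((1 - c2 * s powr (1/5)) / sqrt (1 + h\<^sup>2 * s ^ 3) - (c1 * s powr (1/5) + exp (- (K\<^sup>2 / 2)) * (3 * s powr (-3/2)) / h))
        \<le> (1 - exp (- (s * U))) * ((h / sqrt V * (1 - \<delta> s) - err - exp (- (K\<^sup>2 / 2))) * (sqrt B / h))"
      proof (rule mult_left_mono[OF _ u1])
        have e: "(h / sqrt V * (1 - \<delta> s) - err - exp (- (K\<^sup>2 / 2))) * (sqrt B / h) = (1 - \<delta> s) * (sqrt B / sqrt V) - (err * sqrt B / h + exp (- (K\<^sup>2 / 2)) * sqrt B / h)"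
          using hp by (simp add: field_simps)
        have g1: "err * sqrt B / h \<le> c1 * s powr (1/5)"
        proof -
          have "err * sqrt B / h \<le> err * (3 * s powr (-3/2)) / h"
            using err0 sBle hp by (intro divide_right_mono mult_left_mono) auto
          also have "\<dots> = \<eta> s" by (simp add: \<eta>_def err_def h_def)
          finally show ?thesis using \<eta>le by linarith
        qed
        have g2: "exp (- (K\<^sup>2 / 2)) * sqrt B / h \<le> exp (- (K\<^sup>2 / 2)) * (3 * s powr (-3/2)) / h"
          using sBle hp by (intro divide_right_mono mult_left_mono) auto
        have g3: "(1 - c2 * s powr (1/5)) / sqrt (1 + h\<^sup>2 * s ^ 3) \<le> (1 - \<delta> s) * (sqrt B / sqrt V)"
        proof -
          have "V \<le> B * (1 + h\<^sup>2 * s ^ 3)"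
          proof -
            have "h\<^sup>2 * 1 \<le> h\<^sup>2 * (B * s ^ 3)" using B1 by (intro mult_left_mono) auto
            then show ?thesis by (simp add: V_def algebra_simps)
          qed
          then have "sqrt V \<le> sqrt B * sqrt (1 + h\<^sup>2 * s ^ 3)" by (simp flip: real_sqrt_mult)
          moreover have p: "sqrt (1 + h\<^sup>2 * s ^ 3) > 0" using s by (simp add: add_pos_nonneg)
          ultimately have "1 / sqrt (1 + h\<^sup>2 * s ^ 3) \<le> sqrt B / sqrt V" using V by (simp add: field_simps)
          then have "(1 - c2 * s powr (1/5)) * (1 / sqrt (1 + h\<^sup>2 * s ^ 3)) \<le> (1 - \<delta> s) * (sqrt B / sqrt V)"
            using \<delta>le s(6) p by (intro mult_mono) auto
          then show ?thesis by simp
        qed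
        show "(1 - c2 * s powr (1/5)) / sqrt (1 + h\<^sup>2 * s ^ 3) - (c1 * s powr (1/5) + exp (- (K\<^sup>2 / 2)) * (3 * s powr (-3/2)) / h)
          \<le> (h / sqrt V * (1 - \<delta> s) - err - exp (- (K\<^sup>2 / 2))) * (sqrt B / h)"
          unfolding e using g1 g2 g3 by linarith
      qed
      also have "\<dots> \<le> Q * X" using q1 by (simp only: mult.assoc)
      finally have "(1 - exp (- (s * U))) * ((1 - c2 * s powr (1/5)) / sqrt (1 + h\<^sup>2 * s ^ 3) - (c1 * s powr (1/5) + exp (- (K\<^sup>2 / 2)) * (3 * s powr (-3/2)) / h)) * (1 / X) \<le> Q * X * (1 / X)"
        using X by (intro mult_right_mono) auto
      also have "Q * X * (1 / X) = Q" using X by simp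
      also have "1 / X = exp (- (s * (K * h) + s\<^sup>2 * h\<^sup>2 / 2))" unfolding X_def by (simp only: exp_minus inverse_eq_divide)
      finally show ?thesis by (simp only: LO_def h_def K_def U_def)
    qed
    have Qd: "1 - d * s powr (1/5) \<le> Q" "Q \<le> 1 + d * s powr (1/5)"
    proof -
      have "d1 * s powr (1/5) \<le> d * s powr (1/5)" "d2 * s powr (1/5) \<le> d * s powr (1/5)"
        by (auto simp: d_def intro!: mult_right_mono)
      then show "1 - d * s powr (1/5) \<le> Q" "Q \<le> 1 + d * s powr (1/5)" using Q_up Q_lo elim by linarith+
    qed
    define \<rho> where "\<rho> = log_gf_upto s J - (pi\<^sup>2 / (6 * s) + (b - 1/2) * ln s + H0)"
    have \<rho>: "\<bar>\<rho>\<bar> \<le> C2 * s"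
    proof -
      have "Cl * s \<le> \<bar>Cl\<bar> * s" using s by (intro mult_right_mono) auto
      then show ?thesis using L[OF s(1)] J(5) unfolding \<rho>_def C2_def distrib_right by linarith
    qed
    define q where "q = B * s ^ 3 / (pi\<^sup>2 / 3)"
    have q: "\<bar>q - 1\<bar> \<le> C3 * s"
    proof -
      have "q - 1 = (B * s ^ 3 - pi\<^sup>2 / 3) / (pi\<^sup>2 / 3)" using pi9 by (simp add: q_def diff_divide_distrib)
      moreover have "\<bar>pi\<^sup>2 / 3\<bar> = pi\<^sup>2 / 3" by simp
      ultimately have "\<bar>q - 1\<bar> = \<bar>B * s ^ 3 - pi\<^sup>2 / 3\<bar> / (pi\<^sup>2 / 3)"
        by (metis abs_divide)
      also have "\<dots> \<le> \<bar>B * s ^ 3 - pi\<^sup>2 / 3\<bar> / 1" using pi9 by (intro divide_left_mono) auto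
      finally show ?thesis using Bs by simp
    qed
    have q0: "q > 0" using B1 pi9 by (simp add: q_def)
    have X: "real (card (low_confs y)) * exp (- (pi\<^sup>2 / (3 * s))) * s powr (- b) / \<kappa> = Q * exp \<rho> / sqrt q"
    proof -
      have sy: "s * y = pi\<^sup>2 / (6 * s)" using s by (simp add: y_def power2_eq_square)
      have "- (s * y) - log_gf_upto s J = - (pi\<^sup>2 / (3 * s)) - \<rho> - H0 + (1/2 - b) * ln s"
        unfolding sy \<rho>_def by (simp add: algebra_simps)
      then have "exp (- (s * y) - log_gf_upto s J) = exp (- (pi\<^sup>2 / (3 * s))) * exp (- \<rho>) * exp (- H0) * s powr (1/2 - b)"
        using s by (simp add: powr_def algebra_simps flip: exp_add)
      then have R: "R = real (card (low_confs y)) * (exp (- (pi\<^sup>2 / (3 * s))) * exp (- \<rho>) * exp (- H0) * s powr (1/2 - b))"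
        by (simp add: R_def)
      have sq: "sqrt q = sqrt B * s powr (3/2) / sqrt (pi\<^sup>2 / 3)"
      proof -
        have "sqrt (s ^ 3) = (s powr 3) powr (1/2)"
          using s by (subst powr_half_sqrt) (simp_all add: powr_numeral)
        also have "\<dots> = s powr (3/2)" by (simp add: powr_powr)
        finally have "sqrt (s ^ 3) = s powr (3/2)" .
        then show ?thesis by (simp add: q_def real_sqrt_divide real_sqrt_mult)
      qed
      have p: "s * s powr (1/2 - b) / s powr (3/2) = s powr (- b)"
      proof -
        have "s * s powr (1/2 - b) = s powr (3/2 - b)" using s by (subst powr_mult_base) auto
        then show ?thesis by (simp flip: powr_diff)
      qed
      have "Q * exp \<rho> / sqrt q = real (card (low_confs y)) * exp (- (pi\<^sup>2 / (3 * s))) * (s * s powr (1/2 - b) / s powr (3/2)) * (exp (- \<rho>) * exp \<rho>) * (sqrt (2 * pi) * sqrt (pi\<^sup>2 / 3) * exp (- H0))"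
        unfolding sq Q_def R using sB by simp
      also have "exp (- \<rho>) * exp \<rho> = 1" by (simp flip: exp_add)
      also have "sqrt (2 * pi) * sqrt (pi\<^sup>2 / 3) * exp (- H0) = 1 / \<kappa>"
        unfolding \<kappa>_def real_sqrt_mult[symmetric] exp_minus by (simp only: divide_inverse inverse_mult_distrib inverse_inverse_eq mult_1 mult.commute)
      finally show ?thesis unfolding p by simp
    qed
    have up: "Q * exp \<rho> / sqrt q \<le> UP2 s"
      unfolding UP2_def
    proof (intro frac_le mult_mono)
      show "sqrt (1 - C3 * s) > 0" using s(4) by simp
      show "sqrt (1 - C3 * s) \<le> sqrt q" using q by simp
    qed (use Qd \<rho> d in \<open>auto intro!: add_nonneg_nonneg\<close>)
    have lo: "LO2 s \<le> Q * exp \<rho> / sqrt q"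
      unfolding LO2_def
    proof (intro frac_le mult_mono)
      show "sqrt q \<le> sqrt (1 + C3 * s)" using q by simp
      show "0 \<le> Q * exp \<rho>" using Qd s(7) by simp
    qed (use Qd \<rho> s(7) q0 in auto)
    have "f1 * s powr (1/5) \<le> max f1 f2 * s powr (1/5)" "f2 * s powr (1/5) \<le> max f1 f2 * s powr (1/5)"
      by (auto intro!: mult_right_mono)
    then show ?case using up lo elim unfolding X[unfolded y_def] by linarith
  qed
  then show ?thesis using that \<kappa> by blast
qed

end

section \<open>The monoid generated by a Lucas sequence\<close>

context lucas_pair
begin

definition prim_idx :: "nat set" where
  "prim_idx = {n. 1 \<le> n \<and> (\<exists>p. primitive_divisor \<phi> \<psi> p n)}"

lemma int_divides_of_int: "int_divides p (of_int k) \<longleftrightarrow> int p dvd k"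
  by (auto simp: int_divides_def)

lemma primitive_divisor_iff:
  "primitive_divisor \<phi> \<psi> p n \<longleftrightarrow> prime p \<and> int p dvd l n \<and> (\<forall>i. 1 \<le> i \<and> i < n \<longrightarrow> \<not> int p dvd l i)"
proof -
  have "(\<Prod>i=1..<n. lucas_v \<phi> \<psi> i) = of_int (\<Prod>i=1..<n. l i)" by (simp add: lucas_v_eq)
  then have "primitive_divisor \<phi> \<psi> p n \<longleftrightarrow> prime p \<and> int p dvd l n \<and> \<not> int p dvd (\<Prod>i=1..<n. l i)"
    by (simp only: primitive_divisor_def lucas_v_eq int_divides_of_int)
  moreover have "int p dvd (\<Prod>i=1..<n. l i) \<longleftrightarrow> (\<exists>i\<in>{1..<n}. int p dvd l i)" if "prime p"
    using that by (intro prime_dvd_prod_iff) auto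
  ultimately show ?thesis by auto
qed

lemma prim_idx_ge_13: "n \<ge> 13 \<Longrightarrow> n \<in> prim_idx"
proof -
  assume n: "n \<ge> 13"
  obtain p where p: "prime p" "p dvd l n" "\<forall>m. 0 < m \<and> m < n \<longrightarrow> \<not> p dvd l m" using carmichael[OF n] by blast
  have "int (nat p) = p" using prime_gt_0_int[OF p(1)] by simp
  moreover have "prime (nat p)" using p(1) calculation by (metis prime_int_nat_transfer)
  ultimately have "primitive_divisor \<phi> \<psi> (nat p) n" unfolding primitive_divisor_iff using p by auto
  then show ?thesis using n by (auto simp: prim_idx_def)
qed

lemma prim_idx_prime:
  assumes "n \<in> prim_idx"
  obtains p :: int where "prime p" "p dvd l n" "\<And>i. 0 < i \<Longrightarrow> i < n \<Longrightarrow> \<not> p dvd l i"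
proof -
  obtain p where "primitive_divisor \<phi> \<psi> p n" using assms by (auto simp: prim_idx_def)
  then have "prime (int p)" "int p dvd l n" "\<And>i. 0 < i \<Longrightarrow> i < n \<Longrightarrow> \<not> int p dvd l i"
    unfolding primitive_divisor_iff by auto
  then show ?thesis using that by blast
qed

lemma prim_idx_pos: "n \<in> prim_idx \<Longrightarrow> n > 0"
  by (auto simp: prim_idx_def)

lemma l_gt_1: "n \<in> prim_idx \<Longrightarrow> l n > 1"
proof -
  assume n: "n \<in> prim_idx"
  obtain p where p: "prime p" "p dvd l n" using prim_idx_prime[OF n] by blast
  have "l n > 0" using l_pos prim_idx_pos[OF n] by blast
  then have "p \<le> l n" using p(2) by (intro zdvd_imp_le)
  then show "l n > 1" using prime_gt_1_int[OF p(1)] by linarith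
qed

text \<open>A primitive prime of the larger index separates the two values. Outside
  \<open>prim_idx\<close> values may repeat: for \<open>P = 1\<close> both \<open>l 1\<close> and
  \<open>l 2\<close> are 1.\<close>

lemma inj_on_l: "inj_on l prim_idx"
proof -
  have "l m \<noteq> l n" if m: "m \<in> prim_idx" and n: "n \<in> prim_idx" and mn: "m < n" for m n
  proof -
    obtain p where "p dvd l n" "\<And>i. 0 < i \<Longrightarrow> i < n \<Longrightarrow> \<not> p dvd l i" using prim_idx_prime[OF n] by blast
    then show ?thesis using prim_idx_pos[OF m] mn by metis
  qed
  then show ?thesis by (intro inj_onI) (metis linorder_neqE_nat)
qed

lemma lucas_F_eq: "lucas_F \<phi> \<psi> = (\<lambda>n. of_int (l n)) ` prim_idx"
  by (auto simp: lucas_F_def prim_idx_def lucas_v_eq)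

lemma card_lucas_F0: "card (lucas_F0 \<phi> \<psi>) = card (prim_idx \<inter> {..12})"
proof -
  have "lucas_F0 \<phi> \<psi> = (\<lambda>n. of_int (l n)) ` (prim_idx \<inter> {..12})"
    by (auto simp: lucas_F0_def prim_idx_def lucas_v_eq)
  moreover have "inj_on (\<lambda>n. real_of_int (l n)) (prim_idx \<inter> {..12})"
    using inj_on_l by (auto simp: inj_on_def)
  ultimately show ?thesis by (simp add: card_image)
qed

definition small_count :: nat where "small_count = card (prim_idx \<inter> {..12})"

text \<open>Any enumeration will do, since the order of finitely many parts has no influence on the
  asymptotics.\<close>

definition idx0 :: "nat \<Rightarrow> nat" where
  "idx0 = (SOME g. bij_betw g {..<small_count} (prim_idx \<inter> {..12}))"

text \<open>After the small indices, position \<open>small_count\<close> is sent to 13, the next one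
  to 14, and so on. The truncated subtraction is harmless by \<open>small_count_le\<close>.\<close>

definition idx :: "nat \<Rightarrow> nat" where "idx j = (if j < small_count then idx0 j else j + 13 - small_count)"

lemma bij_idx0: "bij_betw idx0 {..<small_count} (prim_idx \<inter> {..12})"
proof -
  have "\<exists>g. bij_betw g {..<small_count} (prim_idx \<inter> {..12})"
    unfolding small_count_def using ex_bij_betw_nat_finite[of "prim_idx \<inter> {..12}"] by (auto simp: atLeast0LessThan)
  then show ?thesis unfolding idx0_def by (rule someI_ex)
qed

lemma small_count_le: "small_count \<le> 12"
proof -
  have "prim_idx \<inter> {..12} \<subseteq> {1..12}" using prim_idx_pos by (auto simp: Suc_le_eq)
  then have "small_count \<le> card {1..12::nat}" unfolding small_count_def by (intro card_mono) auto
  then show ?thesis by simp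
qed

lemma bij_idx: "bij_betw idx UNIV prim_idx"
proof -
  have "bij_betw idx ({..<small_count} \<union> {small_count..}) ((prim_idx \<inter> {..12}) \<union> {13..})"
  proof (rule bij_betw_combine)
    show "bij_betw idx {..<small_count} (prim_idx \<inter> {..12})"
      using bij_idx0 by (subst bij_betw_cong[of _ _ idx0]) (auto simp: idx_def)
    show "bij_betw idx {small_count..} {13..}"
      using small_count_le by (intro bij_betw_byWitness[where f' = "\<lambda>n. n + small_count - 13"]) (auto simp: idx_def)
  qed auto
  moreover have "{..<small_count} \<union> {small_count..} = UNIV" by auto
  moreover have "(prim_idx \<inter> {..12}) \<union> {13..} = prim_idx" using prim_idx_ge_13 by force
  ultimately show ?thesis by simp
qed

lemma idx_in: "idx j \<in> prim_idx"
  using bij_idx by (auto simp: bij_betw_def)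

definition lam :: "nat \<Rightarrow> real" where "lam j = ln (of_int (l (idx j))) / ln \<phi>"

text \<open>From \<open>small_count\<close> on the index is \<open>n = j + 13 - small_count\<close>,
  and \<open>l n\<close> is close to \<open>\<phi> ^ n / (\<phi> - \<psi>)\<close>; so
  \<open>lam j\<close> is close to \<open>j + shift\<close>. The exponent \<open>k1\<close> will be
  \<open>- shift / 2\<close>.\<close>

definition shift :: real where "shift = 13 - real small_count - ln (\<phi> - \<psi>) / ln \<phi>"

lemma ln_phi_pos: "ln \<phi> > 0"
  using phi_gt_1 by simp

text \<open>The deviation is exactly \<open>ln (1 - (\<psi> / \<phi>) ^ n) / ln \<phi>\<close> for
  the large indices \<open>n\<close>, and it decays geometrically.\<close>

sublocale almost_arith_seq lam shift
proof
  fix j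
  show "lam j > 0" unfolding lam_def using l_gt_1[OF idx_in[of j]] ln_phi_pos by simp
next
  define r where "r = \<bar>\<psi> / \<phi>\<bar>"
  have r: "0 \<le> r" "r < 1" using dominant phi_gt_1 by (auto simp: r_def)
  have bd: "\<bar>lam j - (real j + shift)\<bar> \<le> (1 / (ln \<phi> * (1 - r))) * r ^ j" if j: "j \<ge> small_count" for j
  proof -
    define n where "n = j + 13 - small_count"
    have n: "idx j = n" "n \<ge> j" "n > 0" "real n = real j + 13 - real small_count" using j small_count_le by (auto simp: n_def idx_def)
    define t where "t = (\<psi> / \<phi>) ^ n"
    have at: "\<bar>t\<bar> = r ^ n" by (simp add: t_def r_def power_abs)
    have rn: "r ^ n < 1" using r n by (simp add: power_less_one_iff)
    have rr: "r ^ n \<le> r" using r n power_decreasing[of 1 n r] by simp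
    have p0: "\<phi> > 0" "\<phi> - \<psi> > 0" using dominant by linarith+
    have "real_of_int (l n) = (\<phi> ^ n - \<psi> ^ n) / (\<phi> - \<psi>)" using lucas_v_eq[of n] by (simp add: lucas_v_def)
    also have "\<phi> ^ n - \<psi> ^ n = \<phi> ^ n * (1 - t)" using p0 by (simp add: t_def power_divide right_diff_distrib)
    finally have "ln (real_of_int (l n)) = ln (\<phi> ^ n * (1 - t)) - ln (\<phi> - \<psi>)"
      using p0 at rn by (simp add: ln_div)
    also have "ln (\<phi> ^ n * (1 - t)) = real n * ln \<phi> + ln (1 - t)"
      using p0 at rn by (simp add: ln_mult ln_realpow)
    finally have "lam j = real n + ln (1 - t) / ln \<phi> - ln (\<phi> - \<psi>) / ln \<phi>"
      unfolding lam_def n(1) using ln_phi_pos by (simp add: add_divide_distrib diff_divide_distrib)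
    then have "lam j - (real j + shift) = ln (1 - t) / ln \<phi>" using n by (simp add: shift_def)
    then have "\<bar>lam j - (real j + shift)\<bar> = \<bar>ln (1 - t)\<bar> / ln \<phi>" using ln_phi_pos by (simp add: abs_divide)
    also have "\<dots> \<le> (\<bar>t\<bar> / (1 - \<bar>t\<bar>)) / ln \<phi>"
      using ln_phi_pos at rn by (intro divide_right_mono abs_ln_one_minus) auto
    also have "\<dots> \<le> (r ^ j / (1 - r)) / ln \<phi>"
    proof (intro divide_right_mono frac_le)
      show "\<bar>t\<bar> \<le> r ^ j" unfolding at using r n by (intro power_decreasing) auto
      show "1 - r \<le> 1 - \<bar>t\<bar>" unfolding at using rr by simp
    qed (use r ln_phi_pos in auto)
    finally show ?thesis by (simp add: field_simps)
  qed
  show "summable (\<lambda>j. \<bar>lam j - (real j + shift)\<bar>)"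
  proof (rule summable_comparison_test'[where N = small_count])
    show "summable (\<lambda>j. (1 / (ln \<phi> * (1 - r))) * r ^ j)" using r by (intro summable_mult summable_geometric) auto
  qed (use bd in auto)
qed

section \<open>Unique factorization in the monoid\<close>

definition conf_val :: "(nat \<Rightarrow> nat) \<Rightarrow> int" where
  "conf_val a = (\<Prod>j | a j \<noteq> 0. l (idx j) ^ a j)"

definition fin_confs :: "(nat \<Rightarrow> nat) set" where "fin_confs = {a. finite {j. a j \<noteq> 0}}"

lemma conf_val_eq:
  assumes "finite S" "{j. a j \<noteq> 0} \<subseteq> S"
  shows "conf_val a = (\<Prod>j\<in>S. l (idx j) ^ a j)"
  unfolding conf_val_def using assms by (intro prod.mono_neutral_left) auto

lemma l_idx_pos: "l (idx j) > 0"
  using l_gt_1[OF idx_in[of j]] by linarith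

text \<open>Among the generators with different exponents take the one of largest index. Its
  primitive prime divides none of the other generators whose exponents differ, so the valuations of
  the two products at that prime are different.\<close>

lemma inj_on_conf_val: "inj_on conf_val fin_confs"
proof (rule inj_onI, rule ccontr)
  fix a a' assume aa: "a \<in> fin_confs" "a' \<in> fin_confs" "conf_val a = conf_val a'" "a \<noteq> a'"
  define S where "S = {j. a j \<noteq> 0} \<union> {j. a' j \<noteq> 0}"
  have S: "finite S" using aa by (simp add: S_def fin_confs_def)
  define D where "D = {j. a j \<noteq> a' j}"
  have DS: "D \<subseteq> S" by (auto simp: D_def S_def)
  have D: "finite D" "D \<noteq> {}" "D \<subseteq> S" using finite_subset[OF DS S] DS aa(4) by (auto simp: D_def)
  \<comment> \<open>The maximum is taken over Lucas indices, not over positions, because the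
    enumeration of the small indices is in no particular order.\<close>
  define m where "m = Max (idx ` D)"
  have "m \<in> idx ` D" unfolding m_def using D by (intro Max_in) auto
  then obtain j where j: "j \<in> D" "idx j = m" by blast
  have mx: "idx i < m" if "i \<in> D" "i \<noteq> j" for i
  proof -
    have "idx i \<le> m" unfolding m_def using D that by (intro Max_ge) auto
    moreover have "idx i \<noteq> idx j" using bij_idx that(2) by (auto simp: bij_betw_def inj_def)
    ultimately show ?thesis using j(2) by simp
  qed
  obtain p where p: "prime p" "p dvd l m" "\<And>i. 0 < i \<Longrightarrow> i < m \<Longrightarrow> \<not> p dvd l i"
    using prim_idx_prime[OF idx_in[of j]] j(2) by blast
  have mult: "multiplicity p (\<Prod>i\<in>S. l (idx i) ^ f i) = (\<Sum>i\<in>S. f i * multiplicity p (l (idx i)))" for f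
  proof -
    have "multiplicity p (\<Prod>i\<in>S. l (idx i) ^ f i) = (\<Sum>i\<in>S. multiplicity p (l (idx i) ^ f i))"
      using p(1) S l_idx_pos by (intro prime_elem_multiplicity_prod_distrib) (auto simp: less_imp_neq[symmetric])
    also have "\<dots> = (\<Sum>i\<in>S. f i * multiplicity p (l (idx i)))"
      using p(1) l_idx_pos by (intro sum.cong refl prime_elem_multiplicity_power_distrib) (auto simp: less_imp_neq[symmetric])
    finally show ?thesis .
  qed
  have "(\<Prod>i\<in>S. l (idx i) ^ a i) = (\<Prod>i\<in>S. l (idx i) ^ a' i)"
    using aa(3) conf_val_eq[of S a] conf_val_eq[of S a'] S by (auto simp: S_def)
  then have "(\<Sum>i\<in>S. a i * multiplicity p (l (idx i))) = (\<Sum>i\<in>S. a' i * multiplicity p (l (idx i)))"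
    using mult[of a] mult[of a'] by simp
  then have "(\<Sum>i\<in>S. int (a i) * int (multiplicity p (l (idx i)))) = (\<Sum>i\<in>S. int (a' i) * int (multiplicity p (l (idx i))))"
    by (metis (no_types, lifting) of_nat_mult of_nat_sum sum.cong)
  then have "(\<Sum>i\<in>S. (int (a i) - int (a' i)) * int (multiplicity p (l (idx i)))) = 0"
    by (simp add: left_diff_distrib sum_subtractf)
  also have "(\<Sum>i\<in>S. (int (a i) - int (a' i)) * int (multiplicity p (l (idx i)))) = (\<Sum>i\<in>{j}. (int (a i) - int (a' i)) * int (multiplicity p (l (idx i))))"
  proof (rule sum.mono_neutral_right[OF S])
    show "{j} \<subseteq> S" using j D by auto
    show "\<forall>i\<in>S - {j}. (int (a i) - int (a' i)) * int (multiplicity p (l (idx i))) = 0"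
    proof
      fix i assume i: "i \<in> S - {j}"
      show "(int (a i) - int (a' i)) * int (multiplicity p (l (idx i))) = 0"
      proof (cases "i \<in> D")
        case True
        then have "\<not> p dvd l (idx i)" using mx[of i] i prim_idx_pos[OF idx_in[of i]] p(3) by blast
        then show ?thesis by (simp add: not_dvd_imp_multiplicity_0)
      qed (simp add: D_def)
    qed
  qed
  finally have "(int (a j) - int (a' j)) * int (multiplicity p (l m)) = 0" using j by simp
  moreover have "multiplicity p (l m) > 0"
    using p(1,2) l_idx_pos[of j] j(2) by (intro prime_multiplicity_gt_zero_iff[THEN iffD2]) (auto simp: prime_imp_prime_elem)
  ultimately show False using j(1) by (simp add: D_def)
qed

lemma mult_monoid_mult: "u \<in> mult_monoid S \<Longrightarrow> w \<in> mult_monoid S \<Longrightarrow> u * w \<in> mult_monoid S"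
proof -
  assume "u \<in> mult_monoid S" "w \<in> mult_monoid S"
  then obtain us ws where "u = prod_list us" "w = prod_list ws" "set us \<subseteq> S" "set ws \<subseteq> S"
    by (auto simp: mult_monoid_def)
  then have "u * w = prod_list (us @ ws)" "set (us @ ws) \<subseteq> S" by auto
  then show ?thesis unfolding mult_monoid_def by blast
qed

lemma mult_monoid_1: "1 \<in> mult_monoid S"
  unfolding mult_monoid_def by (auto intro!: exI[of _ "[]"])

lemma mult_monoid_gen: "u \<in> S \<Longrightarrow> u \<in> mult_monoid S"
  unfolding mult_monoid_def by (auto intro!: exI[of _ "[u]"])

lemma mult_monoid_lucas: "mult_monoid (lucas_F \<phi> \<psi>) = (\<lambda>a. of_int (conf_val a)) ` fin_confs"
proof (intro equalityI subsetI)
  fix u assume "u \<in> mult_monoid (lucas_F \<phi> \<psi>)"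
  then obtain ms where ms: "u = prod_list ms" "set ms \<subseteq> lucas_F \<phi> \<psi>" by (auto simp: mult_monoid_def)
  have "prod_list ms \<in> (\<lambda>a. of_int (conf_val a)) ` fin_confs" using ms(2)
  proof (induction ms)
    case Nil
    have "(\<lambda>_. 0) \<in> fin_confs" "conf_val (\<lambda>_. 0) = 1" by (auto simp: fin_confs_def conf_val_def)
    then show ?case by force
  next
    case (Cons w ms)
    then obtain a where a: "a \<in> fin_confs" "prod_list ms = of_int (conf_val a)" by auto
    obtain n where n: "n \<in> prim_idx" "w = of_int (l n)" using Cons.prems by (auto simp: lucas_F_eq)
    obtain j where j: "n = idx j" using n(1) bij_idx by (auto simp: bij_betw_def)
    define a' where "a' = a(j := Suc (a j))"
    define S where "S = insert j {i. a i \<noteq> 0}"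
    have S: "finite S" "j \<in> S" using a(1) by (auto simp: S_def fin_confs_def)
    have "{i. a' i \<noteq> 0} \<subseteq> S" by (auto simp: a'_def S_def split: if_splits)
    then have a': "a' \<in> fin_confs" using finite_subset S(1) by (simp add: fin_confs_def) blast
    have "conf_val a' = (\<Prod>i\<in>S. l (idx i) ^ a' i)" using S by (intro conf_val_eq) (auto simp: a'_def S_def)
    also have "\<dots> = l (idx j) ^ a' j * (\<Prod>i\<in>S - {j}. l (idx i) ^ a' i)" using S by (rule prod.remove)
    also have "(\<Prod>i\<in>S - {j}. l (idx i) ^ a' i) = (\<Prod>i\<in>S - {j}. l (idx i) ^ a i)" by (intro prod.cong) (auto simp: a'_def)
    also have "l (idx j) ^ a' j * \<dots> = l (idx j) * (l (idx j) ^ a j * (\<Prod>i\<in>S - {j}. l (idx i) ^ a i))" by (simp add: a'_def)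
    also have "l (idx j) ^ a j * (\<Prod>i\<in>S - {j}. l (idx i) ^ a i) = (\<Prod>i\<in>S. l (idx i) ^ a i)" using S by (rule prod.remove[symmetric])
    also have "\<dots> = conf_val a" using S by (intro conf_val_eq[symmetric]) (auto simp: S_def)
    finally have "prod_list (w # ms) = of_int (conf_val a')" using a(2) n(2) j by simp
    then show ?case using a' by blast
  qed
  then show "u \<in> (\<lambda>a. of_int (conf_val a)) ` fin_confs" using ms(1) by simp
next
  fix u assume "u \<in> (\<lambda>a. real_of_int (conf_val a)) ` fin_confs"
  then obtain a where a: "finite {j. a j \<noteq> 0}" "u = of_int (conf_val a)" by (auto simp: fin_confs_def)
  have pw: "(of_int (l (idx j)) :: real) ^ k \<in> mult_monoid (lucas_F \<phi> \<psi>)" for j k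
  proof (induction k)
    case (Suc k)
    have "of_int (l (idx j)) \<in> lucas_F \<phi> \<psi>" using idx_in by (auto simp: lucas_F_eq)
    then show ?case using Suc by (simp add: mult_monoid_mult mult_monoid_gen)
  qed (simp add: mult_monoid_1)
  have "(\<Prod>j\<in>S. (of_int (l (idx j)) :: real) ^ a j) \<in> mult_monoid (lucas_F \<phi> \<psi>)" if "finite S" for S
    using that by (induction S rule: finite_induct) (auto simp: mult_monoid_1 intro!: mult_monoid_mult pw)
  then show "u \<in> mult_monoid (lucas_F \<phi> \<psi>)" using a by (simp add: conf_val_def)
qed

lemma conf_val_pos: "conf_val a \<ge> 1"
proof -
  have "conf_val a > 0" unfolding conf_val_def using l_idx_pos by (intro prod_pos) auto
  then show ?thesis by linarith
qed

lemma ln_conf_val: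
  assumes "a \<in> fin_confs"
  shows "ln (of_int (conf_val a)) = ln \<phi> * (\<Sum>j | a j \<noteq> 0. lam j * real (a j))"
proof -
  have "ln (of_int (conf_val a)) = ln (\<Prod>j | a j \<noteq> 0. (of_int (l (idx j)) :: real) ^ a j)" by (simp add: conf_val_def)
  also have "\<dots> = (\<Sum>j | a j \<noteq> 0. ln ((of_int (l (idx j)) :: real) ^ a j))"
    using assms l_idx_pos by (intro ln_prod) (auto simp: fin_confs_def less_imp_neq[symmetric])
  also have "\<dots> = (\<Sum>j | a j \<noteq> 0. ln \<phi> * (lam j * real (a j)))"
    using ln_phi_pos by (intro sum.cong refl) (simp add: ln_realpow lam_def)
  finally show ?thesis by (simp add: sum_distrib_left)
qed

lemma card_monoid:
  assumes x: "x > 0"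
  shows "card (mult_monoid (lucas_F \<phi> \<psi>) \<inter> {1..x}) = card (low_confs (ln x / ln \<phi>))"
proof -
  have iff: "of_int (conf_val a) \<le> x \<longleftrightarrow> (\<Sum>j | a j \<noteq> 0. lam j * real (a j)) \<le> ln x / ln \<phi>" if "a \<in> fin_confs" for a
  proof -
    have "0 < (of_int (conf_val a) :: real)" using conf_val_pos[of a] by simp
    then have "of_int (conf_val a) \<le> x \<longleftrightarrow> ln (of_int (conf_val a)) \<le> ln x" using x by simp
    then show ?thesis unfolding ln_conf_val[OF that] using ln_phi_pos by (simp add: pos_le_divide_eq mult.commute)
  qed
  have "mult_monoid (lucas_F \<phi> \<psi>) \<inter> {1..x} = (\<lambda>a. of_int (conf_val a)) ` low_confs (ln x / ln \<phi>)"
  proof -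
    have "low_confs (ln x / ln \<phi>) = {a \<in> fin_confs. of_int (conf_val a) \<le> x}"
      using iff by (auto simp: low_confs_def fin_confs_def)
    moreover have "1 \<le> (of_int (conf_val a) :: real)" for a using conf_val_pos[of a] by simp
    ultimately show ?thesis unfolding mult_monoid_lucas by auto
  qed
  moreover have "inj_on (\<lambda>a. real_of_int (conf_val a)) (low_confs (ln x / ln \<phi>))"
    using inj_on_conf_val by (auto simp: inj_on_def low_confs_def fin_confs_def)
  ultimately show ?thesis by (simp add: card_image)
qed

lemma main_asymptotics:
  "\<exists>k0 k1 :: real.
    k1 = (real (card (lucas_F0 \<phi> \<psi>)) - 13) / 2 + ln (\<phi> - \<psi>) / (2 * ln \<phi>) \<and>
    (\<exists>E :: real \<Rightarrow> real. E \<in> O[at_top](\<lambda>x. 1 / (ln x) powr (1 / 10)) \<and>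
      (\<forall>\<^sub>F x in at_top.
        real (card (mult_monoid (lucas_F \<phi> \<psi>) \<inter> {1..x})) =
          k0 * (ln x) powr k1 * exp (pi * sqrt (2 * ln x / (3 * ln \<phi>))) * (1 + E x)))"
proof -
  obtain \<kappa> c where \<kappa>: "\<kappa> > 0" and asy: "\<forall>\<^sub>F s in at_right 0.
     \<bar>real (card (low_confs (pi\<^sup>2 / (6 * s\<^sup>2)))) * exp (- (pi\<^sup>2 / (3 * s))) * s powr (- shift) / \<kappa> - 1\<bar> \<le> c * s powr (1/5)"
    by (rule count_asymp) blast
  define L where "L = ln \<phi>"
  have L: "L > 0" using ln_phi_pos by (simp add: L_def)
  \<comment> \<open>The factor in \<open>s = A / sqrt (ln x)\<close> that results from
    \<open>s = pi / sqrt (6 * y)\<close> and \<open>y = ln x / L\<close>.\<close>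
  define A where "A = pi / sqrt (6 / L)"
  have A: "A > 0" using L by (simp add: A_def)
  define s where "s = (\<lambda>x. A * ln x powr (-1/2))"
  have s_pos: "s x > 0" if "x > 1" for x using that A by (simp add: s_def)
  have "filterlim s (at_right 0) at_top" unfolding s_def using A by real_asymp
  from eventually_compose_filterlim[OF asy this]
  have asy': "\<forall>\<^sub>F x in at_top.
     \<bar>real (card (low_confs (pi\<^sup>2 / (6 * (s x)\<^sup>2)))) * exp (- (pi\<^sup>2 / (3 * s x))) * s x powr (- shift) / \<kappa> - 1\<bar> \<le> c * s x powr (1/5)" .
  \<comment> \<open>\<open>E\<close> is the exact relative deviation, so the final equation is an
    identity for \<open>x > 1\<close>, and only the size of \<open>E\<close> is an asymptotic
    statement.\<close>
  define E where "E = (\<lambda>x. real (card (low_confs (pi\<^sup>2 / (6 * (s x)\<^sup>2)))) * exp (- (pi\<^sup>2 / (3 * s x))) * s x powr (- shift) / \<kappa> - 1)"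
  have "E \<in> O[at_top](\<lambda>x. s x powr (1/5))"
    by (rule bigoI[of _ c]) (use asy' in eventually_elim, simp add: E_def)
  also have "(\<lambda>x. s x powr (1/5)) \<in> O[at_top](\<lambda>x. 1 / (ln x) powr (1 / 10))"
    unfolding s_def using A by real_asymp
  finally have EO: "E \<in> O[at_top](\<lambda>x. 1 / (ln x) powr (1 / 10))" .
  define K0 where "K0 = \<kappa> * A powr shift"
  have ev: "\<forall>\<^sub>F x in at_top. real (card (mult_monoid (lucas_F \<phi> \<psi>) \<inter> {1..x})) =
          K0 * (ln x) powr (- shift / 2) * exp (pi * sqrt (2 * ln x / (3 * ln \<phi>))) * (1 + E x)"
    using eventually_gt_at_top[of 1]
  proof eventually_elim
    case (elim x)
    have lx: "ln x > 0" using elim by simp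
    have s2: "(s x)\<^sup>2 = A\<^sup>2 / ln x"
      using lx by (simp add: s_def power_mult_distrib power2_eq_square powr_minus_divide flip: powr_add)
    have A2: "A\<^sup>2 = pi\<^sup>2 * L / 6" using L by (simp add: A_def power_divide)
    have y: "pi\<^sup>2 / (6 * (s x)\<^sup>2) = ln x / L" unfolding s2 A2 using L lx by (simp add: field_simps)
    have e: "pi\<^sup>2 / (3 * s x) = pi * sqrt (2 * ln x / (3 * ln \<phi>))"
    proof -
      have "pi * sqrt (2 * ln x / (3 * L)) = sqrt ((pi\<^sup>2 / (3 * s x))\<^sup>2)"
      proof -
        have "(pi\<^sup>2 / (3 * s x))\<^sup>2 = pi\<^sup>2 * (2 * ln x / (3 * L))"
          unfolding power_divide power_mult_distrib s2 A2 using L lx by (simp add: field_simps power2_eq_square)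
        then have "sqrt ((pi\<^sup>2 / (3 * s x))\<^sup>2) = sqrt (pi\<^sup>2) * sqrt (2 * ln x / (3 * L))" by (simp only: real_sqrt_mult)
        then show ?thesis by simp
      qed
      also have "\<dots> = pi\<^sup>2 / (3 * s x)" using s_pos[OF elim] by simp
      finally show ?thesis by (simp add: L_def)
    qed
    have sp: "s x powr (- shift) = A powr (- shift) * ln x powr (shift / 2)"
      using A by (simp add: s_def powr_mult powr_powr)
    have cm: "card (mult_monoid (lucas_F \<phi> \<psi>) \<inter> {1..x}) = card (low_confs (ln x / L))"
      using card_monoid[of x] elim by (simp add: L_def)
    have ex: "exp (pi * sqrt (2 * ln x / (3 * ln \<phi>))) * exp (- (pi\<^sup>2 / (3 * s x))) = 1"
      unfolding e by (simp flip: exp_add)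
    have p1: "A powr shift * A powr (- shift) = 1" using A by (simp flip: powr_add)
    have p2: "ln x powr (- shift / 2) * ln x powr (shift / 2) = 1" using lx by (simp flip: powr_add)
    define N where "N = real (card (low_confs (ln x / L)))"
    have "1 + E x = N * exp (- (pi\<^sup>2 / (3 * s x))) * (A powr (- shift) * ln x powr (shift / 2)) / \<kappa>"
      by (simp add: E_def y sp N_def)
    then have "K0 * (ln x) powr (- shift / 2) * exp (pi * sqrt (2 * ln x / (3 * ln \<phi>))) * (1 + E x)
      = N * (exp (pi * sqrt (2 * ln x / (3 * ln \<phi>))) * exp (- (pi\<^sup>2 / (3 * s x)))) * (A powr shift * A powr (- shift)) * (ln x powr (- shift / 2) * ln x powr (shift / 2))"
      using \<kappa> by (simp add: K0_def)
    also have "\<dots> = N" unfolding ex p1 p2 by simp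
    finally show ?case using cm by (simp add: N_def)
  qed
  have k1: "- shift / 2 = (real (card (lucas_F0 \<phi> \<psi>)) - 13) / 2 + ln (\<phi> - \<psi>) / (2 * ln \<phi>)"
    unfolding card_lucas_F0 small_count_def[symmetric] shift_def by (simp add: field_simps)
  show ?thesis
    by (rule exI[of _ K0], rule exI[of _ "- shift / 2"], rule conjI[OF k1], rule exI[of _ E], rule conjI[OF EO ev])
qed

end

theorem theorem1:
  fixes \<phi> \<psi> :: real and P Q :: int
  assumes "algebraic_int \<phi>" and "algebraic_int \<psi>"
    and "\<phi> + \<psi> = of_int P" and "\<phi> * \<psi> = of_int Q"
    and "P \<noteq> 0" and "Q \<noteq> 0" and "coprime P Q"
    and "\<phi> > \<bar>\<psi>\<bar>"
  shows "\<exists>k0 k1 :: real.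
    k1 = (real (card (lucas_F0 \<phi> \<psi>)) - 13) / 2 + ln (\<phi> - \<psi>) / (2 * ln \<phi>) \<and>
    (\<exists>E :: real \<Rightarrow> real. E \<in> O[at_top](\<lambda>x. 1 / (ln x) powr (1 / 10)) \<and>
      (\<forall>\<^sub>F x in at_top.
        real (card (mult_monoid (lucas_F \<phi> \<psi>) \<inter> {1..x})) =
          k0 * (ln x) powr k1 * exp (pi * sqrt (2 * ln x / (3 * ln \<phi>))) * (1 + E x)))"
proof -
  interpret lucas_pair \<phi> \<psi> P Q by unfold_locales (use assms in auto)
  show ?thesis by (rule main_asymptotics)
qed

end
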